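(* Let $k\ge 2$ be an even integer and let $r\neq -1$ be an odd integer. For every $x>0$, \begin{align*} \sum_{n=1}^{\infty} D_{k,r}(n) e^{-nx} =& -\frac{1}{2}\zeta(-r)+\frac{1}{k}\Gamma\left(\frac{1}{k}\right)\zeta\left(\frac{1}{k}-r\right)x^{-\frac{1}{k}}+R_{1+r} +\frac{(-1)^{\frac{2k+r-1}{2}} (2\pi)^{\frac{k+1-2r}{2}}}{x\,k^{\frac{2k-1}{2}}}\\ &\times \sum_{\substack{j=-(k-1)\\ j\equiv k-1 \ (\mathrm{mod}\ 2)}}^{k-1} i^j \sum_{n=1}^{\infty} S_{k,r}(n)\, G_{0,k}^{\,k,0} \!\left( \,\begin{matrix}-\\ r,-\frac{1}{k},\dots ,-\frac{k-1}{k} \end{matrix} \; \Big|X(j) \right), \end{align*} where $X(j)=\dfrac{e^{-\frac{i\pi j}{2}} (2\pi)^{k+1}n}{k^{k} x}$ and $$R_{1+r}=\begin{cases} r!\,\zeta(k(1+r))\,x^{-(1+r)}, & r\ge 0,\\[2pt] \dfrac{(-1)^{1+r}}{(-(1+r))!}\,k\,\zeta'(k(1+r))\,x^{-(1+r)}, & r<0.\end{cases}$$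
   Context: $\zeta$ is the Riemann zeta function and $\Gamma$ the gamma function. For $k\in\mathbb{N}$, $r\in\mathbb{Z}$ define $D_{k,r}(n)=\sum_{d\ge1,\ d^k\mid n}\left(\frac{n}{d^k}\right)^r$ and $S_{k,r}(n)=\sum_{d\ge1,\ d^k\mid n}\left(\frac{n}{d^k}\right)^{-r}d^{k-1}$. The sum over $j$ runs over $j=-(k-1),-(k-3),\dots,k-3,k-1$. For complex $b_1,\dots,b_k$ the Meijer $G$-function is $G_{0,k}^{\,k,0}\!\left(\begin{matrix}-\\ b_1,\dots,b_k\end{matrix}\Big| z\right)=\frac{1}{2\pi i}\int_L \prod_{j=1}^k\Gamma(b_j+s)\,z^{-s}\,ds$, where $L$ is a vertical line lying to the right of all poles of the integrand, and $z^{-s}$ uses the principal branch; it converges for $|\arg z|<k\pi/2$.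
   Formalization: In the G-function, z^{-s} at z = X(j) is computed with arg X(j) = -πj/2 (on the Riemann surface of the logarithm) instead of the principal branch; the two agree for k = 2, and for k ≥ 4 the principal-branch identity fails for some x. *)

theory Defs
  imports "HOL-Complex_Analysis.Complex_Analysis" "HOL-Number_Theory.Cong"
begin

(* The analytic continuation of the Dirichlet series to the plane without 1. The clause "f 1 = 0"
   only fixes the value at the pole, so that the function is unique. *)
definition zeta :: "complex \<Rightarrow> complex" where
  "zeta = (THE f. f holomorphic_on (- {1}) \<and> f 1 = 0 \<and>
                  (\<forall>s. 1 < Re s \<longrightarrow> (\<lambda>n. 1 / of_nat (Suc n) powr s) sums f s))"

definition D_sum :: "nat \<Rightarrow> int \<Rightarrow> nat \<Rightarrow> real" where
  "D_sum k r n = (\<Sum>d | 1 \<le> d \<and> d ^ k dvd n. (real n / real (d ^ k)) powi r)"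

definition S_sum :: "nat \<Rightarrow> int \<Rightarrow> nat \<Rightarrow> real" where
  "S_sum k r n = (\<Sum>d | 1 \<le> d \<and> d ^ k dvd n. (real n / real (d ^ k)) powi (- r) * real d ^ (k - 1))"

(* polar_power \<rho> \<theta> s is z^s for z = \<rho> e^(i\<theta>), \<rho> > 0, computed with arg z = \<theta>, where \<theta> is any real number
   (z is a point of the Riemann surface of the logarithm). For -\<pi> < \<theta> \<le> \<pi> this is the principal
   branch. *)
definition polar_power :: "real \<Rightarrow> real \<Rightarrow> complex \<Rightarrow> complex" where
  "polar_power \<rho> \<theta> s = exp (s * Complex (ln \<rho>) \<theta>)"

lemma polar_power_principal:
  assumes "0 < \<rho>" "- pi < \<theta>" "\<theta> \<le> pi"
  shows "polar_power \<rho> \<theta> s = rcis \<rho> \<theta> powr s"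
proof -
  have 1: "rcis \<rho> \<theta> = exp (Complex (ln \<rho>) \<theta>)"
    using assms by (simp add: rcis_def exp_eq_polar)
  have "Ln (rcis \<rho> \<theta>) = Complex (ln \<rho>) \<theta>"
    unfolding 1 using assms by (intro Ln_exp) auto
  moreover have "rcis \<rho> \<theta> \<noteq> 0"
    unfolding 1 by simp
  ultimately show ?thesis
    by (simp add: polar_power_def powr_def)
qed

(* meijer_G bs \<rho> \<theta> is the Meijer function G_{0,k}^{k,0} with lower parameters bs = [b_1, ..., b_k] at
   z = \<rho> e^(i\<theta>), arg z = \<theta>. The range |\<theta>| < k\<pi>/2 of convergence exceeds (-\<pi>, \<pi>] for k > 2, so the
   function lives on the Riemann surface of the logarithm and the argument is kept explicit.
   The vertical line L is s = c + it with c to the right of all poles of the integrand, and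
   ds / (2\<pi>i) = dt / (2\<pi>). The value does not depend on c. *)
definition meijer_G :: "complex list \<Rightarrow> real \<Rightarrow> real \<Rightarrow> complex" where
  "meijer_G bs \<rho> \<theta> =
     (THE I. \<forall>c. (\<forall>b\<in>set bs. - Re b < c) \<longrightarrow>
        ((\<lambda>t. (\<Prod>b\<leftarrow>bs. Gamma (b + Complex c t)) * polar_power \<rho> \<theta> (- Complex c t) / (2 * of_real pi))
           has_integral I) UNIV)"

definition R_term :: "nat \<Rightarrow> int \<Rightarrow> real \<Rightarrow> complex" where
  "R_term k r x =
     (if r \<ge> 0
      then fact (nat r) * zeta (of_int (int k * (1 + r))) * of_real (x powi (- (1 + r)))
      else (- 1) powi (1 + r) / fact (nat (- (1 + r))) * of_nat k
             * deriv zeta (of_int (int k * (1 + r))) * of_real (x powi (- (1 + r))))"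

(* X(j) = X_abs k x n * e^(i X_arg j) *)
definition X_abs :: "nat \<Rightarrow> real \<Rightarrow> nat \<Rightarrow> real" where
  "X_abs k x n = (2 * pi) ^ (k + 1) * real n / (real k ^ k * x)"

definition X_arg :: "int \<Rightarrow> real" where
  "X_arg j = - (pi * of_int j / 2)"

lemma rcis_X:
  "rcis (X_abs k x n) (X_arg j) =
     exp (- (\<i> * of_real pi * of_int j / 2)) * (2 * of_real pi) ^ (k + 1) * of_nat n / (of_nat k ^ k * of_real x)"
proof -
  have "cis (X_arg j) = exp (- (\<i> * of_real pi * of_int j / 2))"
    by (simp add: cis_conv_exp X_arg_def mult.assoc)
  then show ?thesis
    by (simp add: rcis_def X_abs_def mult.commute mult.assoc)
qed

end

(*
  With (k, r, x) fixed, the left-hand side is the Mellin-Barnes integral of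
  Phi(s) = Gamma(s) zeta(ks) zeta(s - r) x^(-s) along a line Re s = c to the right of all poles:
  expand both zeta functions and use the Cahen-Mellin integral for exp(-nx).  Moving the line to
  Re s = 1 - c picks up the residues at s = 0, 1/k and 1 + r.  The other poles of Gamma are
  cancelled by the trivial zeros of zeta(ks), since k is even; for r < 0 the pole of Gamma at 1 + r
  meets such a zero and the pole of zeta(s - r), which gives the term with zeta'.

  On the new line put s = 1 - u.  The functional equation of zeta, the reflection formula and the
  multiplication formula of Gauss turn Phi(1 - u) into the product of the gamma factors of the Meijer
  function, of zeta(ku - k + 1) zeta(u + r), which is the Dirichlet series of S_{k,r}, and of a
  quotient sin(k phi) / cos(phi), phi = pi u / 2.  As k is even, this quotient is a Laurent polynomial
  in i exp(i phi); its monomials are the rotations exp(-i pi j / 2) of the argument X(j).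

  The zeta function is continued to Re s > -1 by summing the errors of the trapezoidal rule for u^(-s),
  which also bounds it polynomially, and to the whole plane by the functional equation.  The latter
  is first proved for real s in (-1, 0): there Gamma(s) zeta(s) is the Mellin transform of
  1/(e^x - 1) - 1/x + 1/2, whose partial fraction expansion can be integrated term by term.
*)
theory Submission
  imports Defs "HOL-Computational_Algebra.Fundamental_Theorem_Algebra"
begin

section \<open>Shifting vertical lines of integration\<close>

text \<open>Convergence rests on a balance of exponentials in t = Im s. On vertical lines Gamma
  decays like exp(-pi |t| / 2) and zeta grows at most polynomially, so the single gamma factor of
  Phi suffices. A Meijer integrand has k gamma factors, while the rotation of its argument costs at
  most exp((k - 1) pi |t| / 2), as |j| <= k - 1; a margin of pi / 2 remains. The abscissa c = |r| +
  5/2 is large enough for the Dirichlet series of both \<open>D_sum\<close> and \<open>S_sum\<close>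
  to converge absolutely. The modulus of n^(-s) is constant on a vertical line, so the terms are
  dominated by a summable sequence times one integrable function. On the real interval (-1, 0) all
  integrands leading to the functional equation can be taken nonnegative, so Tonelli's theorem
  replaces estimates; the identity theorem does the rest. As \<open>zeta\<close> and
  \<open>meijer_G\<close> are defined by descriptions, existence and uniqueness must be settled
  before their values can be used.\<close>

lemma integrable_inverse_one_plus_square:
  "integrable lborel (\<lambda>t::real. 1 / (1 + t\<^sup>2))"
proof -
  have pos: "0 < 1 + t\<^sup>2" for t :: real
    by (simp add: add_pos_nonneg)
  have "set_integrable lborel (einterval (-\<infinity>) \<infinity>) (\<lambda>t::real. 1 / (1 + t\<^sup>2))"
  proof (rule interval_integral_FTC_nonneg(1)[where F = arctan])
    show "DERIV arctan x :> 1 / (1 + x\<^sup>2)" for x :: real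
      by (rule DERIV_cong[OF DERIV_arctan]) (simp add: inverse_eq_divide)
    show "isCont (\<lambda>t. 1 / (1 + t\<^sup>2)) x" for x :: real
      using pos[of x] by (intro continuous_intros) auto
    show "((arctan \<circ> real_of_ereal) \<longlongrightarrow> - (pi / 2)) (at_right (-\<infinity>))"
      unfolding ereal_tendsto_simps1 by (rule tendsto_arctan_at_bot)
    show "((arctan \<circ> real_of_ereal) \<longlongrightarrow> pi / 2) (at_left \<infinity>)"
      unfolding ereal_tendsto_simps1 by (rule tendsto_arctan_at_top)
  qed auto
  then show ?thesis
    by (simp add: set_integrable_def einterval_eq)
qed

text \<open>In the applications the poles are real, so decay is available only away from the real
  axis; on the compact remainder of the line continuity bounds the integrand.\<close>

lemma integrable_of_inverse_square_decay:
  fixes g :: "real \<Rightarrow> complex"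
  assumes cont: "continuous_on UNIV g"
    and bound: "\<And>t. 1 \<le> \<bar>t\<bar> \<Longrightarrow> norm (g t) \<le> C / (1 + t\<^sup>2)"
  shows "integrable lborel g"
proof -
  have "bounded (g ` {-1..1})"
    by (intro compact_imp_bounded compact_continuous_image continuous_on_subset[OF cont]) auto
  then obtain M where M: "\<And>t. t \<in> {-1..1} \<Longrightarrow> norm (g t) \<le> M" and M0: "M > 0"
    unfolding bounded_pos by (metis imageI)
  define K where "K = \<bar>C\<bar> + 2 * M"
  have "\<bar>K\<bar> = K"
    using M0 by (simp add: K_def)
  have pos: "0 < 1 + t\<^sup>2" for t :: real
    by (simp add: add_pos_nonneg)
  have le: "norm (g t) \<le> K * (1 / (1 + t\<^sup>2))" for t
  proof (cases "1 \<le> \<bar>t\<bar>")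
    case True
    have "norm (g t) \<le> C / (1 + t\<^sup>2)"
      using bound[OF True] .
    also have "\<dots> \<le> K / (1 + t\<^sup>2)"
      using pos[of t] M0 by (intro divide_right_mono) (auto simp: K_def)
    finally show ?thesis by simp
  next
    case False
    then have "t\<^sup>2 \<le> 1"
      by (simp add: abs_square_le_1)
    then have "M * (1 + t\<^sup>2) \<le> M * 2"
      using M0 by (intro mult_left_mono) auto
    then have "M * (1 + t\<^sup>2) \<le> K"
      by (simp add: K_def)
    then have "M \<le> K / (1 + t\<^sup>2)"
      using pos[of t] by (simp add: pos_le_divide_eq)
    moreover have "norm (g t) \<le> M"
      using M[of t] False by (auto simp: abs_less_iff not_le)
    ultimately show ?thesis by simp
  qed
  have "g \<in> borel_measurable lborel"
    using borel_measurable_continuous_onI[OF cont] by simp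
  moreover have "integrable lborel (\<lambda>t. K * (1 / (1 + t\<^sup>2)))"
    by (intro integrable_mult_right integrable_inverse_one_plus_square)
  ultimately show ?thesis
        by (intro Bochner_Integration.integrable_bound[where g = g and f = "\<lambda>t. K * (1 / (1 + t\<^sup>2))"] AE_I2)
       (use le \<open>\<bar>K\<bar> = K\<close> in auto)
qed

text \<open>Links the two integrals in use: contour integrals give Henstock-Kurzweil integrals over
  compact intervals, while the shifted lines carry Lebesgue integrals.\<close>

lemma tendsto_integral_symmetric_interval:
  fixes g :: "real \<Rightarrow> complex"
  assumes cont: "continuous_on UNIV g" and int: "integrable lborel g"
  shows "(\<lambda>n. integral {- real n..real n} g) \<longlonglongrightarrow> integral\<^sup>L lborel g"
proof -
  have "(\<lambda>n. integral\<^sup>L lborel (\<lambda>t. indicator {- real n..real n} t *\<^sub>R g t)) \<longlonglongrightarrow> integral\<^sup>L lborel g"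
  proof (rule integral_dominated_convergence[where w = "\<lambda>t. norm (g t)"])
    show "g \<in> borel_measurable lborel" "integrable lborel (\<lambda>t. norm (g t))"
      using int by auto
    show "AE t in lborel. (\<lambda>n. indicator {- real n..real n} t *\<^sub>R g t) \<longlonglongrightarrow> g t"
    proof (rule AE_I2)
      fix t :: real
      obtain m :: nat where "\<bar>t\<bar> \<le> real m"
        using real_arch_simple by blast
      then have "\<forall>\<^sub>F n in sequentially. indicator {- real n..real n} t *\<^sub>R g t = g t"
        by (intro eventually_sequentiallyI[of m]) (auto simp: indicator_def)
      then show "(\<lambda>n. indicator {- real n..real n} t *\<^sub>R g t) \<longlonglongrightarrow> g t"
        by (rule tendsto_eventually)
    qed
    show "AE t in lborel. norm (indicator {- real n..real n} t *\<^sub>R g t) \<le> norm (g t)" for n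
      by (auto intro!: AE_I2 simp: indicator_def)
  qed (use int in auto)
  moreover have "integral\<^sup>L lborel (\<lambda>t. indicator {- real n..real n} t *\<^sub>R g t) = integral {- real n..real n} g" for n
  proof -
    have "set_integrable lborel {- real n..real n} g"
      by (intro borel_integrable_atLeastAtMost' continuous_on_subset[OF cont]) auto
    from set_borel_integral_eq_integral(2)[OF this] show ?thesis
      by (simp add: set_lebesgue_integral_def)
  qed
  ultimately show ?thesis by simp
qed

lemma Complex_line_continuous: "continuous_on A (\<lambda>t. Complex c t)"
  unfolding Complex_eq by (intro continuous_intros)

text \<open>Residue theorem on the rectangles [a, b] x [-n, n]: the horizontal sides have length b -
  a, and the integrand there is O(1 / n^2). The factor is 2 pi instead of 2 pi i because ds = i dt
  on vertical lines. The slack a' < a and b < b' supplies the open strip in which the residue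
  theorem operates.\<close>

theorem vertical_line_shift:
  fixes f :: "complex \<Rightarrow> complex"
  assumes ab: "a < b" and a': "a' < a" and b': "b < b'"
    and P: "finite P" "\<And>p. p \<in> P \<Longrightarrow> a < Re p \<and> Re p < b"
    and holo: "f holomorphic_on {s. a' < Re s \<and> Re s < b'} - P"
    and bound: "\<And>s. a \<le> Re s \<Longrightarrow> Re s \<le> b \<Longrightarrow> 1 \<le> \<bar>Im s\<bar> \<Longrightarrow> norm (f s) \<le> C / (1 + (Im s)\<^sup>2)"
  shows "integrable lborel (\<lambda>t. f (Complex a t))"
    and "integrable lborel (\<lambda>t. f (Complex b t))"
    and "integral\<^sup>L lborel (\<lambda>t. f (Complex b t)) - integral\<^sup>L lborel (\<lambda>t. f (Complex a t))
           = 2 * of_real pi * (\<Sum>p\<in>P. residue f p)"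
proof -
  let ?R = "\<Sum>p\<in>P. residue f p" and ?f = "\<lambda>c t. f (Complex c t)"
  let ?I = "\<lambda>c. integral\<^sup>L lborel (?f c)" and ?J = "\<lambda>n c. integral {- real n..real n} (?f c)"
  define S where "S = {s. a' < Re s \<and> Re s < b'}"
  have S_eq: "S = {s. Re s > a'} \<inter> {s. Re s < b'}"
    by (auto simp: S_def)
  have S: "open S" "convex S"
    unfolding S_eq by (auto intro!: open_Int convex_Int open_halfspace_Re_gt open_halfspace_Re_lt
        convex_halfspace_Re_gt convex_halfspace_Re_lt)
  have cont: "continuous_on (S - P) f"
    using holo unfolding S_def by (rule holomorphic_on_imp_continuous_on)
  have line: "continuous_on UNIV (?f c)" if "c = a \<or> c = b" for c
    by (rule continuous_on_compose2[OF cont Complex_line_continuous]) (use that ab a' b' P in \<open>force simp: S_def\<close>)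
  have int: "integrable lborel (?f c)" if "c = a \<or> c = b" for c
    by (rule integrable_of_inverse_square_decay[OF line[OF that]]) (use bound[of "Complex c _"] that ab in auto)
  show "integrable lborel (?f a)" "integrable lborel (?f b)"
    by (simp_all add: int)
  obtain B where B: "\<And>p. p \<in> P \<Longrightarrow> norm p \<le> B"
    using finite_imp_bounded[OF P(1)] unfolding bounded_iff by blast
  \<comment> \<open>From height T0 on the rectangle encloses all of P, and T0 > 1 puts its
    horizontal sides into the range of the decay bound.\<close>
  obtain T0 :: nat where T0': "max B 1 < real T0"
    using reals_Archimedean2 by blast
  then have T0: "\<bar>Im p\<bar> < real T0" if "p \<in> P" for p
    using B[OF that] abs_Im_le_cmod[of p] by linarith
  have rect: "norm (\<i> * (?J n b - ?J n a)
       - 2 * of_real pi * \<i> * ?R) \<le> 2 * (\<bar>C\<bar> * (b - a)) / (1 + (real n)\<^sup>2)"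
    if n: "n \<ge> T0" for n
  proof -
    define T where "T = real n"
    have T1: "T \<ge> 1"
      using n T0' by (simp add: T_def)
    have T2: "\<bar>Im p\<bar> < T" if "p \<in> P" for p
      using T0[OF that] n by (simp add: T_def)
    note T = T1 T2
    define a1 a2 a3 a4 where "a1 = Complex a (-T)" "a2 = Complex b (-T)" "a3 = Complex b T" "a4 = Complex a T"
    note defs = this
    have sub: "path_image (rectpath a1 a3) \<subseteq> S - P"
      using ab a' b' P T by (auto simp: path_image_rectpath defs S_def; fastforce)
    have wn: "winding_number (rectpath a1 a3) p = 1" if "p \<in> P" for p
      using P(2)[OF that] T(2)[OF that] by (intro winding_number_rectpath) (auto simp: defs in_box_complex_iff)
    have "contour_integral (rectpath a1 a3) f
          = 2 * pi * \<i> * (\<Sum>p\<in>P. winding_number (rectpath a1 a3) p * residue f p)"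
    proof (rule Residue_theorem[of S])
      show "connected S" using S(2) by (rule convex_connected)
      show "f holomorphic_on S - P" using holo by (simp add: S_def)
      show "\<forall>z. z \<notin> S \<longrightarrow> winding_number (rectpath a1 a3) z = 0"
        by (intro allI impI winding_number_zero_outside[OF _ S(2)]) (use sub in auto)
    qed (use S P sub in auto)
    also have "(\<Sum>p\<in>P. winding_number (rectpath a1 a3) p * residue f p) = ?R"
      by (intro sum.cong) (auto simp: wn)
    finally have res: "contour_integral (rectpath a1 a3) f = 2 * pi * \<i> * ?R" .
    have segs: "closed_segment a1 a2 \<subseteq> S - P" "closed_segment a2 a3 \<subseteq> S - P"
      "closed_segment a3 a4 \<subseteq> S - P" "closed_segment a4 a1 \<subseteq> S - P"
      using sub unfolding rectpath_def Let_def by (auto simp: path_image_join defs)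
    have ci: "f contour_integrable_on linepath u v" if "closed_segment u v \<subseteq> S - P" for u v
      using that by (intro contour_integrable_continuous_linepath continuous_on_subset[OF cont])
    have split: "contour_integral (rectpath a1 a3) f = contour_integral (linepath a1 a2) f
       + (contour_integral (linepath a2 a3) f + (contour_integral (linepath a3 a4) f + contour_integral (linepath a4 a1) f))"
      using ci[OF segs(1)] ci[OF segs(2)] ci[OF segs(3)] ci[OF segs(4)]
      unfolding rectpath_def Let_def by (simp add: defs)
    have v1: "contour_integral (linepath a2 a3) f = \<i> * integral {-T..T} (?f b)"
      using T(1) by (intro contour_integral_linepath_same_Re) (auto simp: defs)
    have "contour_integral (linepath a1 a4) f = \<i> * integral {-T..T} (?f a)"
      using T(1) by (intro contour_integral_linepath_same_Re) (auto simp: defs)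
    then have v2: "contour_integral (linepath a4 a1) f = - (\<i> * integral {-T..T} (?f a))"
      by (metis contour_integral_reversepath reversepath_linepath valid_path_linepath)
    have h: "norm (contour_integral (linepath u v) f) \<le> \<bar>C\<bar> * (b - a) / (1 + T\<^sup>2)"
      if "closed_segment u v \<subseteq> S - P" "Im u = Im v" "\<bar>Im u\<bar> = T" "Re u \<in> {a..b}" "Re v \<in> {a..b}" "norm (v - u) = b - a" for u v
    proof -
      have "norm (contour_integral (linepath u v) f) \<le> \<bar>C\<bar> / (1 + T\<^sup>2) * norm (v - u)"
      proof (rule has_contour_integral_bound_linepath[OF has_contour_integral_integral[OF ci[OF that(1)]]])
        show "0 \<le> \<bar>C\<bar> / (1 + T\<^sup>2)" by (simp add: add_nonneg_nonneg)
        fix s assume s: "s \<in> closed_segment u v"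
        have conv: "convex {s. a \<le> Re s \<and> Re s \<le> b}"
          using convex_Int[OF convex_halfspace_Re_ge[of a] convex_halfspace_Re_le[of b]] by (simp add: Int_def)
        have "closed_segment u v \<subseteq> {s. a \<le> Re s \<and> Re s \<le> b}"
          by (rule closed_segment_subset[OF _ _ conv]) (use that in auto)
        then have re: "a \<le> Re s" "Re s \<le> b" using s by auto
        have "Im s = Im u"
          using s that(2) by (auto simp: closed_segment_same_Im)
        then have im: "\<bar>Im s\<bar> = T" using that by simp
        then have "(Im s)\<^sup>2 = T\<^sup>2" by (metis power2_abs)
        have "norm (f s) \<le> C / (1 + (Im s)\<^sup>2)"
          using re im T by (intro bound) auto
        also have "\<dots> \<le> \<bar>C\<bar> / (1 + T\<^sup>2)"
          unfolding \<open>(Im s)\<^sup>2 = T\<^sup>2\<close> by (intro divide_right_mono) (auto simp: add_nonneg_nonneg)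
        finally show "norm (f s) \<le> \<bar>C\<bar> / (1 + T\<^sup>2)" .
      qed
      then show ?thesis using that by simp
    qed
    have ncx: "norm (Complex x y - Complex x' y) = \<bar>x - x'\<bar>" for x x' y
      by (simp add: cmod_def)
    have h1: "norm (contour_integral (linepath a1 a2) f) \<le> \<bar>C\<bar> * (b - a) / (1 + T\<^sup>2)"
      by (rule h) (use segs T ab in \<open>auto simp: defs ncx\<close>)
    have h2: "norm (contour_integral (linepath a3 a4) f) \<le> \<bar>C\<bar> * (b - a) / (1 + T\<^sup>2)"
      by (rule h) (use segs T ab in \<open>auto simp: defs ncx\<close>)
    have "\<i> * (integral {- T..T} (?f b) - integral {- T..T} (?f a))
       - 2 * of_real pi * \<i> * ?R
       = - (contour_integral (linepath a1 a2) f + contour_integral (linepath a3 a4) f)"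
      using split unfolding res v1 v2 by (simp add: algebra_simps)
    also have "norm \<dots> \<le> \<bar>C\<bar> * (b - a) / (1 + T\<^sup>2) + \<bar>C\<bar> * (b - a) / (1 + T\<^sup>2)"
      unfolding norm_minus_cancel using h1 h2 by (intro norm_triangle_mono)
    finally show ?thesis by (simp add: T_def)
  qed
  define L where "L = ?I b - ?I a"
  define E where "E n = \<i> * (?J n b - ?J n a)
       - 2 * of_real pi * \<i> * ?R" for n :: nat
  have "E \<longlonglongrightarrow> \<i> * L - 2 * of_real pi * \<i> * ?R"
    unfolding E_def L_def
    by (intro tendsto_intros tendsto_integral_symmetric_interval line int) auto
  moreover have "E \<longlonglongrightarrow> 0"
  proof (rule Lim_null_comparison)
    show "\<forall>\<^sub>F n in sequentially. norm (E n) \<le> 2 * (\<bar>C\<bar> * (b - a)) / (1 + (real n)\<^sup>2)"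
      using rect unfolding E_def by (intro eventually_sequentiallyI[of T0])
    have "filterlim (\<lambda>n. 1 + (real n)\<^sup>2) at_top sequentially"
      by (intro filterlim_tendsto_add_at_top[OF tendsto_const] filterlim_pow_at_top filterlim_real_sequentially) auto
    then show "(\<lambda>n. 2 * (\<bar>C\<bar> * (b - a)) / (1 + (real n)\<^sup>2)) \<longlonglongrightarrow> 0"
      by (intro tendsto_divide_0[OF tendsto_const] filterlim_at_top_imp_at_infinity)
  qed
  ultimately have "\<i> * L - 2 * of_real pi * \<i> * ?R = 0"
    by (rule LIMSEQ_unique)
  then have "\<i> * (L - 2 * of_real pi * ?R) = 0"
    by (simp add: algebra_simps)
  then show "?I b - ?I a
           = 2 * of_real pi * ?R"
    by (simp add: L_def)
qed

section \<open>Decay of the gamma function in vertical strips\<close>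

lemma power_times_exp_decay:
  fixes \<delta> :: real
  assumes "\<delta> > 0"
  shows "\<exists>C>0. \<forall>t. 1 \<le> \<bar>t\<bar> \<longrightarrow> \<bar>t\<bar> ^ N * exp (- \<delta> * \<bar>t\<bar>) \<le> C / (1 + t\<^sup>2)"
proof -
  \<comment> \<open>The bound (1 + y / m)^m <= exp y with y = delta |t| controls |t|^m; the two
    powers beyond N produce the factor 1 / (1 + t^2).\<close>
  define m where "m = N + 2"
  define K where "K = (real m / \<delta>) ^ m"
  have K: "K > 0"
    using assms by (simp add: K_def m_def)
  have "\<bar>t\<bar> ^ N * exp (- \<delta> * \<bar>t\<bar>) \<le> 2 * K / (1 + t\<^sup>2)" if t: "1 \<le> \<bar>t\<bar>" for t :: real
  proof -
    have "(\<delta> * \<bar>t\<bar> / real m) ^ m \<le> (1 + \<delta> * \<bar>t\<bar> / real m) ^ m"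
      using assms by (intro power_mono) auto
    also have "\<dots> \<le> exp (\<delta> * \<bar>t\<bar>)"
      using assms by (intro exp_ge_one_plus_x_over_n_power_n) (auto simp: m_def intro: order_trans[of _ 0])
    finally have "\<bar>t\<bar> ^ m / K \<le> exp (\<delta> * \<bar>t\<bar>)"
      by (simp add: K_def power_divide power_mult_distrib field_simps)
    then have "\<bar>t\<bar> ^ m * exp (- (\<delta> * \<bar>t\<bar>)) \<le> K"
      using K by (simp add: exp_minus field_simps)
    moreover have "\<bar>t\<bar> ^ m = \<bar>t\<bar> ^ N * t\<^sup>2"
      by (simp add: m_def power_add power2_eq_square flip: abs_mult)
    ultimately have "\<bar>t\<bar> ^ N * exp (- (\<delta> * \<bar>t\<bar>)) * t\<^sup>2 \<le> K"
      by (simp add: mult_ac)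
    moreover have "1 \<le> t\<^sup>2"
      using t by (metis one_le_power power2_abs)
    then have "\<bar>t\<bar> ^ N * exp (- (\<delta> * \<bar>t\<bar>)) * (1 + t\<^sup>2) \<le> \<bar>t\<bar> ^ N * exp (- (\<delta> * \<bar>t\<bar>)) * (2 * t\<^sup>2)"
      by (intro mult_left_mono) auto
    ultimately have "\<bar>t\<bar> ^ N * exp (- (\<delta> * \<bar>t\<bar>)) * (1 + t\<^sup>2) \<le> 2 * K"
      by linarith
    then show ?thesis
      by (simp add: pos_le_divide_eq add_pos_nonneg)
  qed
  then show ?thesis
    using K by (intro exI[of _ "2 * K"]) auto
qed

text \<open>Every factor $(a + j) / |a + j + \mathrm{i} t|$ of the Euler product for $|\Gamma(a + \mathrm{i} t)| / \Gamma(a)$ increases with $a$.\<close>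

lemma norm_Gamma_ratio_mono:
  assumes "0 < a" "a \<le> b"
  shows "norm (Gamma (Complex a t)) / Gamma a \<le> norm (Gamma (Complex b t)) / Gamma b"
proof -
  \<comment> \<open>The factors n! n^(c + it) and n! n^c have the same modulus, so only the
    Pochhammer denominators survive in the quotient.\<close>
  have eq: "norm (Gamma_series (Complex c t) n) / Gamma_series c n
       = (\<Prod>i = 0..<n+1. (c + real i) / norm (Complex (c + real i) t))" if "c > 0" for c n
  proof -
    have "norm (pochhammer (Complex c t) (n+1)) = (\<Prod>i = 0..<n+1. norm (Complex (c + real i) t))"
      unfolding pochhammer_prod prod_norm[symmetric]
      by (intro prod.cong refl arg_cong[of _ _ norm]) (simp add: complex_eq_iff)
    moreover have "pochhammer c (n+1) > 0"
      using that by (intro pochhammer_pos)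
    moreover have "pochhammer c (n+1) = (\<Prod>i = 0..<n+1. c + real i)"
      by (simp add: pochhammer_prod)
    ultimately show ?thesis
      by (simp add: Gamma_series_def norm_mult norm_divide prod_dividef del: pochhammer_Suc prod.op_ivl_Suc)
  qed
  have le: "u / norm (Complex u t) \<le> v / norm (Complex v t)" if "0 < u" "u \<le> v" for u v
  proof -
    have "u\<^sup>2 * t\<^sup>2 \<le> v\<^sup>2 * t\<^sup>2"
      using that by (intro mult_right_mono power_mono) auto
    moreover have "(norm (Complex w t))\<^sup>2 = w\<^sup>2 + t\<^sup>2" for w
      by (simp add: cmod_def)
    ultimately have "(u * norm (Complex v t))\<^sup>2 \<le> (v * norm (Complex u t))\<^sup>2"
      unfolding power_mult_distrib by (simp add: distrib_left)
    then have "u * norm (Complex v t) \<le> v * norm (Complex u t)"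
      by (rule power2_le_imp_le) (use that in auto)
    moreover have "norm (Complex u t) > 0" "norm (Complex v t) > 0"
      using that by (auto simp: complex_eq_iff)
    ultimately show ?thesis
      by (simp add: field_simps)
  qed
  show ?thesis
  proof (rule LIMSEQ_le)
    show "(\<lambda>n. norm (Gamma_series (Complex a t) n) / Gamma_series a n) \<longlonglongrightarrow> norm (Gamma (Complex a t)) / Gamma a"
      using Gamma_real_pos[of a] assms by (intro tendsto_intros Gamma_series_LIMSEQ) (metis less_irrefl less_le_trans)
    show "(\<lambda>n. norm (Gamma_series (Complex b t) n) / Gamma_series b n) \<longlonglongrightarrow> norm (Gamma (Complex b t)) / Gamma b"
      using Gamma_real_pos[of b] assms by (intro tendsto_intros Gamma_series_LIMSEQ) (metis less_irrefl less_le_trans)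
    have "norm (Gamma_series (Complex a t) n) / Gamma_series a n
           \<le> norm (Gamma_series (Complex b t) n) / Gamma_series b n" for n
      using assms by (subst (1 2) eq) (auto intro!: prod_mono le simp del: prod.op_ivl_Suc)
    then show "\<exists>N. \<forall>n\<ge>N. norm (Gamma_series (Complex a t) n) / Gamma_series a n
           \<le> norm (Gamma_series (Complex b t) n) / Gamma_series b n"
      by blast
  qed
qed

text \<open>On the line Re z = 1/2 the point 1 - z is the conjugate of z, so the reflection formula
  gives |Gamma z|^2 = pi / |sin (pi z)| exactly. The constant 3 comes from 2 pi <= 9.\<close>

lemma norm_Gamma_half_le:
  "norm (Gamma (Complex (1/2) t)) \<le> 3 * exp (- (pi / 2) * \<bar>t\<bar>)"
proof -
  define z where "z = Complex (1/2) t"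
  have "1 - z = cnj z"
    by (simp add: z_def complex_eq_iff)
  then have "Gamma z * cnj (Gamma z) = of_real pi / sin (of_real pi * z)"
    using Gamma_reflection_complex[of z] by (simp add: cnj_Gamma)
  then have "norm (Gamma z * cnj (Gamma z)) = pi / norm (sin (of_real pi * z))"
    by (simp add: norm_divide)
  then have 1: "norm (Gamma z) ^ 2 = pi / norm (sin (of_real pi * z))"
    by (simp add: norm_mult power2_eq_square)
  have "norm (sin (of_real pi * z)) ^ 2 = (exp (2 * (pi * t)) + inverse (exp (2 * (pi * t))) + 2) / 4"
    by (simp add: norm_sin_squared z_def)
  also have "\<dots> \<ge> exp (2 * (pi * \<bar>t\<bar>)) / 4"
    by (cases "t \<ge> 0") (auto simp: exp_minus[symmetric] intro!: add_nonneg_nonneg)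
  also have "exp (2 * (pi * \<bar>t\<bar>)) / 4 = (exp (pi * \<bar>t\<bar>) / 2) ^ 2"
    by (simp add: power_divide exp_double)
  finally have "exp (pi * \<bar>t\<bar>) / 2 \<le> norm (sin (of_real pi * z))"
    by (rule power2_le_imp_le) auto
  then have "pi / norm (sin (of_real pi * z)) \<le> pi / (exp (pi * \<bar>t\<bar>) / 2)"
    by (intro divide_left_mono mult_pos_pos) (auto intro: less_le_trans[of 0 "exp (pi * \<bar>t\<bar>) / 2"])
  also have "\<dots> = 2 * pi * exp (- (pi * \<bar>t\<bar>))"
    by (simp add: exp_minus field_simps)
  also have "\<dots> \<le> 9 * exp (- (pi * \<bar>t\<bar>))"
    using pi_less_4 by (intro mult_right_mono) (auto intro: order_trans[of _ "2 * pi"] simp: pi_half_less_two)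
  also have "exp (- (pi * \<bar>t\<bar>)) = exp (- (pi / 2) * \<bar>t\<bar>) ^ 2"
    by (simp add: exp_double[symmetric])
  finally have "norm (Gamma z) ^ 2 \<le> (3 * exp (- (pi / 2) * \<bar>t\<bar>)) ^ 2"
    unfolding 1 by (simp add: power_mult_distrib)
  then show ?thesis
    unfolding z_def by (rule power2_le_imp_le) auto
qed

lemma not_nonpos_Int_Im: "Im z \<noteq> 0 \<Longrightarrow> z \<notin> \<int>\<^sub>\<le>\<^sub>0"
  by (auto elim!: nonpos_Ints_cases)

lemma not_nonpos_Int_Re: "Re z > 0 \<Longrightarrow> z \<notin> \<int>\<^sub>\<le>\<^sub>0"
  by (auto elim!: nonpos_Ints_cases)

lemma Gamma_pochhammer_mult:
  "z \<notin> \<int>\<^sub>\<le>\<^sub>0 \<Longrightarrow> Gamma (z + of_nat n) = pochhammer z n * Gamma z" for z :: complex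
  using pochhammer_Gamma[of z n] by (simp add: Gamma_eq_zero_iff)

text \<open>Everything is reduced to the line Re = 1/2. The recurrence moves s to the right into Re
  >= 1, the monotonicity of |Gamma(a + it)| / Gamma(a) in a leads on to a half-integer abscissa, and
  the recurrence leads back from there to 1/2 at the price of a power of |t|.\<close>

theorem norm_Gamma_strip_le:
  "\<exists>C>0. \<exists>N. \<forall>s. \<bar>Re s\<bar> \<le> A \<longrightarrow> 1 \<le> \<bar>Im s\<bar> \<longrightarrow>
      norm (Gamma s) \<le> C * \<bar>Im s\<bar> ^ N * exp (- (pi / 2) * \<bar>Im s\<bar>)"
proof -
  \<comment> \<open>M is chosen so that Re s + M lies in [1, N] whenever |Re s| <= A; the comparison
    abscissa is then N + 1/2.\<close>
  define M where "M = nat \<lceil>\<bar>A\<bar>\<rceil> + 1"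
  define N where "N = 2 * M"
  have MA: "real M \<ge> A + 1" by (simp add: M_def) linarith
  have "continuous_on {1..real N} (Gamma :: real \<Rightarrow> real)"
    by (intro continuous_on_Gamma) (auto elim!: nonpos_Ints_cases)
  then have "bounded (Gamma ` {1..real N})"
    by (intro compact_imp_bounded compact_continuous_image) auto
  then obtain B where B: "B > 0" "\<And>x. x \<in> {1..real N} \<Longrightarrow> \<bar>Gamma x\<bar> \<le> B"
    unfolding bounded_pos real_norm_def by (metis imageI)
  define G where "G = Gamma (real N + 1/2)"
  have G: "G > 0" by (simp add: G_def)
  define K where "K = B / G * ((2 * real N + 1) ^ N * 3)"
  have K: "K > 0" using B G by (simp add: K_def zero_less_mult_iff add_nonneg_pos)
  have "norm (Gamma s) \<le> K * \<bar>Im s\<bar> ^ N * exp (- (pi / 2) * \<bar>Im s\<bar>)" if s: "\<bar>Re s\<bar> \<le> A" "1 \<le> \<bar>Im s\<bar>" for s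
  proof -
    define t where "t = Im s"
    have t: "1 \<le> \<bar>t\<bar>" using s by (simp add: t_def)
    define x where "x = Re s + real M"
    have x: "x \<ge> 1" "x \<le> real N" using s MA by (auto simp: x_def N_def)
    have "s + of_nat M = Complex x t" by (simp add: x_def t_def complex_eq_iff)
    then have 1: "Gamma (Complex x t) = pochhammer s M * Gamma s"
      using Gamma_pochhammer_mult[of s M] s not_nonpos_Int_Im[of s] by auto
    \<comment> \<open>Every factor s + i has modulus at least |Im s| >= 1, so dividing by the
      Pochhammer product costs nothing.\<close>
    have "1 \<le> norm (pochhammer s M)"
    proof -
      have "(\<Prod>i = 0..<M. 1::real) \<le> (\<Prod>i = 0..<M. norm (s + of_nat i))"
      proof (intro prod_mono conjI)
        show "1 \<le> norm (s + of_nat i)" for i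
          using abs_Im_le_cmod[of "s + of_nat i"] s by simp
      qed auto
      then show ?thesis by (simp add: pochhammer_prod prod_norm)
    qed
    then have "norm (Gamma s) \<le> norm (pochhammer s M) * norm (Gamma s)"
      using mult_right_mono[of 1 "norm (pochhammer s M)" "norm (Gamma s)"] by simp
    also have "\<dots> = norm (Gamma (Complex x t))"
      by (simp add: 1 norm_mult)
    also have "\<dots> \<le> Gamma x * (norm (Gamma (Complex (real N + 1/2) t)) / G)"
    proof -
      have "norm (Gamma (Complex x t)) / Gamma x \<le> norm (Gamma (Complex (real N + 1/2) t)) / G"
        unfolding G_def using x by (intro norm_Gamma_ratio_mono) auto
      moreover have "Gamma x > 0" using x by simp
      ultimately show ?thesis by (simp add: field_simps)
    qed
    also have "\<dots> \<le> B * (norm (Gamma (Complex (real N + 1/2) t)) / G)"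
      using x G B(2)[of x] by (intro mult_right_mono) auto
    also have "Gamma (Complex (real N + 1/2) t) = pochhammer (Complex (1/2) t) N * Gamma (Complex (1/2) t)"
    proof -
      have "Complex (real N + 1/2) t = Complex (1/2) t + of_nat N" by (simp add: complex_eq_iff)
      then show ?thesis using Gamma_pochhammer_mult[of "Complex (1/2) t" N] not_nonpos_Int_Re[of "Complex (1/2) t"] by simp
    qed
    also have "norm (pochhammer (Complex (1/2) t) N * Gamma (Complex (1/2) t))
        \<le> ((2 * real N + 1) * \<bar>t\<bar>) ^ N * (3 * exp (- (pi / 2) * \<bar>t\<bar>))"
      unfolding norm_mult
    proof (intro mult_mono norm_Gamma_half_le)
      have "norm (pochhammer (Complex (1/2) t) N) = (\<Prod>i = 0..<N. norm (Complex (1/2) t + of_nat i))"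
        by (simp add: pochhammer_prod prod_norm)
      also have "\<dots> \<le> (\<Prod>i = 0..<N. (2 * real N + 1) * \<bar>t\<bar>)"
      proof (intro prod_mono conjI)
        fix i assume i: "i \<in> {0..<N}"
        have "norm (Complex (1/2) t + of_nat i) \<le> \<bar>1/2 + real i\<bar> + \<bar>t\<bar>"
          using cmod_le[of "Complex (1/2) t + of_nat i"] by simp
        also have "\<dots> \<le> 2 * real N * 1 + \<bar>t\<bar>"
          using i by auto
        also have "\<dots> \<le> 2 * real N * \<bar>t\<bar> + \<bar>t\<bar>"
          using t by (intro add_right_mono mult_left_mono) auto
        finally show "norm (Complex (1/2) t + of_nat i) \<le> (2 * real N + 1) * \<bar>t\<bar>"
          by (simp add: algebra_simps)
      qed auto
      finally show "norm (pochhammer (Complex (1/2) t) N) \<le> ((2 * real N + 1) * \<bar>t\<bar>) ^ N"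
        by simp
    qed auto
    finally have "norm (Gamma s) \<le> B * (((2 * real N + 1) * \<bar>t\<bar>) ^ N * (3 * exp (- (pi / 2) * \<bar>t\<bar>)) / G)"
      using B G by (simp add: mult_left_mono divide_right_mono)
    then show ?thesis
      unfolding power_mult_distrib K_def t_def by (simp only: mult_ac times_divide_eq_left times_divide_eq_right)
  qed
  then show ?thesis using K by blast
qed

section \<open>Mellin--Barnes integrals\<close>

lemma norm_polar_power: "norm (polar_power \<rho> \<theta> (- s)) = exp (Im s * \<theta> - Re s * ln \<rho>)"
  by (simp add: polar_power_def)

lemma polar_power_zero_arg: "\<rho> > 0 \<Longrightarrow> polar_power \<rho> 0 s = of_real \<rho> powr s"
  by (simp add: polar_power_def powr_def Ln_of_real complex_eq_iff Complex_eq)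

lemma norm_prod_Gamma_strip_le:
  fixes bs :: "complex list"
  assumes "\<forall>b\<in>set bs. b \<in> \<real>"
  shows "\<exists>C>0. \<exists>N. \<forall>s. \<bar>Re s\<bar> \<le> A \<longrightarrow> 1 \<le> \<bar>Im s\<bar> \<longrightarrow>
      norm (\<Prod>b\<leftarrow>bs. Gamma (b + s)) \<le> C * \<bar>Im s\<bar> ^ N * exp (- (real (length bs) * (pi / 2)) * \<bar>Im s\<bar>)"
  using assms
proof (induction bs)
  case Nil
  show ?case by (intro exI[of _ 1] conjI exI[of _ 0]) auto
next
  case (Cons b bs)
  then obtain C N where C: "C > 0" and CN: "\<And>s. \<bar>Re s\<bar> \<le> A \<Longrightarrow> 1 \<le> \<bar>Im s\<bar> \<Longrightarrow>
      norm (\<Prod>b\<leftarrow>bs. Gamma (b + s)) \<le> C * \<bar>Im s\<bar> ^ N * exp (- (real (length bs) * (pi / 2)) * \<bar>Im s\<bar>)"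
    by auto
  obtain C' N' where C': "C' > 0" and CN': "\<And>s. \<bar>Re s\<bar> \<le> A + \<bar>Re b\<bar> \<Longrightarrow> 1 \<le> \<bar>Im s\<bar> \<Longrightarrow>
      norm (Gamma s) \<le> C' * \<bar>Im s\<bar> ^ N' * exp (- (pi / 2) * \<bar>Im s\<bar>)"
    using norm_Gamma_strip_le[of "A + \<bar>Re b\<bar>"] by metis
  have "norm (\<Prod>b\<leftarrow>b # bs. Gamma (b + s))
      \<le> (C' * C) * \<bar>Im s\<bar> ^ (N' + N) * exp (- (real (length (b # bs)) * (pi / 2)) * \<bar>Im s\<bar>)"
    if s: "\<bar>Re s\<bar> \<le> A" "1 \<le> \<bar>Im s\<bar>" for s
  proof -
    let ?t = "\<bar>Im s\<bar>" and ?\<beta> = "real (length bs) * (pi / 2)"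
    have "b \<in> \<real>" using Cons.prems by simp
    then have im: "Im (b + s) = Im s" by (simp add: complex_is_Real_iff)
    have "norm (Gamma (b + s)) \<le> C' * ?t ^ N' * exp (- (pi / 2) * ?t)"
      using CN'[of "b + s"] s unfolding im by simp
    then have "norm (\<Prod>b\<leftarrow>b # bs. Gamma (b + s)) \<le> (C' * ?t ^ N' * exp (- (pi / 2) * ?t))
        * (C * ?t ^ N * exp (- (?\<beta>) * ?t))"
      using CN[OF s] C' by (simp add: norm_mult mult_mono del: minus_mult_left)
    also have "\<dots> = (C' * C) * ?t ^ (N' + N) * (exp (- (pi / 2) * ?t) * exp (- (?\<beta>) * ?t))"
      by (simp only: power_add mult_ac)
    also have "exp (- (pi / 2) * ?t) * exp (- (?\<beta>) * ?t)
        = exp (- (real (length (b # bs)) * (pi / 2)) * ?t)"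
      unfolding exp_add[symmetric] by (rule arg_cong[of _ _ exp]) (simp add: algebra_simps)
    finally show ?thesis .
  qed
  then show ?case using C C' by (metis mult_pos_pos)
qed

definition meijer_integrand :: "complex list \<Rightarrow> real \<Rightarrow> real \<Rightarrow> complex \<Rightarrow> complex" where
  "meijer_integrand bs \<rho> \<theta> s = (\<Prod>b\<leftarrow>bs. Gamma (b + s)) * polar_power \<rho> \<theta> (- s)"

text \<open>The gamma factors decay like exp(-k pi |t| / 2) with k = \<open>length bs\<close>, and
  the power grows at most like exp(|theta| |t|). The condition on the argument says exactly that the
  difference delta of these rates is positive.\<close>

lemma meijer_integrand_strip_bound:
  fixes bs :: "complex list"
  assumes bs: "\<forall>b\<in>set bs. b \<in> \<real>" and \<theta>: "\<bar>\<theta>\<bar> < real (length bs) * (pi / 2)"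
  shows "\<exists>C>0. \<forall>s. \<bar>Re s\<bar> \<le> A \<longrightarrow> 1 \<le> \<bar>Im s\<bar> \<longrightarrow> norm (meijer_integrand bs \<rho> \<theta> s) \<le> C / (1 + (Im s)\<^sup>2)"
proof -
  define \<beta> where "\<beta> = real (length bs) * (pi / 2)"
  obtain C N where C: "C > 0" and CN: "\<And>s. \<bar>Re s\<bar> \<le> A \<Longrightarrow> 1 \<le> \<bar>Im s\<bar> \<Longrightarrow>
      norm (\<Prod>b\<leftarrow>bs. Gamma (b + s)) \<le> C * \<bar>Im s\<bar> ^ N * exp (- \<beta> * \<bar>Im s\<bar>)"
    using norm_prod_Gamma_strip_le[OF bs, of A] unfolding \<beta>_def by metis
  define \<delta> where "\<delta> = \<beta> - \<bar>\<theta>\<bar>"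
  have "\<delta> > 0" using \<theta> by (simp add: \<delta>_def \<beta>_def)
  then obtain D where D: "D > 0" "\<And>t. 1 \<le> \<bar>t\<bar> \<Longrightarrow> \<bar>t\<bar> ^ N * exp (- \<delta> * \<bar>t\<bar>) \<le> D / (1 + t\<^sup>2)"
    using power_times_exp_decay[of \<delta> N] by metis
  define B where "B = exp (A * \<bar>ln \<rho>\<bar>)"
  have "norm (meijer_integrand bs \<rho> \<theta> s) \<le> C * B * D / (1 + (Im s)\<^sup>2)"
    if s: "\<bar>Re s\<bar> \<le> A" "1 \<le> \<bar>Im s\<bar>" for s
  proof -
    define t where "t = \<bar>Im s\<bar>"
    have "Im s * \<theta> \<le> \<bar>\<theta>\<bar> * t"
      by (metis abs_ge_self abs_mult mult.commute t_def)
    moreover have "- (Re s * ln \<rho>) \<le> \<bar>Re s\<bar> * \<bar>ln \<rho>\<bar>"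
      by (metis abs_ge_minus_self abs_mult)
    moreover have "\<bar>Re s\<bar> * \<bar>ln \<rho>\<bar> \<le> A * \<bar>ln \<rho>\<bar>"
      using s by (intro mult_right_mono) auto
    ultimately have "exp (Im s * \<theta> - Re s * ln \<rho>) \<le> exp (\<bar>\<theta>\<bar> * t) * B"
      unfolding B_def exp_add[symmetric] by simp
    then have "norm (meijer_integrand bs \<rho> \<theta> s) \<le> (C * t ^ N * exp (- \<beta> * t)) * (exp (\<bar>\<theta>\<bar> * t) * B)"
      unfolding meijer_integrand_def norm_mult norm_polar_power t_def using C by (intro mult_mono CN s) auto
    also have "\<dots> = C * B * (t ^ N * (exp (- \<beta> * t) * exp (\<bar>\<theta>\<bar> * t)))"
      by (simp only: mult_ac)
    also have "exp (- \<beta> * t) * exp (\<bar>\<theta>\<bar> * t) = exp (- \<delta> * t)"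
      unfolding exp_add[symmetric] by (rule arg_cong[of _ _ exp]) (simp add: \<delta>_def algebra_simps)
    also have "C * B * (t ^ N * exp (- \<delta> * t)) \<le> C * B * (D / (1 + (Im s)\<^sup>2))"
      unfolding t_def using C by (intro mult_left_mono D(2) s) (auto simp: B_def)
    finally show ?thesis by simp
  qed
  moreover have "C * B * D > 0" using C D(1) by (simp add: B_def)
  ultimately show ?thesis by blast
qed

lemma holomorphic_meijer_integrand:
  assumes "\<And>b s. b \<in> set bs \<Longrightarrow> s \<in> S \<Longrightarrow> b + s \<notin> \<int>\<^sub>\<le>\<^sub>0"
  shows "meijer_integrand bs \<rho> \<theta> holomorphic_on S"
proof -
  have "(\<lambda>s. \<Prod>b\<leftarrow>bs. Gamma (b + s)) holomorphic_on S"
    using assms by (induction bs) (auto intro!: holomorphic_intros)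
  then show ?thesis
    unfolding meijer_integrand_def polar_power_def by (intro holomorphic_intros)
qed

text \<open>Makes the description in \<open>meijer_G\<close> meaningful: no pole lies between two
  admissible lines, so all of them carry the same integral, and this common value is the unique
  witness.\<close>

theorem meijer_G_line:
  fixes bs :: "complex list"
  assumes bs: "\<forall>b\<in>set bs. b \<in> \<real>" and \<theta>: "\<bar>\<theta>\<bar> < real (length bs) * (pi / 2)"
    and c: "\<forall>b\<in>set bs. - Re b < c"
  shows "integrable lborel (\<lambda>t. meijer_integrand bs \<rho> \<theta> (Complex c t))"
    and "integral\<^sup>L lborel (\<lambda>t. meijer_integrand bs \<rho> \<theta> (Complex c t)) = 2 * of_real pi * meijer_G bs \<rho> \<theta>"
proof -
  let ?M = "meijer_integrand bs \<rho> \<theta>"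
  let ?m = "\<lambda>c t. ?M (Complex c t)"
  have notin: "b + s \<notin> \<int>\<^sub>\<le>\<^sub>0" if "- Re b < Re s" for b s
    using that by (intro not_nonpos_Int_Re) auto
  have shift: "integrable lborel (?m d) \<and>
     integrable lborel (?m e) \<and>
     integral\<^sup>L lborel (?m e) = integral\<^sup>L lborel (?m d)"
    if d: "\<forall>b\<in>set bs. - Re b < d" and de: "d < e" for d e
  proof -
    \<comment> \<open>The shift needs holomorphy on an open strip, hence room between d and the
      rightmost pole; d' is the midpoint of M and d. The entry d - 1 keeps the maximum defined for
      empty \<open>bs\<close>.\<close>
    obtain d' where d': "d' < d" "\<forall>b\<in>set bs. - Re b < d'"
    proof -
      define M where "M = Max (insert (d - 1) ((\<lambda>b. - Re b) ` set bs))"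
      have "M < d" using d by (simp add: M_def)
      moreover have "- Re b \<le> M" if "b \<in> set bs" for b
        unfolding M_def using that by (intro Max_ge) auto
      ultimately show ?thesis
        by (intro that[of "(M + d) / 2"]) (auto, smt (verit) field_sum_of_halves)
    qed
    have holo: "?M holomorphic_on {s. d' < Re s \<and> Re s < e + 1} - {}"
      by (intro holomorphic_meijer_integrand notin) (use d' in force)
    obtain C where C: "\<And>s. \<bar>Re s\<bar> \<le> \<bar>d\<bar> + \<bar>e\<bar> \<Longrightarrow> 1 \<le> \<bar>Im s\<bar> \<Longrightarrow>
        norm (?M s) \<le> C / (1 + (Im s)\<^sup>2)"
      using meijer_integrand_strip_bound[OF bs \<theta>, of "\<bar>d\<bar> + \<bar>e\<bar>" \<rho>] by metis
    have bd: "norm (?M s) \<le> C / (1 + (Im s)\<^sup>2)" if "d \<le> Re s" "Re s \<le> e" "1 \<le> \<bar>Im s\<bar>" for s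
      using that by (intro C) auto
    note V = vertical_line_shift[where f = "?M" and P = "{}", OF de d'(1) _ _ _ holo bd, simplified]
    show ?thesis using V by (auto simp: algebra_simps)
  qed
  define I where "I = integral\<^sup>L lborel (?m c) / (2 * of_real pi)"
  have int: "integrable lborel (?m d)" if "\<forall>b\<in>set bs. - Re b < d" for d
    using shift[OF that, of "d + 1"] by simp
  then show "integrable lborel (?m c)"
    using c by blast
  have eq: "integral\<^sup>L lborel (?m d) = 2 * of_real pi * I"
    if "\<forall>b\<in>set bs. - Re b < d" for d
    using shift[OF that, of c] shift[OF c, of d] by (cases d c rule: linorder_cases) (auto simp: I_def)
  have unfold: "(\<Prod>b\<leftarrow>bs. Gamma (b + Complex d t)) * polar_power \<rho> \<theta> (- Complex d t) / (2 * of_real pi)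
     = ?m d t / (2 * of_real pi)" for d t
    by (simp add: meijer_integrand_def)
  have hi: "((\<lambda>t. ?m d t / (2 * of_real pi)) has_integral I) UNIV"
    if "\<forall>b\<in>set bs. - Re b < d" for d
    using has_integral_integral_lborel[of "\<lambda>t. ?m d t / (2 * of_real pi)"]
      int[OF that] eq[OF that] by simp
  have "meijer_G bs \<rho> \<theta> = I"
    unfolding meijer_G_def unfold
  proof (rule the_equality)
    fix J assume "\<forall>d. (\<forall>b\<in>set bs. - Re b < d) \<longrightarrow>
       ((\<lambda>t. ?m d t / (2 * of_real pi)) has_integral J) UNIV"
    with c hi[OF c] show "J = I" by (blast intro: has_integral_unique)
  qed (use hi in blast)
  then show "integral\<^sup>L lborel (?m c) = 2 * of_real pi * meijer_G bs \<rho> \<theta>"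
    using eq[OF c] by simp
qed

text \<open>The line is pushed to Re s = -(m + 1/2). The residue at -j is (-y)^j / j!, so the
  residues build the exponential series, while the remaining integral is O(y^m / m!). The integrand
  is the Meijer integrand with the single parameter 0, so its bounds apply.\<close>

theorem Cahen_Mellin:
  assumes y: "y > 0" and c: "c > 0"
  shows "integrable lborel (\<lambda>t. Gamma (Complex c t) * of_real y powr (- Complex c t))"
    and "integral\<^sup>L lborel (\<lambda>t. Gamma (Complex c t) * of_real y powr (- Complex c t)) = 2 * of_real pi * of_real (exp (- y))"
proof -
  let ?h = "\<lambda>t. Gamma (Complex c t) * of_real y powr (- Complex c t)"
  define f where "f = meijer_integrand [0] y 0"
  have f_eq: "f = (\<lambda>s. Gamma s * of_real y powr (- s))"
    using y by (simp add: f_def meijer_integrand_def polar_power_zero_arg fun_eq_iff)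
  define L where "L = integral\<^sup>L lborel (\<lambda>t. f (Complex c t))"
  \<comment> \<open>Half-integers stay away from the poles and allow every line to be compared with
    Re s = 1/2 through the recurrence.\<close>
  define a where "a m = - (real m + 1/2)" for m
  define g where "g m t = f (Complex (a m) t)" for m t
  define P where "P m = (\<lambda>j. - of_nat j :: complex) ` {..m}" for m
  have strip: "integrable lborel (g m) \<and> integrable lborel (\<lambda>t. f (Complex c t)) \<and>
     L - integral\<^sup>L lborel (g m) = 2 * of_real pi * (\<Sum>p\<in>P m. residue f p)" for m
  proof -
    have holo: "f holomorphic_on {s. a m - 1/4 < Re s \<and> Re s < c + 1} - P m"
      unfolding f_def
    proof (rule holomorphic_meijer_integrand)
      fix b s assume b: "b \<in> set [0::complex]" and s: "s \<in> {s. a m - 1/4 < Re s \<and> Re s < c + 1} - P m"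
      show "b + s \<notin> \<int>\<^sub>\<le>\<^sub>0"
      proof
        assume "b + s \<in> \<int>\<^sub>\<le>\<^sub>0"
        then obtain n where n: "s = - of_nat n" using b by (auto elim!: nonpos_Ints_cases')
        then have "- (real m + 3/4) < - real n" using s by (simp add: a_def)
        then have "n \<le> m" by linarith
        then show False using s n by (auto simp: P_def)
      qed
    qed
    obtain C where C: "\<And>s. \<bar>Re s\<bar> \<le> \<bar>a m\<bar> + \<bar>c\<bar> \<Longrightarrow> 1 \<le> \<bar>Im s\<bar> \<Longrightarrow> norm (f s) \<le> C / (1 + (Im s)\<^sup>2)"
      using meijer_integrand_strip_bound[of "[0]" 0 "\<bar>a m\<bar> + \<bar>c\<bar>" y] unfolding f_def by auto
    have bd: "norm (f s) \<le> C / (1 + (Im s)\<^sup>2)" if "a m \<le> Re s" "Re s \<le> c" "1 \<le> \<bar>Im s\<bar>" for s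
      using that by (intro C) auto
    have V: "a m < c" "a m - 1/4 < a m" "c < c + 1" "finite (P m)" "\<And>p. p \<in> P m \<Longrightarrow> a m < Re p \<and> Re p < c"
      using c by (auto simp: a_def P_def)
    show ?thesis
      using vertical_line_shift[OF V holo bd] unfolding L_def g_def[abs_def] by blast
  qed
  show "integrable lborel ?h"
    using strip[of 0] unfolding f_eq by simp
  have res: "residue f (- of_nat j) = (- of_real y) ^ j / fact j" for j
  proof (rule residue_simple')
    show "open (- (\<int>\<^sub>\<le>\<^sub>0 - {- of_nat j}) :: complex set)"
      by (intro open_Compl closed_subset_Ints) auto
    show "f holomorphic_on - (\<int>\<^sub>\<le>\<^sub>0 - {- of_nat j}) - {- of_nat j}"
      unfolding f_def by (rule holomorphic_meijer_integrand) auto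
    have "isCont (\<lambda>s. of_real y powr (- s) :: complex) (- of_nat j)"
      using y by (intro continuous_intros) auto
    then have "((\<lambda>s. of_real y powr (- s)) \<longlongrightarrow> of_real y powr (- (- of_nat j :: complex))) (at (- of_nat j))"
      unfolding isCont_def .
    from tendsto_mult[OF Gamma_residues this]
    have "((\<lambda>s. Gamma s * (s + of_nat j) * of_real y powr (- s)) \<longlongrightarrow> (-1) ^ j / fact j * of_real y powr (- (- of_nat j))) (at (- of_nat j :: complex))" .
    also have "(-1) ^ j / fact j * of_real y powr (- (- of_nat j :: complex)) = (- of_real y :: complex) ^ j / fact j"
      using y by (simp add: powr_nat power_minus[of "of_real y"])
    finally show "((\<lambda>w. f w * (w - - of_nat j)) \<longlongrightarrow> (- of_real y) ^ j / fact j) (at (- of_nat j))"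
      by (simp add: f_eq mult_ac)
  qed auto
  define H where "H = (\<integral>t. norm (Gamma (Complex (1/2) t)) \<partial>lborel)"
  have Hint: "integrable lborel (\<lambda>t. Gamma (Complex (1/2) t))"
    using meijer_G_line(1)[of "[0]" 0 "1/2" 1] by (simp add: meijer_integrand_def polar_power_def flip: complex_of_real_def zero_complex.code)
  have small: "norm (integral\<^sup>L lborel (g m)) \<le> 2 * H * y powr (1/2) * (y ^ m / fact m)" for m
  proof -
    have "norm (g m t) \<le> 2 * y powr (1/2) * (y ^ m / fact m) * norm (Gamma (Complex (1/2) t))" for t
    proof -
      define z where "z = Complex (a m) t"
      have "z \<notin> \<int>\<^sub>\<le>\<^sub>0"
      proof
        assume "z \<in> \<int>\<^sub>\<le>\<^sub>0"
        then obtain n where "z = - of_nat n" by (auto elim!: nonpos_Ints_cases')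
        then have "real m + 1/2 = real n" by (simp add: z_def a_def complex_eq_iff)
        then have "real (2 * m + 1) = real (2 * n)" by simp
        then show False unfolding of_nat_eq_iff by presburger
      qed
      moreover have "z + of_nat (Suc m) = Complex (1/2) t"
        by (simp add: z_def a_def complex_eq_iff)
      ultimately have G: "Gamma (Complex (1/2) t) = pochhammer z (Suc m) * Gamma z"
        using Gamma_pochhammer_mult[of z "Suc m"] by simp
      \<comment> \<open>The factor with index i < m has real part of modulus m + 1/2 - i >= m - i,
        which gives m!; the last factor has real part -1/2.\<close>
      have "fact m / 2 \<le> norm (pochhammer z (Suc m))"
      proof -
        have "(\<Prod>i = 0..<m. real m - real i) \<le> (\<Prod>i = 0..<m. norm (z + of_nat i))"
        proof (intro prod_mono conjI)
          fix i assume i: "i \<in> {0..<m}"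
          show "0 \<le> real m - real i" using i by simp
          have "real m - real i \<le> \<bar>Re (z + of_nat i)\<bar>" by (simp add: z_def a_def)
          also have "\<dots> \<le> norm (z + of_nat i)" by (rule abs_Re_le_cmod)
          finally show "real m - real i \<le> norm (z + of_nat i)" .
        qed
        moreover have "(\<Prod>i = 0..<m. real m - real i) = fact m"
          by (simp add: fact_prod_rev of_nat_diff)
        moreover have "1/2 \<le> norm (z + of_nat m)"
          using abs_Re_le_cmod[of "z + of_nat m"] by (simp add: z_def a_def)
        ultimately have "fact m * (1/2) \<le> (\<Prod>i = 0..<m. norm (z + of_nat i)) * norm (z + of_nat m)"
          by (intro mult_mono) (auto intro: prod_nonneg)
        then show ?thesis by (simp add: pochhammer_prod prod_norm norm_mult)
      qed
      then have "fact m / 2 * norm (Gamma z) \<le> norm (Gamma (Complex (1/2) t))"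
        unfolding G norm_mult by (rule mult_right_mono) auto
      then have "norm (Gamma z) \<le> 2 / fact m * norm (Gamma (Complex (1/2) t))"
        by (simp add: field_simps)
      moreover have "norm (of_real y powr (- z)) = y powr (1/2) * y ^ m"
        using y by (simp add: norm_powr_real_powr z_def a_def powr_add powr_realpow)
      ultimately have "norm (f z) \<le> (2 / fact m * norm (Gamma (Complex (1/2) t))) * (y powr (1/2) * y ^ m)"
        unfolding f_eq norm_mult using y by (metis mult_right_mono powr_ge_zero zero_le_power less_imp_le mult_nonneg_nonneg)
      then show ?thesis by (simp add: g_def z_def mult_ac)
    qed
    then have "norm (integral\<^sup>L lborel (g m)) \<le> (\<integral>t. 2 * y powr (1/2) * (y ^ m / fact m) * norm (Gamma (Complex (1/2) t)) \<partial>lborel)"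
      using strip[of m] Hint by (intro Bochner_Integration.integral_norm_bound_integral) auto
    then show ?thesis by (simp add: H_def mult_ac)
  qed
  have sum_res: "(\<Sum>p\<in>P m. residue f p) = (\<Sum>j\<le>m. (- of_real y) ^ j / fact j)" for m
    unfolding P_def by (subst sum.reindex) (auto simp: inj_on_def res)
  have "(\<lambda>m. \<Sum>j\<le>m. (- of_real y :: complex) ^ j / fact j) \<longlonglongrightarrow> exp (- of_real y)"
    using exp_converges[of "- of_real y :: complex"] unfolding sums_def_le by (simp add: scaleR_conv_of_real divide_inverse mult_ac)
  then have lim1: "(\<lambda>m. 2 * of_real pi * (\<Sum>p\<in>P m. residue f p)) \<longlonglongrightarrow> 2 * of_real pi * exp (- of_real y)"
    unfolding sum_res by (intro tendsto_intros)
  have "(\<lambda>m. y ^ m / fact m) \<longlonglongrightarrow> 0"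
    using summable_LIMSEQ_zero[OF summable_exp[of y]] by (simp add: divide_inverse mult_ac)
  then have "(\<lambda>m. 2 * H * y powr (1/2) * (y ^ m / fact m)) \<longlonglongrightarrow> 0"
    by (intro tendsto_mult_right_zero)
  then have "(\<lambda>m. integral\<^sup>L lborel (g m)) \<longlonglongrightarrow> 0"
    by (rule Lim_null_comparison[rotated]) (use small in auto)
  then have "(\<lambda>m. L - integral\<^sup>L lborel (g m)) \<longlonglongrightarrow> L - 0"
    by (intro tendsto_intros)
  moreover have "(\<lambda>m. L - integral\<^sup>L lborel (g m)) = (\<lambda>m. 2 * of_real pi * (\<Sum>p\<in>P m. residue f p))"
    using strip by auto
  ultimately have "L - 0 = 2 * of_real pi * exp (- of_real y)"
    using lim1 by (simp only: LIMSEQ_unique)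
  then have "L = 2 * of_real pi * exp (- of_real y)" by simp
  then show "integral\<^sup>L lborel ?h = 2 * of_real pi * of_real (exp (- y))"
    by (simp add: L_def f_eq flip: exp_of_real)
qed

section \<open>Continuation of the zeta function\<close>

text \<open>$s - 1$ times the error of the trapezoidal rule for $u^{-s}$ on $[n, n + 1]$; the factor $s - 1$ removes the pole.\<close>

definition trapezoid_term :: "nat \<Rightarrow> complex \<Rightarrow> complex" where
  "trapezoid_term n s = (s - 1) * (of_nat n powr (- s) + of_nat (n + 1) powr (- s)) / 2
     - (of_nat n powr (1 - s) - of_nat (n + 1) powr (1 - s))"

text \<open>With g(u) = u^(1 - s) on an interval [a, b] of length 1 the term is g(b) - g(a) - (g'(a)
  + g'(b)) / 2, which vanishes for quadratic g. It is the Taylor remainder X of g minus half the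
  Taylor remainder Y of g', and both are controlled by g'''. For Re s >= -2 the bound on |g'''| is
  largest at the left endpoint; its size n^(-Re s - 2) is summable for Re s > -1.\<close>

lemma norm_trapezoid_term_le:
  assumes n: "n \<ge> 1" and s: "Re s \<ge> -2"
  shows "norm (trapezoid_term n s) \<le> norm ((s - 1) * s * (s + 1)) * real n powr (- Re s - 2)"
proof -
  define a b :: complex where "a = of_nat n" and "b = of_nat (n + 1)"
  define S where "S = closed_segment a b"
  \<comment> \<open>\<open>g i\<close> is the i-th derivative of u^(1 - s).\<close>
  define g :: "nat \<Rightarrow> complex \<Rightarrow> complex" where
    "g i u = (\<Prod>j<i. 1 - s - of_nat j) * u powr (1 - s - of_nat i)" for i u
  have S: "\<exists>x\<ge>real n. u = of_real x" if "u \<in> S" for u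
  proof -
    from that obtain w where w: "0 \<le> w" "w \<le> 1" "u = (1 - w) *\<^sub>R a + w *\<^sub>R b"
      by (auto simp: S_def closed_segment_def)
    then have "u = of_real (real n + w)"
      by (simp add: a_def b_def scaleR_conv_of_real algebra_simps)
    then show ?thesis using w by (intro exI[of _ "real n + w"]) auto
  qed
  have deriv: "(g i has_field_derivative g (Suc i) u) (at u within S)" if u: "u \<in> S" for i u
  proof -
    obtain x where x: "x \<ge> real n" "u = of_real x" using S[OF u] by blast
    then have "u \<notin> \<real>\<^sub>\<le>\<^sub>0" using n by (simp add: complex_nonpos_Reals_iff)
    then have "((\<lambda>u. u powr (1 - s - of_nat i)) has_field_derivative (1 - s - of_nat i) * u powr (1 - s - of_nat i - 1)) (at u)"
      by (intro has_field_derivative_powr)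
    then have "((\<lambda>u. u powr (1 - s - of_nat i)) has_field_derivative (1 - s - of_nat i) * u powr (1 - s - of_nat i - 1)) (at u within S)"
      by (rule has_field_derivative_at_within)
    from DERIV_cmult[OF this, of "\<Prod>j<i. 1 - s - of_nat j"] show ?thesis
      unfolding g_def by (simp add: algebra_simps)
  qed
  define B where "B = norm ((s - 1) * s * (s + 1)) * real n powr (- Re s - 2)"
  have B: "norm (g 3 u) \<le> B" if u: "u \<in> S" for u
  proof -
    obtain x where x: "x \<ge> real n" "u = of_real x" using S[OF u] by blast
    have "norm (u powr (1 - s - 3)) = x powr (- Re s - 2)"
      using x n by (simp add: norm_powr_real_powr algebra_simps)
    also have "\<dots> \<le> real n powr (- Re s - 2)"
      using x n s by (intro powr_mono2') auto
    finally have "norm (u powr (1 - s - 3)) \<le> real n powr (- Re s - 2)" .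
    moreover have "(\<Prod>j<3. 1 - s - of_nat j) = - ((s - 1) * s * (s + 1))"
      by (simp add: eval_nat_numeral algebra_simps)
    ultimately show ?thesis
      unfolding g_def B_def by (simp add: norm_mult mult_left_mono)
  qed
  have conv: "convex S" and ab: "a \<in> S" "b \<in> S" by (auto simp: S_def)
  have d: "b - a = 1" by (simp add: a_def b_def)
  define X where "X = g 0 b - (\<Sum>i\<le>2. g i a * (b - a) ^ i / fact i)"
  define Y where "Y = g (Suc 0) b - (\<Sum>i\<le>1. g (Suc i) a * (b - a) ^ i / fact i)"
  have "norm X \<le> B * norm (b - a) ^ Suc 2 / fact 2"
    unfolding X_def
  proof (rule complex_Taylor[where f = g, OF conv _ _ ab])
    show "(g i has_field_derivative g (Suc i) x) (at x within S)" if "x \<in> S" "i \<le> 2" for i x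
      using deriv that by blast
    show "norm (g (Suc 2) x) \<le> B" if "x \<in> S" for x
      using B[OF that] by (simp add: eval_nat_numeral)
  qed
  then have X: "norm X \<le> B / 2" by (simp add: d)
  have "norm Y \<le> B * norm (b - a) ^ Suc 1 / fact 1"
    unfolding Y_def
  proof (rule complex_Taylor[where f = "\<lambda>i. g (Suc i)", OF conv _ _ ab])
    show "(g (Suc i) has_field_derivative g (Suc (Suc i)) x) (at x within S)" if "x \<in> S" "i \<le> 1" for i x
      using deriv that by blast
    show "norm (g (Suc (Suc 1)) x) \<le> B" if "x \<in> S" for x
      using B[OF that] by (simp add: eval_nat_numeral)
  qed
  then have Y: "norm (Y / 2) \<le> B / 2" by (simp add: d norm_divide)
  have g: "g 0 u = u powr (1 - s)" "g (Suc 0) u = (1 - s) * u powr (- s)"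
    "g (Suc (Suc 0)) u = (1 - s) * (- s) * u powr (- s - 1)" for u
  proof -
    have "1 - s - of_nat (Suc (Suc 0)) = - s - 1" by simp
    then show "g (Suc (Suc 0)) u = (1 - s) * (- s) * u powr (- s - 1)"
      unfolding g_def by (simp only:) (simp add: lessThan_Suc mult.commute)
  qed (simp_all add: g_def lessThan_Suc)
  have X_eq: "X = g 0 b - (g 0 a + g (Suc 0) a + g (Suc (Suc 0)) a / 2)"
    unfolding X_def d by (simp add: numeral_2_eq_2)
  have Y_eq: "Y = g (Suc 0) b - (g (Suc 0) a + g (Suc (Suc 0)) a)"
    unfolding Y_def d by simp
  have "trapezoid_term n s = X - Y / 2"
    unfolding X_eq Y_eq trapezoid_term_def a_def[symmetric] b_def[symmetric] g by (simp add: field_simps)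
  also have "norm \<dots> \<le> B / 2 + B / 2"
    using X Y by (rule order_trans[OF norm_triangle_ineq4 add_mono])
  finally show ?thesis by (simp add: B_def)
qed

text \<open>This is (s - 1) zeta(s) in the form of Euler-Maclaurin summation: the 1 is s - 1 times
  the integral of u^(-s) over [1, infinity), and (s - 1) / 2 accounts for the half weight of the
  node u = 1.\<close>

definition zeta_num :: "complex \<Rightarrow> complex" where
  "zeta_num s = 1 + (s - 1) / 2 + (\<Sum>n. trapezoid_term (Suc n) s)"

text \<open>Here the exponent of n no longer depends on s, as the Weierstrass test and the bounds on
  whole strips require.\<close>

lemma norm_trapezoid_term_le':
  assumes e: "Re s \<ge> -1 + e" and e0: "e > 0"
  shows "norm (trapezoid_term (Suc n) s) \<le> norm ((s - 1) * s * (s + 1)) * real (Suc n) powr (- 1 - e)"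
proof -
  have "norm (trapezoid_term (Suc n) s) \<le> norm ((s - 1) * s * (s + 1)) * real (Suc n) powr (- Re s - 2)"
    using assms by (intro norm_trapezoid_term_le) auto
  also have "\<dots> \<le> norm ((s - 1) * s * (s + 1)) * real (Suc n) powr (- 1 - e)"
    using e by (intro mult_left_mono powr_mono) auto
  finally show ?thesis .
qed

lemma summable_Suc_powr: "e > 0 \<Longrightarrow> summable (\<lambda>n. real (Suc n) powr (- 1 - e))"
  by (subst summable_Suc_iff) (simp add: summable_real_powr_iff)

lemma summable_trapezoid_term:
  assumes "Re s > -1"
  shows "summable (\<lambda>n. trapezoid_term (Suc n) s)"
proof (rule summable_comparison_test')
  show "summable (\<lambda>n. norm ((s - 1) * s * (s + 1)) * real (Suc n) powr (- 1 - (Re s + 1)))"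
    using assms by (intro summable_mult summable_Suc_powr) auto
  show "norm (trapezoid_term (Suc n) s) \<le> norm ((s - 1) * s * (s + 1)) * real (Suc n) powr (- 1 - (Re s + 1))"
    for n using assms by (intro norm_trapezoid_term_le') auto
qed

lemma holomorphic_zeta_num: "zeta_num holomorphic_on {s. Re s > -1}"
proof -
  have "(\<lambda>s. \<Sum>n. trapezoid_term (Suc n) s) holomorphic_on {s. Re s > -1}"
  proof (rule holomorphic_uniform_sequence)
    show "open {s. Re s > -1}" by (rule open_halfspace_Re_gt)
    show "(\<lambda>s. \<Sum>i<n. trapezoid_term (Suc i) s) holomorphic_on {s. Re s > -1}" for n
      unfolding trapezoid_term_def by (intro holomorphic_intros) auto
    fix x assume x: "x \<in> {s. Re s > -1}"
    \<comment> \<open>Half the distance from x to the boundary Re s = -1, so that Re y >= -1 + d on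
      the whole ball.\<close>
    define d where "d = (Re x + 1) / 2"
    have d: "d > 0" "Re x = -1 + 2 * d" using x by (auto simp: d_def field_simps)
    have re: "Re y \<ge> -1 + d" if "y \<in> cball x d" for y
      using abs_Re_le_cmod[of "x - y"] that d by (auto simp: dist_norm)
    define K where "K = (norm x + d + 1) ^ 3"
    have "uniform_limit (cball x d) (\<lambda>n s. \<Sum>i<n. trapezoid_term (Suc i) s) (\<lambda>s. \<Sum>n. trapezoid_term (Suc n) s) sequentially"
    proof (rule Weierstrass_m_test)
      show "summable (\<lambda>n. K * real (Suc n) powr (- 1 - d))"
        using d by (intro summable_mult summable_Suc_powr)
      fix n y assume y: "y \<in> cball x d"
      have ny: "norm y \<le> norm x + d"
        using y norm_triangle_ineq2[of y x] by (auto simp: dist_norm norm_minus_commute)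
      have "norm ((y - 1) * y * (y + 1)) \<le> (norm x + d + 1) * (norm x + d + 1) * (norm x + d + 1)"
        unfolding norm_mult using ny norm_triangle_ineq4[of y 1] norm_triangle_ineq[of y 1] d
        by (intro mult_mono mult_nonneg_nonneg) auto
      also have "\<dots> = K" by (simp add: K_def power3_eq_cube)
      finally have "norm ((y - 1) * y * (y + 1)) * real (Suc n) powr (- 1 - d) \<le> K * real (Suc n) powr (- 1 - d)"
        by (intro mult_right_mono) auto
      then show "norm (trapezoid_term (Suc n) y) \<le> K * real (Suc n) powr (- 1 - d)"
        using norm_trapezoid_term_le'[OF re[OF y] d(1), of n] by linarith
    qed
    then show "\<exists>d>0. cball x d \<subseteq> {s. - 1 < Re s} \<and>
        uniform_limit (cball x d) (\<lambda>n s. \<Sum>i<n. trapezoid_term (Suc i) s) (\<lambda>s. \<Sum>n. trapezoid_term (Suc n) s) sequentially"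
      using d re by (intro exI[of _ d]) (auto simp: subset_iff, smt (verit))
  qed
  then show ?thesis unfolding zeta_num_def by (intro holomorphic_intros) auto
qed

lemma zeta_num_1: "zeta_num 1 = 1"
proof -
  have "trapezoid_term (Suc n) 1 = 0" for n
    using of_nat_neq_0[of n, where 'a = complex] of_nat_neq_0[of "Suc n", where 'a = complex]
    by (simp add: trapezoid_term_def del: of_nat_Suc)
  then show ?thesis by (simp add: zeta_num_def)
qed

text \<open>The trapezoidal rule is exact for the constant u^0, so only 1 + (0 - 1) / 2 is
  left.\<close>

lemma zeta_num_0: "zeta_num 0 = 1 / 2"
proof -
  have "trapezoid_term (Suc n) 0 = 0" for n
    using of_nat_neq_0[of n, where 'a = complex] of_nat_neq_0[of "Suc n", where 'a = complex]
    by (simp add: trapezoid_term_def del: of_nat_Suc) simp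
  then show ?thesis by (simp add: zeta_num_def)
qed

text \<open>Neighbouring half weights combine and the integrals telescope. Only boundary terms at 1
  and N + 1 remain, and the latter vanish in the limit for Re s > 1.\<close>

lemma sum_trapezoid_term:
  "(\<Sum>n<N. trapezoid_term (Suc n) s) = (s - 1) * (\<Sum>n<N. of_nat (Suc n) powr (- s))
     + (s - 1) / 2 * (of_nat (Suc N) powr (- s) - 1) + of_nat (Suc N) powr (1 - s) - 1"
proof (induction N)
  case (Suc N)
  show ?case
    unfolding sum.lessThan_Suc Suc.IH
    unfolding trapezoid_term_def Suc_eq_plus1[symmetric]
    by (simp add: field_simps del: of_nat_Suc)
qed simp

lemma zeta_num_sums:
  assumes "Re s > 1"
  shows "(\<lambda>n. 1 / of_nat (Suc n) powr s) sums (zeta_num s / (s - 1))"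
proof -
  have s1: "s \<noteq> 1" using assms by auto
  have lim: "(\<lambda>N. of_nat (Suc N) powr z) \<longlonglongrightarrow> 0" if "Re z < 0" for z :: complex
    using that by (intro LIMSEQ_Suc tendsto_neg_powr_complex_of_nat filterlim_ident) auto
  have "(\<lambda>N. ((\<Sum>n<N. trapezoid_term (Suc n) s) - (s - 1) / 2 * (of_nat (Suc N) powr (- s) - 1)
           - of_nat (Suc N) powr (1 - s) + 1) / (s - 1))
        \<longlonglongrightarrow> ((\<Sum>n. trapezoid_term (Suc n) s) - (s - 1) / 2 * (0 - 1) - 0 + 1) / (s - 1)"
    using assms s1 by (intro tendsto_intros summable_LIMSEQ summable_trapezoid_term lim) auto
  also have "(\<lambda>N. ((\<Sum>n<N. trapezoid_term (Suc n) s) - (s - 1) / 2 * (of_nat (Suc N) powr (- s) - 1)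
           - of_nat (Suc N) powr (1 - s) + 1) / (s - 1)) = (\<lambda>N. \<Sum>n<N. 1 / of_nat (Suc n) powr s)"
    unfolding sum_trapezoid_term using s1 by (simp add: powr_minus_divide)
  also have "((\<Sum>n. trapezoid_term (Suc n) s) - (s - 1) / 2 * (0 - 1) - 0 + 1) / (s - 1) = zeta_num s / (s - 1)"
    by (simp add: zeta_num_def)
  finally show ?thesis by (simp add: sums_def)
qed

text \<open>The exponent 3 is the degree of (s - 1) s (s + 1) in the trapezoidal bound. Since Re s
  >= -1/2 keeps away from the edge Re s = -1, the fixed series over n^(-3/2) majorises all sums. The
  division by s - 1 is harmless, as |s - 1| >= |Im s| >= 1.\<close>

lemma zeta_num_poly_bound:
  "\<exists>C>0. \<forall>s. - (1/2) \<le> Re s \<longrightarrow> \<bar>Re s\<bar> \<le> A \<longrightarrow> 1 \<le> \<bar>Im s\<bar> \<longrightarrow> norm (zeta_num s / (s - 1)) \<le> C * \<bar>Im s\<bar> ^ 3"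
proof -
  define T where "T = (\<Sum>n. real (Suc n) powr (- 1 - 1/2))"
  have T: "T \<ge> 0" unfolding T_def by (intro suminf_nonneg summable_Suc_powr) auto
  define A' where "A' = \<bar>A\<bar> + 2"
  have "norm (zeta_num s / (s - 1)) \<le> (2 + T) * A' ^ 3 * \<bar>Im s\<bar> ^ 3"
    if s: "- (1/2) \<le> Re s" "\<bar>Re s\<bar> \<le> A" "1 \<le> \<bar>Im s\<bar>" for s
  proof -
    define m where "m = A' * \<bar>Im s\<bar>"
    have A': "A' \<ge> 2" by (simp add: A'_def)
    have m2: "m \<ge> 2" using mult_mono[of 2 A' 1 "\<bar>Im s\<bar>"] A' s(3) by (simp add: m_def)
    have "\<bar>A\<bar> + 1 + \<bar>Im s\<bar> \<le> m"
    proof -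
      have "(\<bar>A\<bar> + 1) * 1 \<le> (\<bar>A\<bar> + 1) * \<bar>Im s\<bar>" using s by (intro mult_left_mono) auto
      then show ?thesis by (simp add: m_def A'_def algebra_simps)
    qed
    then have ns: "norm s + 1 \<le> m" using cmod_le[of s] s by linarith
    then have n3: "norm (s - 1) \<le> m" "norm s \<le> m" "norm (s + 1) \<le> m"
      using norm_triangle_ineq4[of s 1] norm_triangle_ineq[of s 1] by auto
    have cube: "norm ((s - 1) * s * (s + 1)) \<le> m ^ 3"
      unfolding norm_mult power3_eq_cube using n3 m2 by (intro mult_mono mult_nonneg_nonneg) auto
    have "norm (\<Sum>n. trapezoid_term (Suc n) s) \<le> (\<Sum>n. m ^ 3 * real (Suc n) powr (- 1 - 1/2))"
    proof (rule norm_suminf_le)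
      show "summable (\<lambda>n. m ^ 3 * real (Suc n) powr (- 1 - 1/2))"
        by (intro summable_mult summable_Suc_powr) auto
      show "norm (trapezoid_term (Suc n) s) \<le> m ^ 3 * real (Suc n) powr (- 1 - 1/2)" for n
        using norm_trapezoid_term_le'[of "1/2" s n] s cube
        by (smt (verit) mult_right_mono powr_ge_zero field_sum_of_halves)
    qed
    also have "\<dots> = m ^ 3 * T"
      unfolding T_def by (intro suminf_mult summable_Suc_powr) auto
    finally have 1: "norm (\<Sum>n. trapezoid_term (Suc n) s) \<le> m ^ 3 * T" .
    have "m \<le> m ^ 3" using m2 by (intro self_le_power) auto
    have "norm (zeta_num s) \<le> norm (1 + (s - 1) / 2) + norm (\<Sum>n. trapezoid_term (Suc n) s)"
      unfolding zeta_num_def by (rule norm_triangle_ineq)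
    also have "norm (1 + (s - 1) / 2) \<le> 1 + norm (s - 1) / 2"
      by (rule order_trans[OF norm_triangle_ineq]) (simp add: norm_divide)
    also have "1 + norm (s - 1) / 2 \<le> 2 * m ^ 3"
      using n3 m2 \<open>m \<le> m ^ 3\<close> by linarith
    finally have "norm (zeta_num s) \<le> (2 + T) * m ^ 3"
      using 1 by (simp add: algebra_simps)
    moreover have "1 \<le> norm (s - 1)" using abs_Im_le_cmod[of "s - 1"] s by simp
    then have "norm (zeta_num s / (s - 1)) \<le> norm (zeta_num s)"
      by (simp add: norm_divide divide_le_eq mult_left_le[of _ "norm (zeta_num s)"] mult_le_cancel_left1)
    ultimately show ?thesis by (simp add: m_def power_mult_distrib mult_ac)
  qed
  moreover have "(2 + T) * A' ^ 3 > 0" using T by (simp add: A'_def zero_less_mult_iff add_pos_nonneg)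
  ultimately show ?thesis by blast
qed

section \<open>The functional equation\<close>

lemma has_integral_of_nn_integral:
  fixes f :: "real \<Rightarrow> real"
  assumes [measurable]: "f \<in> borel_measurable borel" "A \<in> sets borel"
    and nn: "\<And>x. x \<in> A \<Longrightarrow> 0 \<le> f x"
    and eq: "(\<integral>\<^sup>+x. ennreal (f x) * indicator A x \<partial>lborel) = ennreal r" and r: "0 \<le> r"
  shows "(f has_integral r) A"
proof -
  have "((\<lambda>x. f x * indicator A x) has_integral r) UNIV"
  proof (rule nn_integral_has_integral)
    have "(\<integral>\<^sup>+x. ennreal (f x * indicator A x) \<partial>lborel) = (\<integral>\<^sup>+x. ennreal (f x) * indicator A x \<partial>lborel)"
      by (intro nn_integral_cong) (auto simp: indicator_def)
    then show "(\<integral>\<^sup>+x. ennreal (f x * indicator A x) \<partial>lborel) = ennreal r"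
      using eq by simp
    show "0 \<le> f x * indicator A x" for x using nn by (auto simp: indicator_def)
  qed (use r in auto)
  also have "(\<lambda>x. f x * indicator A x) = (\<lambda>x. if x \<in> A then f x else 0)"
    by (auto simp: indicator_def)
  finally show ?thesis by (simp add: has_integral_restrict_UNIV)
qed

text \<open>Tonelli's theorem for \<open>has_integral\<close>: one iterated integral is known, the
  inner integral H of the other order is given pointwise, and the integrability of H is part of the
  conclusion.\<close>

lemma has_integral_tonelli:
  fixes f :: "real \<Rightarrow> real \<Rightarrow> real"
  assumes meas [measurable]: "(\<lambda>(x, y). f x y) \<in> borel_measurable (borel \<Otimes>\<^sub>M borel)" "A \<in> sets borel" "B \<in> sets borel"
    and nn: "\<And>x y. x \<in> A \<Longrightarrow> y \<in> B \<Longrightarrow> 0 \<le> f x y"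
    and G: "\<And>y. y \<in> B \<Longrightarrow> ((\<lambda>x. f x y) has_integral G y) A"
    and I: "(G has_integral I) B"
    and H: "\<And>x. x \<in> A \<Longrightarrow> (f x has_integral H x) B"
  shows "(H has_integral I) A"
proof -
  have G0: "0 \<le> G y" if "y \<in> B" for y
    using has_integral_nonneg[OF G[OF that]] nn that by blast
  have H0: "0 \<le> H x" if "x \<in> A" for x
    using has_integral_nonneg[OF H[OF that]] nn that by blast
  \<comment> \<open>The measurability behind the outer integral holds for K by construction; on A it
    agrees with H.\<close>
  define K where "K x = (\<integral>\<^sup>+y. ennreal (f x y) * indicator B y \<partial>lborel)" for x
  have K: "K x = ennreal (H x)" if "x \<in> A" for x
    unfolding K_def using nn that by (intro nn_integral_has_integral_lebesgue' H) auto
  have [measurable]: "(\<lambda>x. f (fst x) (snd x)) \<in> borel_measurable (borel \<Otimes>\<^sub>M borel)"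
    using meas(1) by (simp add: case_prod_beta')
  have [measurable]: "K \<in> borel_measurable borel"
    unfolding K_def by measurable
  have "(\<integral>\<^sup>+x. K x * indicator A x \<partial>lborel) = (\<integral>\<^sup>+x. (\<integral>\<^sup>+y. ennreal (f x y) * indicator B y * indicator A x \<partial>lborel) \<partial>lborel)"
    unfolding K_def by (intro nn_integral_cong) (simp add: nn_integral_multc)
  also have "\<dots> = (\<integral>\<^sup>+y. (\<integral>\<^sup>+x. ennreal (f x y) * indicator B y * indicator A x \<partial>lborel) \<partial>lborel)"
    by (intro lborel_pair.Fubini') measurable
  also have "\<dots> = (\<integral>\<^sup>+y. ennreal (G y) * indicator B y \<partial>lborel)"
  proof (intro nn_integral_cong)
    fix y
    have "(\<integral>\<^sup>+x. ennreal (f x y) * indicator B y * indicator A x \<partial>lborel)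
        = (\<integral>\<^sup>+x. (ennreal (f x y) * indicator A x) * indicator B y \<partial>lborel)"
      by (intro nn_integral_cong) (simp add: mult_ac)
    also have "\<dots> = (\<integral>\<^sup>+x. ennreal (f x y) * indicator A x \<partial>lborel) * indicator B y"
      by (intro nn_integral_multc) measurable
    also have "\<dots> = ennreal (G y) * indicator B y"
    proof (cases "y \<in> B")
      case True
      have "(\<integral>\<^sup>+x. ennreal (f x y) * indicator A x \<partial>lborel) = ennreal (G y)"
        using nn True by (intro nn_integral_has_integral_lebesgue' G) auto
      then show ?thesis by simp
    qed auto
    finally show "(\<integral>\<^sup>+x. ennreal (f x y) * indicator B y * indicator A x \<partial>lborel) = ennreal (G y) * indicator B y" .
  qed
  also have "\<dots> = ennreal I"
    using G0 by (intro nn_integral_has_integral_lebesgue' I)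
  finally have eq: "(\<integral>\<^sup>+x. K x * indicator A x \<partial>lborel) = ennreal I" .
  have "((\<lambda>x. enn2real (K x)) has_integral I) A"
  proof (rule has_integral_of_nn_integral)
    have "(\<integral>\<^sup>+x. ennreal (enn2real (K x)) * indicator A x \<partial>lborel) = (\<integral>\<^sup>+x. K x * indicator A x \<partial>lborel)"
      by (intro nn_integral_cong) (auto simp: indicator_def K H0)
    then show "(\<integral>\<^sup>+x. ennreal (enn2real (K x)) * indicator A x \<partial>lborel) = ennreal I"
      using eq by simp
    show "0 \<le> I" using has_integral_nonneg[OF I] G0 by blast
  qed auto
  then show ?thesis
    by (rule has_integral_eq[rotated]) (simp add: K H0)
qed

lemma has_integral_sums_nonneg:
  fixes f :: "nat \<Rightarrow> real \<Rightarrow> real"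
  assumes [measurable]: "\<And>n. f n \<in> borel_measurable borel" "A \<in> sets borel"
    and nn: "\<And>n x. x \<in> A \<Longrightarrow> 0 \<le> f n x"
    and I: "\<And>n. (f n has_integral I n) A" and S: "I sums S"
    and F: "\<And>x. x \<in> A \<Longrightarrow> (\<lambda>n. f n x) sums F x"
  shows "(F has_integral S) A"
proof -
  have I0: "0 \<le> I n" for n
    using has_integral_nonneg[OF I] nn by blast
  have "((\<lambda>x. \<Sum>n. f n x) has_integral S) A"
  proof (rule has_integral_of_nn_integral)
    have "(\<integral>\<^sup>+x. ennreal (\<Sum>n. f n x) * indicator A x \<partial>lborel) = (\<integral>\<^sup>+x. (\<Sum>n. ennreal (f n x) * indicator A x) \<partial>lborel)"
    proof (intro nn_integral_cong)
      fix x show "ennreal (\<Sum>n. f n x) * indicator A x = (\<Sum>n. ennreal (f n x) * indicator A x)"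
        using suminf_ennreal_eq[OF nn F, of x] F[of x] by (cases "x \<in> A") (auto simp: sums_iff)
    qed
    also have "\<dots> = (\<Sum>n. \<integral>\<^sup>+x. ennreal (f n x) * indicator A x \<partial>lborel)"
      by (intro nn_integral_suminf) measurable
    also have "\<dots> = (\<Sum>n. ennreal (I n))"
      using nn I by (intro suminf_cong nn_integral_has_integral_lebesgue') auto
    also have "\<dots> = ennreal S"
      using I0 S by (rule suminf_ennreal_eq)
    finally show "(\<integral>\<^sup>+x. ennreal (\<Sum>n. f n x) * indicator A x \<partial>lborel) = ennreal S" .
    show "0 \<le> (\<Sum>n. f n x)" if "x \<in> A" for x
      using sums_summable[OF F[OF that]] nn[OF that] by (intro suminf_nonneg)
    show "0 \<le> S" by (rule sums_le[OF I0 sums_zero S])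
  qed auto
  then show ?thesis
    by (rule has_integral_eq[rotated]) (use F in \<open>auto simp: sums_iff\<close>)
qed

lemma has_integral_substitution_half_line:
  fixes f g g' :: "real \<Rightarrow> real"
  assumes f: "(f has_integral I) {0<..}" and nn: "\<And>x. x > 0 \<Longrightarrow> 0 \<le> f x"
    and g: "bij_betw g {0<..} {0<..}" and g': "\<And>x. x > 0 \<Longrightarrow> (g has_field_derivative g' x) (at x)"
    and pos: "\<And>x. x > 0 \<Longrightarrow> 0 \<le> g' x"
  shows "((\<lambda>x. g' x * f (g x)) has_integral I) {0<..}"
proof -
  have img: "g ` {0<..} = {0<..}" and inj: "inj_on g {0<..}"
    using g by (auto simp: bij_betw_def)
  have "f absolutely_integrable_on g ` {0<..} \<and> integral (g ` {0<..}) f = I"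
    unfolding img using f nn
    by (auto intro!: nonnegative_absolutely_integrable_1 simp: has_integral_integrable integral_unique)
  then have "(\<lambda>x. \<bar>g' x\<bar> * f (g x)) absolutely_integrable_on {0<..} \<and> integral {0<..} (\<lambda>x. \<bar>g' x\<bar> * f (g x)) = I"
    by (subst has_absolute_integral_change_of_variables_1'[OF _ _ inj])
       (auto intro: has_field_derivative_at_within g')
  then have "((\<lambda>x. \<bar>g' x\<bar> * f (g x)) has_integral I) {0<..}"
    by (metis absolutely_integrable_on_def has_integral_integral)
  then show ?thesis
    by (rule has_integral_eq[rotated]) (use pos in auto)
qed

lemma has_integral_Gamma_scaled:
  fixes s y :: real
  assumes s: "s > 0" and y: "y > 0"
  shows "((\<lambda>x. x powr (s - 1) * exp (- (x * y))) has_integral Gamma s * y powr (- s)) {0<..}"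
proof -
  have "((\<lambda>t. t powr (s - 1) / exp t) has_integral Gamma s) {0<..}"
  proof -
    have "((\<lambda>t. complex_of_real t powr (complex_of_real s - 1) / complex_of_real (exp t)) has_integral complex_of_real (Gamma s)) {0<..}"
      using Gamma_integral_complex'[of s] s by (simp_all add: Gamma_complex_of_real)
    then have "((\<lambda>t. complex_of_real (t powr (s - 1) / exp t)) has_integral of_real (Gamma s)) {0<..}"
      by (rule has_integral_eq[rotated]) (simp_all add: powr_of_real [symmetric])
    from has_integral_linear[OF this bounded_linear_Re] show ?thesis by (simp add: o_def)
  qed
  then have "((\<lambda>x. y * ((x * y) powr (s - 1) / exp (x * y))) has_integral Gamma s) {0<..}"
  proof (rule has_integral_substitution_half_line[where g = "\<lambda>x. x * y" and g' = "\<lambda>_. y"])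
    show "bij_betw (\<lambda>x. x * y) {0<..} {0<..}"
      by (rule bij_betw_byWitness[where f' = "\<lambda>x. x / y"]) (use y in auto)
    show "((\<lambda>x. x * y) has_field_derivative y) (at x)" for x
      by (auto intro!: derivative_eq_intros)
  qed (use y in auto)
  then have "((\<lambda>x. y powr (- s) * (y * ((x * y) powr (s - 1) / exp (x * y)))) has_integral y powr (- s) * Gamma s) {0<..}"
    by (rule has_integral_mult_right)
  then show ?thesis
    unfolding mult.commute[of "Gamma s"]
  proof (rule has_integral_eq[rotated])
    fix x :: real assume "x \<in> {0<..}"
    then have x: "x > 0" by simp
    have "y powr (- s) * y * y powr (s - 1) = 1"
      using y by (simp add: powr_minus powr_diff field_simps)
    then show "y powr (- s) * (y * ((x * y) powr (s - 1) / exp (x * y))) = x powr (s - 1) * exp (- (x * y))"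
      using x y by (simp add: powr_mult exp_minus field_simps)
  qed
qed

section \<open>Partial fractions of the Bose kernel\<close>

lemma Digamma_reflection_complex:
  fixes z :: complex
  assumes z: "z \<notin> \<int>"
  shows "Digamma z - Digamma (1 - z) = - of_real pi * cos (of_real pi * z) / sin (of_real pi * z)"
proof -
  have z1: "1 - z \<notin> \<int>" using z by (metis Ints_1 Ints_diff diff_diff_eq2 add_diff_cancel_left')
  have n: "z \<notin> \<int>\<^sub>\<le>\<^sub>0" "1 - z \<notin> \<int>\<^sub>\<le>\<^sub>0"
    using z z1 by (auto dest: nonpos_Ints_Int)
  have s0: "sin (of_real pi * z) \<noteq> 0"
    using z by (simp add: sin_eq_0) (metis Ints_of_int mult.commute mult_cancel_left of_real_eq_0_iff pi_neq_zero)
  \<comment> \<open>Both sides of Euler's reflection formula are differentiated and then divided by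
    their common value.\<close>
  have "((\<lambda>z. Gamma z * Gamma (1 - z)) has_field_derivative
          Gamma z * Gamma (1 - z) * (Digamma z - Digamma (1 - z))) (at z)"
    using n by (auto intro!: derivative_eq_intros simp: algebra_simps)
  moreover have "((\<lambda>z. of_real pi / sin (of_real pi * z)) has_field_derivative
          (of_real pi / sin (of_real pi * z)) * (- of_real pi * cos (of_real pi * z) / sin (of_real pi * z))) (at z)"
  proof -
    have d: "((\<lambda>z. sin (of_real pi * z)) has_field_derivative cos (of_real pi * z) * of_real pi) (at z)"
      by (auto intro!: derivative_eq_intros)
    have "(0 * S - p * (C * p)) / (S * S) = (p / S) * (- p * C / S)" for S C p :: complex
      by (simp add: field_simps)
    from DERIV_divide[OF DERIV_const d s0, of "of_real pi", unfolded this] show ?thesis .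
  qed
  moreover have "(\<lambda>z. Gamma z * Gamma (1 - z)) = (\<lambda>z :: complex. of_real pi / sin (of_real pi * z))"
    by (simp add: Gamma_reflection_complex fun_eq_iff)
  ultimately have "Gamma z * Gamma (1 - z) * (Digamma z - Digamma (1 - z))
      = (of_real pi / sin (of_real pi * z)) * (- of_real pi * cos (of_real pi * z) / sin (of_real pi * z))"
    using DERIV_unique by metis
  moreover have "of_real pi / sin (of_real pi * z) \<noteq> 0" using s0 by simp
  ultimately show ?thesis
    unfolding Gamma_reflection_complex mult_cancel_left by blast
qed

text \<open>Removing the terms 1 / x and -1/2 of the expansion of 1 / (e^x - 1) at 0 leaves a
  function that is O(x) there and tends to 1/2 at infinity, so its Mellin integral converges for -1
  < v < 0. It equals coth(x / 2) / 2 - 1 / x.\<close>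

definition bose_kernel :: "real \<Rightarrow> real" where
  "bose_kernel x = 1 / (exp x - 1) - 1 / x + 1 / 2"

text \<open>These are the partial fractions of the cotangent at an imaginary point. With z = i x /
  (2 pi), the series of Digamma(1 + z) - Digamma(1 - z) pairs the simple fractions, and the
  reflection formula evaluates the difference.\<close>

lemma bose_kernel_sums:
  assumes x: "x > 0"
  shows "(\<lambda>n. 2 * x / (x\<^sup>2 + (2 * pi * real (Suc n))\<^sup>2)) sums bose_kernel x"
proof -
  define y where "y = x / (2 * pi)"
  have y: "y > 0" using x by (simp add: y_def)
  define z where "z = \<i> * of_real y"
  have zI: "z \<notin> \<int>" using y by (auto simp: z_def Ints_def complex_eq_iff)
  then have z0: "z \<noteq> 0" "1 + z \<noteq> 0" "1 - z \<noteq> 0"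
    using y by (auto simp: z_def complex_eq_iff)
  define f where "f w n = inverse (of_nat (Suc n)) - inverse (w + of_nat n)" for w :: complex and n
  have f: "f w sums (Digamma w + euler_mascheroni)" if "w \<noteq> 0" for w
    using summable_sums[OF summable_Digamma[OF that]] by (simp add: f_def[abs_def] Digamma_def)
  have "(\<lambda>n. f (1 + z) n - f (1 - z) n) sums
      ((Digamma (1 + z) + euler_mascheroni) - (Digamma (1 - z) + euler_mascheroni))"
    using z0 by (intro sums_diff f) auto
  also have "(Digamma (1 + z) + euler_mascheroni) - (Digamma (1 - z) + euler_mascheroni) = Digamma z + 1 / z - Digamma (1 - z)"
    using Digamma_plus1[of z] z0 by (simp add: add.commute)
  also have "\<dots> = 1 / z - of_real pi * cos (of_real pi * z) / sin (of_real pi * z)"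
    using Digamma_reflection_complex[OF zI] by (simp add: algebra_simps)
  also have "(\<lambda>n. f (1 + z) n - f (1 - z) n) = (\<lambda>k. \<i> * of_real (2 * y / ((real (Suc k))\<^sup>2 + y\<^sup>2)))"
  proof
    fix k
    have nz: "1 + z + of_nat k \<noteq> 0" "1 - z + of_nat k \<noteq> 0"
      using y by (auto simp: z_def complex_eq_iff)
    have prod: "(1 + z + of_nat k) * (1 - z + of_nat k) = of_real ((real (Suc k))\<^sup>2 + y\<^sup>2)"
      by (simp add: z_def algebra_simps power2_eq_square complex_eq_iff)
    have "f (1 + z) k - f (1 - z) k = 2 * z / ((1 + z + of_nat k) * (1 - z + of_nat k))"
      using nz by (simp add: f_def field_simps)
    then show "f (1 + z) k - f (1 - z) k = \<i> * of_real (2 * y / ((real (Suc k))\<^sup>2 + y\<^sup>2))"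
      unfolding prod by (simp add: z_def)
  qed
  finally have sums1: "(\<lambda>k. \<i> * of_real (2 * y / ((real (Suc k))\<^sup>2 + y\<^sup>2))) sums
      (1 / z - of_real pi * cos (of_real pi * z) / sin (of_real pi * z))" .
  have ex: "exp x \<noteq> 1" using x by simp
  have "1 / z - of_real pi * cos (of_real pi * z) / sin (of_real pi * z) = \<i> * of_real (2 * pi * bose_kernel x)"
  proof -
    \<comment> \<open>As E^2 = e^x and exp(i pi z) = 1 / E, the cotangent becomes a rational
      function of e^x.\<close>
    define E where "E = exp (pi * y)"
    have E: "E > 0" "E * E = exp x" by (simp_all add: E_def exp_add[symmetric] y_def)
    have e1: "exp (\<i> * (of_real pi * z)) = of_real (1 / E)" "exp (- (\<i> * (of_real pi * z))) = of_real E"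
      by (simp_all add: z_def E_def exp_of_real[symmetric] exp_minus[symmetric] mult_ac inverse_eq_divide[symmetric])
    have c: "cos (of_real pi * z) = of_real ((1 / E + E) / 2)"
      unfolding cos_exp_eq e1 by simp
    have s: "sin (of_real pi * z) = \<i> * of_real ((E - 1 / E) / 2)"
      unfolding sin_exp_eq e1 by (simp add: field_simps)
    have "cos (of_real pi * z) / sin (of_real pi * z) = - \<i> * of_real ((1 / E + E) / (E - 1 / E))"
    proof -
      have aux: "A / (\<i> * B) = - \<i> * (A / B)" for A B :: complex
        by (cases "B = 0") (auto simp: field_simps)
      have "(P / 2) / (Q / 2) = P / Q" for P Q :: real
        by simp
      then have "((1 / E + E) / 2) / ((E - 1 / E) / 2) = (1 / E + E) / (E - 1 / E)" .
      then show ?thesis unfolding c s aux of_real_divide[symmetric] by (simp only:)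
    qed
    also have "(1 / E + E) / (E - 1 / E) = (exp x + 1) / (exp x - 1)"
    proof -
      have "(1 / E + E) / (E - 1 / E) = ((1 / E + E) * E) / ((E - 1 / E) * E)" using E by simp
      then show ?thesis using E by (simp add: algebra_simps)
    qed
    finally have cs: "cos (of_real pi * z) / sin (of_real pi * z) = - \<i> * of_real ((exp x + 1) / (exp x - 1))" .
    have "1 / z - of_real pi * (cos (of_real pi * z) / sin (of_real pi * z)) = \<i> * of_real (- 1 / y + pi * ((exp x + 1) / (exp x - 1)))"
    proof -
      have "1 / z = - \<i> * of_real (1 / y)"
        using y by (simp add: z_def field_simps)
      then have "1 / z - of_real pi * (- \<i> * of_real q) = \<i> * of_real (- 1 / y + pi * q)" for q
        by (simp add: algebra_simps)
      then show ?thesis unfolding cs .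
    qed
    also have "- 1 / y + pi * ((exp x + 1) / (exp x - 1)) = 2 * pi * bose_kernel x"
      using x ex by (simp add: bose_kernel_def y_def field_simps)
    finally show ?thesis by simp
  qed
  with sums1 have "(\<lambda>k. \<i> * of_real (2 * y / ((real (Suc k))\<^sup>2 + y\<^sup>2))) sums (\<i> * of_real (2 * pi * bose_kernel x))"
    by simp
  from sums_Im[OF this] have "(\<lambda>k. 2 * y / ((real (Suc k))\<^sup>2 + y\<^sup>2)) sums (2 * pi * bose_kernel x)"
    by simp
  from sums_divide[OF this, of "2 * pi"] have "(\<lambda>k. 2 * y / ((real (Suc k))\<^sup>2 + y\<^sup>2) / (2 * pi)) sums bose_kernel x"
    by simp
  also have "(\<lambda>k. 2 * y / ((real (Suc k))\<^sup>2 + y\<^sup>2) / (2 * pi)) = (\<lambda>n. 2 * x / (x\<^sup>2 + (2 * pi * real (Suc n))\<^sup>2))"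
  proof
    fix n
    have p: "(real (Suc n))\<^sup>2 + y\<^sup>2 > 0" by (intro add_pos_nonneg) auto
    have aux: "2 * (2 * pi * y) / ((2 * pi)\<^sup>2 * Q) = 2 * y / Q / (2 * pi)" if "Q > 0" for Q
      using that by (simp add: power2_eq_square field_simps)
    have x_eq: "x = 2 * pi * y" by (simp add: y_def)
    have "x\<^sup>2 + (2 * pi * real (Suc n))\<^sup>2 = (2 * pi)\<^sup>2 * ((real (Suc n))\<^sup>2 + y\<^sup>2)"
      unfolding x_eq power_mult_distrib by (simp add: algebra_simps)
    then have "2 * x / (x\<^sup>2 + (2 * pi * real (Suc n))\<^sup>2) = 2 * (2 * pi * y) / ((2 * pi)\<^sup>2 * ((real (Suc n))\<^sup>2 + y\<^sup>2))"
      using x_eq by simp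
    also have "\<dots> = 2 * y / ((real (Suc n))\<^sup>2 + y\<^sup>2) / (2 * pi)"
      using p by (rule aux)
    finally show "2 * y / ((real (Suc n))\<^sup>2 + y\<^sup>2) / (2 * pi) = 2 * x / (x\<^sup>2 + (2 * pi * real (Suc n))\<^sup>2)" by simp
  qed
  finally show ?thesis .
qed

lemma bose_kernel_nonneg: "x > 0 \<Longrightarrow> 0 \<le> bose_kernel x"
  by (rule sums_le[OF _ sums_zero bose_kernel_sums]) (auto intro!: divide_nonneg_nonneg add_nonneg_nonneg)

section \<open>The Mellin transform of the Bose kernel as a sum of trapezoidal errors\<close>

lemma has_integral_insert_left_endpoint:
  "(f has_integral I) {a<..b} \<longleftrightarrow> (f has_integral I) {a..b}" for f :: "real \<Rightarrow> real"
proof (rule has_integral_spike_set_eq)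
  show "negligible {x \<in> {a<..b} - {a..b}. f x \<noteq> 0}" by (rule negligible_subset[of "{}"]) auto
  show "negligible {x \<in> {a..b} - {a<..b}. f x \<noteq> 0}" by (rule negligible_subset[of "{a}"]) auto
qed

lemma Gamma_real_step:
  fixes v :: real
  assumes "-1 < v" "v < 0"
  shows "Gamma (v + 1) = v * Gamma v" and "Gamma v = (v - 1) * Gamma (v - 1)"
proof -
  have "v \<notin> \<int>" using assms by (auto elim!: Ints_cases)
  moreover from this have "v - 1 \<notin> \<int>" by (metis Ints_1 Ints_add diff_add_cancel)
  ultimately have n: "v \<notin> \<int>\<^sub>\<le>\<^sub>0" "v - 1 \<notin> \<int>\<^sub>\<le>\<^sub>0" by (auto dest: nonpos_Ints_Int)
  from Gamma_plus1[OF n(1)] Gamma_plus1[OF n(2)]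
  show "Gamma (v + 1) = v * Gamma v" "Gamma v = (v - 1) * Gamma (v - 1)" by simp_all
qed

text \<open>Euler's integral beyond its range of convergence, after subtraction of the constant
  Taylor term. It arises by integrating Euler's integral at v + 1 over the parameter y from 0 to a,
  which keeps the integrand nonnegative; the sign is restored at the end. The case a = 0, where both
  sides vanish by \<open>0 powr y = 0\<close>, serves the left end of the interval [0, 1].\<close>

lemma has_integral_Gamma_Cauchy_Saalschuetz:
  fixes v a :: real
  assumes v: "-1 < v" "v < 0" and a: "a \<ge> 0"
  shows "((\<lambda>x. x powr (v - 1) * (exp (- (a * x)) - 1)) has_integral Gamma v * a powr (- v)) {0<..}"
proof (cases "a = 0")
  case False
  with a have a: "a > 0" by simp
  have "((\<lambda>x. x powr (v - 1) * (1 - exp (- (a * x)))) has_integral Gamma (v + 1) * (a powr (- v) / (- v))) {0<..}"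
  proof (rule has_integral_tonelli[where B = "{0<..a}" and f = "\<lambda>x y. x powr v * exp (- (x * y))"])
    show "((\<lambda>x. x powr v * exp (- (x * y))) has_integral Gamma (v + 1) * y powr (- (v + 1))) {0<..}"
      if "y \<in> {0<..a}" for y
      using has_integral_Gamma_scaled[of "v + 1" y] v that by simp
    have "((\<lambda>y. y powr (- (v + 1))) has_integral a powr (- v) / (- v)) {0..a}"
      using has_integral_powr_from_0[of "- (v + 1)" a] v a by simp
    then show "((\<lambda>y. Gamma (v + 1) * y powr (- (v + 1))) has_integral Gamma (v + 1) * (a powr (- v) / (- v))) {0<..a}"
      unfolding has_integral_insert_left_endpoint by (rule has_integral_mult_right)
    fix x :: real assume "x \<in> {0<..}"
    then have x: "x > 0" by simp
    have "((\<lambda>y. x powr v * exp (- (x * y))) has_integral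
        - (x powr (v - 1) * exp (- (x * a))) - - (x powr (v - 1) * exp (- (x * 0)))) {0..a}"
      using a x by (intro fundamental_theorem_of_calculus)
        (auto intro!: derivative_eq_intros simp flip: has_real_derivative_iff_has_vector_derivative simp: powr_diff)
    then show "((\<lambda>y. x powr v * exp (- (x * y))) has_integral x powr (v - 1) * (1 - exp (- (a * x)))) {0<..a}"
      unfolding has_integral_insert_left_endpoint by (simp add: algebra_simps)
  qed (use v in auto)
  from has_integral_neg[OF this] show ?thesis
    using v Gamma_real_step(1)[OF v] by (simp add: algebra_simps)
qed (use assms in \<open>simp add: has_integral_0\<close>)

text \<open>A second integration over the parameter, applied to the preceding formula, reaches the
  exponent v - 1 in (-2, -1), where two Taylor terms have to be removed.\<close>

lemma has_integral_Gamma_Cauchy_Saalschuetz_2: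
  fixes v a :: real
  assumes v: "-1 < v" "v < 0" and a: "a \<ge> 0"
  shows "((\<lambda>x. x powr (v - 2) * (exp (- (a * x)) - 1 + a * x)) has_integral Gamma (v - 1) * a powr (1 - v)) {0<..}"
proof (cases "a = 0")
  case False
  with a have a: "a > 0" by simp
  have "((\<lambda>x. x powr (v - 2) * (exp (- (a * x)) - 1 + a * x)) has_integral - Gamma v * (a powr (1 - v) / (1 - v))) {0<..}"
  proof (rule has_integral_tonelli[where B = "{0<..a}" and f = "\<lambda>x y. x powr (v - 1) * (1 - exp (- (y * x)))"])
    show "((\<lambda>x. x powr (v - 1) * (1 - exp (- (y * x)))) has_integral - Gamma v * y powr (- v)) {0<..}"
      if "y \<in> {0<..a}" for y
      using has_integral_neg[OF has_integral_Gamma_Cauchy_Saalschuetz[OF v, of y]] that by (simp add: algebra_simps)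
    have "((\<lambda>y. y powr (- v)) has_integral a powr (1 - v) / (1 - v)) {0..a}"
      using has_integral_powr_from_0[of "- v" a] v a by (simp add: add.commute)
    then show "((\<lambda>y. - Gamma v * y powr (- v)) has_integral - Gamma v * (a powr (1 - v) / (1 - v))) {0<..a}"
      unfolding has_integral_insert_left_endpoint by (rule has_integral_mult_right)
    fix x :: real assume "x \<in> {0<..}"
    then have x: "x > 0" by simp
    have xp: "x powr (v - 1) = x powr (v - 2) * x" using x by (simp add: powr_diff power2_eq_square)
    have "((\<lambda>y. x powr (v - 1) * (1 - exp (- (y * x)))) has_integral
        (x powr (v - 2) * (exp (- (a * x)) + a * x)) - (x powr (v - 2) * (exp (- (0 * x)) + 0 * x))) {0..a}"
      using a x unfolding xp by (intro fundamental_theorem_of_calculus)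
        (auto intro!: derivative_eq_intros simp flip: has_real_derivative_iff_has_vector_derivative simp: algebra_simps)
    then show "((\<lambda>y. x powr (v - 1) * (1 - exp (- (y * x)))) has_integral x powr (v - 2) * (exp (- (a * x)) - 1 + a * x)) {0<..a}"
      unfolding has_integral_insert_left_endpoint by (simp add: algebra_simps)
  qed auto
  also have "- Gamma v * (a powr (1 - v) / (1 - v)) = Gamma (v - 1) * a powr (1 - v)"
    by (subst Gamma_real_step(2)[OF v]) (use v in \<open>simp add: field_simps\<close>)
  finally show ?thesis .
qed (use assms in \<open>simp add: has_integral_0\<close>)

lemma Gamma_reflection_real: "Gamma x * Gamma (1 - x) = pi / sin (pi * x)" for x :: real
proof -
  have "complex_of_real (Gamma x * Gamma (1 - x)) = Gamma (of_real x) * Gamma (1 - of_real x)"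
    by (simp add: Gamma_complex_of_real[symmetric])
  also have "\<dots> = of_real (pi / sin (pi * x))"
    unfolding Gamma_reflection_complex by (simp add: sin_of_real[symmetric])
  finally show ?thesis by (simp only: of_real_eq_iff)
qed

text \<open>The real form of \<open>trapezoid_term\<close> divided by s - 1. It is also used at n =
  0, where \<open>0 powr y = 0\<close> is the correct endpoint value of u^(-v) and u^(1 - v) because
  v < 0.\<close>

definition trapezoid_real :: "nat \<Rightarrow> real \<Rightarrow> real" where
  "trapezoid_real n v = (real n powr (- v) + real (n + 1) powr (- v)) / 2
     - (real n powr (1 - v) - real (n + 1) powr (1 - v)) / (v - 1)"

text \<open>The function (e^(-nx) - e^(-(n+1)x)) \<open>bose_kernel x\<close> is the trapezoidal
  error of u -> e^(-ux) on [n, n + 1], and the regularised Mellin transform takes e^(-ux) to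
  Gamma(v) u^(-v). The Taylor terms subtracted for convergence cancel, since the rule is exact for
  constants.\<close>

lemma has_integral_trapezoid_real:
  assumes v: "-1 < v" "v < 0"
  shows "((\<lambda>x. x powr (v - 1) * (exp (- (real n * x)) * (1 - exp (- x)) * bose_kernel x))
           has_integral Gamma v * trapezoid_real n v) {0<..}"
proof -
  note A = has_integral_Gamma_Cauchy_Saalschuetz[OF v] and B = has_integral_Gamma_Cauchy_Saalschuetz_2[OF v]
  have "((\<lambda>x. (x powr (v - 1) * (exp (- (real n * x)) - 1) + x powr (v - 1) * (exp (- (real (n + 1) * x)) - 1)) * (1 / 2)
      - (x powr (v - 2) * (exp (- (real n * x)) - 1 + real n * x) - x powr (v - 2) * (exp (- (real (n + 1) * x)) - 1 + real (n + 1) * x)))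
     has_integral (Gamma v * real n powr (- v) + Gamma v * real (n + 1) powr (- v)) * (1 / 2)
       - (Gamma (v - 1) * real n powr (1 - v) - Gamma (v - 1) * real (n + 1) powr (1 - v))) {0<..}"
    by (intro has_integral_diff has_integral_mult_left has_integral_add A B) auto
  also have "(Gamma v * real n powr (- v) + Gamma v * real (n + 1) powr (- v)) * (1 / 2)
       - (Gamma (v - 1) * real n powr (1 - v) - Gamma (v - 1) * real (n + 1) powr (1 - v)) = Gamma v * trapezoid_real n v"
  proof -
    have G: "Gamma (v - 1) = Gamma v / (v - 1)" using Gamma_real_step(2)[OF v] v by simp
    show ?thesis unfolding G trapezoid_real_def by (simp add: algebra_simps diff_divide_distrib add_divide_distrib)
  qed
  finally show ?thesis
  proof (rule has_integral_eq[rotated])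
    fix x :: real assume "x \<in> {0<..}"
    then have x: "x > 0" by simp
    define e q where "e = exp (- (real n * x))" and "q = exp (- x)"
    have eq: "exp (- (real (n + 1) * x)) = e * q"
      by (simp add: e_def q_def exp_add[symmetric] algebra_simps)
    have q: "q > 0" "q \<noteq> 1" and qx: "exp x = 1 / q" using x by (auto simp: q_def exp_minus field_simps)
    define w where "w = x powr (v - 2)"
    have xp: "x powr (v - 1) = w * x" using x by (simp add: w_def powr_diff power2_eq_square)
    have "x * ((1 - q) * bose_kernel x) = x * q - (1 - q) + x * (1 - q) / 2"
      unfolding bose_kernel_def qx using q x by (simp add: field_simps)
    then have "x * (e * (1 - q) * bose_kernel x) = e * (x * q - (1 - q) + x * (1 - q) / 2)"
      by (metis mult.assoc mult.left_commute)
    then have 1: "w * x * (e * (1 - q) * bose_kernel x) = w * (e * (x * q - (1 - q) + x * (1 - q) / 2))"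
      by (simp only: mult.assoc)
    show "(x powr (v - 1) * (exp (- (real n * x)) - 1) + x powr (v - 1) * (exp (- (real (n + 1) * x)) - 1)) * (1 / 2)
      - (x powr (v - 2) * (exp (- (real n * x)) - 1 + real n * x) - x powr (v - 2) * (exp (- (real (n + 1) * x)) - 1 + real (n + 1) * x))
      = x powr (v - 1) * (exp (- (real n * x)) * (1 - exp (- x)) * bose_kernel x)"
      unfolding eq xp w_def[symmetric] e_def[symmetric] q_def[symmetric] 1 by (simp add: field_simps)
  qed
qed

lemma trapezoid_term_of_real:
  "n \<ge> 1 \<Longrightarrow> v \<noteq> 1 \<Longrightarrow> trapezoid_term n (of_real v) = of_real ((v - 1) * trapezoid_real n v)"
proof -
  assume "v \<noteq> 1"
  then have r: "(v - 1) * trapezoid_real n v = (v - 1) * (real n powr (- v) + real (n + 1) powr (- v)) / 2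
     - (real n powr (1 - v) - real (n + 1) powr (1 - v))"
    unfolding trapezoid_real_def right_diff_distrib[of "v - 1"] by simp
  show ?thesis
    unfolding r trapezoid_term_def by (simp add: powr_of_real[symmetric])
qed

text \<open>The error on [0, 1] is 1/2 + 1 / (v - 1), which is the part of \<open>zeta_num\<close>
  outside its series, divided by v - 1. Starting at n = 0 absorbs the elementary terms.\<close>

lemma trapezoid_real_sums:
  assumes v: "-1 < v" "v < 0"
  shows "(\<lambda>n. trapezoid_real n v) sums Re (zeta_num (of_real v) / (of_real v - 1))"
    and "zeta_num (of_real v) / (of_real v - 1) \<in> \<real>"
proof -
  define z where "z = complex_of_real v"
  have s1: "z - 1 \<noteq> 0" "v \<noteq> 1" using v by (auto simp: z_def complex_eq_iff)
  have "(\<lambda>n. trapezoid_term (Suc n) z / (z - 1)) sums ((\<Sum>n. trapezoid_term (Suc n) z) / (z - 1))"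
    using v by (intro sums_divide summable_sums summable_trapezoid_term) (auto simp: z_def)
  also have "(\<lambda>n. trapezoid_term (Suc n) z / (z - 1)) = (\<lambda>n. of_real (trapezoid_real (Suc n) v))"
    using s1 by (auto simp: z_def trapezoid_term_of_real fun_eq_iff)
  finally have S: "(\<lambda>n. of_real (trapezoid_real (Suc n) v)) sums ((\<Sum>n. trapezoid_term (Suc n) z) / (z - 1))" .
  have t0: "complex_of_real (trapezoid_real 0 v) = 1 / 2 + 1 / (z - 1)"
    using v by (simp add: trapezoid_real_def z_def field_simps)
  have zn: "zeta_num z / (z - 1) = (\<Sum>n. trapezoid_term (Suc n) z) / (z - 1) + (1 / 2 + 1 / (z - 1))"
    using s1 by (simp add: zeta_num_def add_divide_distrib)
  from S have sum: "(\<lambda>n. complex_of_real (trapezoid_real n v)) sums (zeta_num z / (z - 1))"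
    unfolding zn t0[symmetric] by (rule sums_Suc)
  from sums_Re[OF this] show "(\<lambda>n. trapezoid_real n v) sums Re (zeta_num (of_real v) / (of_real v - 1))"
    by (simp add: z_def)
  from sums_Im[OF sum] have "(\<lambda>n. 0) sums Im (zeta_num z / (z - 1))" by simp
  from sums_unique2[OF this sums_zero] show "zeta_num (of_real v) / (of_real v - 1) \<in> \<real>"
    unfolding z_def complex_is_Real_iff .
qed

text \<open>The weights e^(-nx) (1 - e^(-x)) form a geometric series with sum 1, so the trapezoidal
  integrals add up to the integral of the kernel itself.\<close>

lemma has_integral_bose_kernel_zeta:
  assumes v: "-1 < v" "v < 0"
  shows "((\<lambda>x. x powr (v - 1) * bose_kernel x) has_integral
            Gamma v * Re (zeta_num (of_real v) / (of_real v - 1))) {0<..}"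
proof (rule has_integral_sums_nonneg)
  show "((\<lambda>x. x powr (v - 1) * (exp (- (real n * x)) * (1 - exp (- x)) * bose_kernel x))
           has_integral Gamma v * trapezoid_real n v) {0<..}" for n
    by (rule has_integral_trapezoid_real[OF v])
  show "(\<lambda>n. Gamma v * trapezoid_real n v) sums (Gamma v * Re (zeta_num (of_real v) / (of_real v - 1)))"
    by (intro sums_mult trapezoid_real_sums v)
  show "(\<lambda>x. x powr (v - 1) * (exp (- (real n * x)) * (1 - exp (- x)) * bose_kernel x)) \<in> borel_measurable borel" for n
    unfolding bose_kernel_def by measurable
  fix x :: real assume "x \<in> {0<..}"
  then have x: "x > 0" by simp
  show "0 \<le> x powr (v - 1) * (exp (- (real n * x)) * (1 - exp (- x)) * bose_kernel x)" for n
    using x bose_kernel_nonneg[OF x] by (intro mult_nonneg_nonneg) auto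
  have "(\<lambda>n. exp (- x) ^ n) sums (1 / (1 - exp (- x)))"
    using x by (intro geometric_sums) auto
  from sums_mult[OF this, of "x powr (v - 1) * ((1 - exp (- x)) * bose_kernel x)"]
  show "(\<lambda>n. x powr (v - 1) * (exp (- (real n * x)) * (1 - exp (- x)) * bose_kernel x)) sums (x powr (v - 1) * bose_kernel x)"
    using x by (simp add: exp_of_nat_mult[symmetric] mult_ac)
qed auto

section \<open>The functional equation on the real interval\<close>

lemma has_integral_Mellin_resolvent:
  fixes v a :: real
  assumes v: "-1 < v" "v < 0" and a: "a > 0"
  shows "((\<lambda>x. x powr (v - 1) * (2 * x / (x\<^sup>2 + a\<^sup>2))) has_integral pi / cos (pi * v / 2) * a powr (v - 1)) {0<..}"
proof -
  \<comment> \<open>The substitution w = x^2 turns 2 x^v dx into w^(tau - 1) dw. Writing 1 / (x^2 +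
    a^2) as the integral of exp(-y (x^2 + a^2)) over y then leads to Gamma(tau) Gamma(1 -
    tau).\<close>
  define \<tau> where "\<tau> = (v + 1) / 2"
  have \<tau>: "0 < \<tau>" "\<tau> < 1" using v by (auto simp: \<tau>_def)
  have square_powr: "(x\<^sup>2) powr (\<tau> - 1) = x powr (v - 1)" if "x > 0" for x :: real
  proof -
    have "2 * (\<tau> - 1) = v - 1" by (simp add: \<tau>_def field_simps)
    then have "(x powr 2) powr (\<tau> - 1) = x powr (v - 1)" by (simp only: powr_powr)
    then show ?thesis using that by simp
  qed
  have "((\<lambda>x. 2 * x powr v * (1 / (x\<^sup>2 + a\<^sup>2))) has_integral Gamma \<tau> * (Gamma (1 - \<tau>) * (a\<^sup>2) powr (- (1 - \<tau>)))) {0<..}"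
  proof (rule has_integral_tonelli[where B = "{0<..}" and f = "\<lambda>x y. 2 * x powr v * exp (- (y * (x\<^sup>2 + a\<^sup>2)))"])
    show "((\<lambda>x. 2 * x powr v * exp (- (y * (x\<^sup>2 + a\<^sup>2)))) has_integral Gamma \<tau> * (y powr ((1 - \<tau>) - 1) * exp (- (y * a\<^sup>2)))) {0<..}"
      if "y \<in> {0<..}" for y
    proof -
      have "((\<lambda>x. (2 * x) * ((x\<^sup>2) powr (\<tau> - 1) * exp (- (x\<^sup>2 * y)))) has_integral Gamma \<tau> * y powr (- \<tau>)) {0<..}"
      proof (rule has_integral_substitution_half_line[where g = "\<lambda>x. x\<^sup>2"])
        show "((\<lambda>w. w powr (\<tau> - 1) * exp (- (w * y))) has_integral Gamma \<tau> * y powr (- \<tau>)) {0<..}"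
          using that \<tau> by (intro has_integral_Gamma_scaled) auto
        show "bij_betw (\<lambda>x::real. x\<^sup>2) {0<..} {0<..}"
          by (rule bij_betw_byWitness[where f' = sqrt]) auto
        show "((\<lambda>x. x\<^sup>2) has_field_derivative 2 * x) (at x)" for x :: real
          by (auto intro!: derivative_eq_intros)
      qed auto
      from has_integral_mult_right[OF this, of "exp (- (y * a\<^sup>2))"]
      have "((\<lambda>x. exp (- (y * a\<^sup>2)) * ((2 * x) * ((x\<^sup>2) powr (\<tau> - 1) * exp (- (x\<^sup>2 * y))))) has_integral Gamma \<tau> * (y powr ((1 - \<tau>) - 1) * exp (- (y * a\<^sup>2)))) {0<..}"
        by (simp add: mult_ac)
      then show ?thesis
      proof (rule has_integral_eq[rotated])
        fix x :: real assume "x \<in> {0<..}"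
        then have x: "x > 0" by simp
        have "(x\<^sup>2) powr (\<tau> - 1) = x powr (v - 1)"
          using x square_powr by simp
        then have "(2 * x) * (x\<^sup>2) powr (\<tau> - 1) = 2 * x powr v"
          using x by (simp add: powr_diff)
        moreover have "exp (- (y * (x\<^sup>2 + a\<^sup>2))) = exp (- (y * a\<^sup>2)) * exp (- (x\<^sup>2 * y))"
          by (simp add: exp_add[symmetric] algebra_simps)
        moreover have "exp (- (y * a\<^sup>2)) * ((2 * x) * ((x\<^sup>2) powr (\<tau> - 1) * exp (- (x\<^sup>2 * y))))
            = ((2 * x) * (x\<^sup>2) powr (\<tau> - 1)) * (exp (- (y * a\<^sup>2)) * exp (- (x\<^sup>2 * y)))"
          by (simp only: mult_ac)
        ultimately show "exp (- (y * a\<^sup>2)) * ((2 * x) * ((x\<^sup>2) powr (\<tau> - 1) * exp (- (x\<^sup>2 * y)))) = 2 * x powr v * exp (- (y * (x\<^sup>2 + a\<^sup>2)))"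
          by (simp only: mult_ac)
      qed
    qed
    show "((\<lambda>y. Gamma \<tau> * (y powr ((1 - \<tau>) - 1) * exp (- (y * a\<^sup>2)))) has_integral Gamma \<tau> * (Gamma (1 - \<tau>) * (a\<^sup>2) powr (- (1 - \<tau>)))) {0<..}"
      using \<tau> a by (intro has_integral_mult_right has_integral_Gamma_scaled) auto
    fix x :: real assume x: "x \<in> {0<..}"
    have p: "x\<^sup>2 + a\<^sup>2 > 0" using a by (intro add_nonneg_pos) auto
    have "((\<lambda>y. y powr (1 - 1) * exp (- (y * (x\<^sup>2 + a\<^sup>2)))) has_integral Gamma 1 * (x\<^sup>2 + a\<^sup>2) powr (- 1)) {0<..}"
      using p by (intro has_integral_Gamma_scaled) auto
    then have "((\<lambda>y. exp (- (y * (x\<^sup>2 + a\<^sup>2)))) has_integral 1 / (x\<^sup>2 + a\<^sup>2)) {0<..}"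
      by (rule has_integral_eq[rotated, THEN has_integral_eq_rhs]) (use p in \<open>auto simp: powr_minus_divide\<close>)
    then show "((\<lambda>y. 2 * x powr v * exp (- (y * (x\<^sup>2 + a\<^sup>2)))) has_integral 2 * x powr v * (1 / (x\<^sup>2 + a\<^sup>2))) {0<..}"
      by (rule has_integral_mult_right)
  qed auto
  also have "Gamma \<tau> * (Gamma (1 - \<tau>) * (a\<^sup>2) powr (- (1 - \<tau>))) = pi / cos (pi * v / 2) * a powr (v - 1)"
  proof -
    have "Gamma \<tau> * Gamma (1 - \<tau>) = pi / sin (pi * \<tau>)"
      by (rule Gamma_reflection_real)
    moreover have "pi * \<tau> = pi * v / 2 + pi / 2" by (simp add: \<tau>_def field_simps)
    then have "sin (pi * \<tau>) = cos (pi * v / 2)" by (simp add: sin_add)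
    moreover have "(a\<^sup>2) powr (- (1 - \<tau>)) = a powr (v - 1)"
      using a square_powr[of a] by simp
    ultimately show ?thesis by (simp flip: mult.assoc)
  qed
  finally show ?thesis
    by (rule has_integral_eq[rotated]) (simp add: powr_diff)
qed

text \<open>The Mellin transform of the kernel is evaluated a second time, from the partial
  fractions: the pair of poles with modulus 2 pi n contributes a multiple of n^(v - 1), and these
  add up to zeta(1 - v). The quotient \<open>zeta_num (1 - s) / (- s)\<close> is zeta(1 - s), as -s
  = (1 - s) - 1.\<close>

lemma zeta_functional_equation_real:
  assumes v: "-1 < v" "v < 0"
  shows "Gamma v * Re (zeta_num (of_real v) / (of_real v - 1))
     = pi / cos (pi * v / 2) * (2 * pi) powr (v - 1) * Re (zeta_num (1 - of_real v) / (- of_real v))"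
    and "zeta_num (1 - of_real v) / (- of_real v) \<in> \<real>"
proof -
  let ?Z = "zeta_num (1 - of_real v) / (- of_real v)"
    and ?C = "pi / cos (pi * v / 2) * (2 * pi) powr (v - 1)"
  have "(\<lambda>n. 1 / of_nat (Suc n) powr (1 - complex_of_real v)) sums (zeta_num (1 - of_real v) / (1 - of_real v - 1))"
    using v by (intro zeta_num_sums) auto
  also have "(\<lambda>n. 1 / of_nat (Suc n) powr (1 - complex_of_real v)) = (\<lambda>n. complex_of_real (real (Suc n) powr (v - 1)))"
  proof
    fix n
    have "complex_of_real (real (Suc n) powr (v - 1)) = of_nat (Suc n) powr (complex_of_real (v - 1))"
      by (simp add: powr_of_real[symmetric] del: of_nat_Suc)
    also have "\<dots> = of_nat (Suc n) powr (- (1 - complex_of_real v))" by simp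
    also have "\<dots> = 1 / of_nat (Suc n) powr (1 - complex_of_real v)" by (rule powr_minus_divide)
    finally show "1 / of_nat (Suc n) powr (1 - complex_of_real v) = complex_of_real (real (Suc n) powr (v - 1))" ..
  qed
  finally have sum: "(\<lambda>n. complex_of_real (real (Suc n) powr (v - 1))) sums (?Z)"
    by simp
  from sums_Im[OF sum] have "(\<lambda>n. 0) sums Im (?Z)" by simp
  from sums_unique2[OF this sums_zero] show "?Z \<in> \<real>"
    unfolding complex_is_Real_iff .
  from sums_Re[OF sum] have S: "(\<lambda>n. real (Suc n) powr (v - 1)) sums Re (?Z)"
    by simp
  have "((\<lambda>x. x powr (v - 1) * bose_kernel x) has_integral
      ?C * Re (?Z)) {0<..}"
  proof (rule has_integral_sums_nonneg)
    show "((\<lambda>x. x powr (v - 1) * (2 * x / (x\<^sup>2 + (2 * pi * real (Suc n))\<^sup>2))) has_integral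
        ?C * real (Suc n) powr (v - 1)) {0<..}" for n
    proof -
      have "(2 * pi * real (Suc n)) powr (v - 1) = (2 * pi) powr (v - 1) * real (Suc n) powr (v - 1)"
        by (rule powr_mult)
      then show ?thesis
        using has_integral_Mellin_resolvent[OF v, of "2 * pi * real (Suc n)"] by (simp only: mult.assoc) (use pi_gt_zero in force)
    qed
    show "(\<lambda>n. ?C * real (Suc n) powr (v - 1)) sums
       (?C * Re (?Z))"
      by (intro sums_mult S)
    show "(\<lambda>n. x powr (v - 1) * (2 * x / (x\<^sup>2 + (2 * pi * real (Suc n))\<^sup>2))) sums (x powr (v - 1) * bose_kernel x)"
      if "x \<in> {0<..}" for x
      using that by (intro sums_mult bose_kernel_sums) auto
  qed (auto intro!: mult_nonneg_nonneg divide_nonneg_nonneg add_nonneg_nonneg)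
  with has_integral_bose_kernel_zeta[OF v] show "Gamma v * Re (zeta_num (of_real v) / (of_real v - 1))
     = ?C * Re (?Z)"
    by (rule has_integral_unique)
qed

section \<open>Continuation to the whole plane and identification of \<open>zeta\<close>\<close>

definition zeta_reflected :: "complex \<Rightarrow> complex" where
  "zeta_reflected s = 2 * (2 * of_real pi) powr (s - 1) * sin (of_real pi * s / 2) * Gamma (1 - s) * (zeta_num (1 - s) / (- s))"

lemma zeta_functional_equation_strip:
  assumes s: "-1 < Re s" "Re s < 0"
  shows "zeta_num s / (s - 1) = zeta_reflected s"
proof -
  define S where "S = {s. -1 < Re s} \<inter> {s. Re s < 0}"
  have holo: "(\<lambda>s. zeta_num s / (s - 1) - zeta_reflected s) holomorphic_on S"
    unfolding zeta_reflected_def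
  proof (intro holomorphic_intros)
    show "zeta_num holomorphic_on S"
      by (rule holomorphic_on_subset[OF holomorphic_zeta_num]) (auto simp: S_def)
    show "(\<lambda>s. zeta_num (1 - s)) holomorphic_on S"
    proof -
      have "zeta_num \<circ> (\<lambda>s. 1 - s) holomorphic_on S"
        by (rule holomorphic_on_compose_gen[OF _ holomorphic_zeta_num]) (auto simp: S_def intro!: holomorphic_intros)
      then show ?thesis by (simp add: o_def)
    qed
    show "1 - z \<notin> \<int>\<^sub>\<le>\<^sub>0" if "z \<in> S" for z
      using that by (auto simp: S_def elim!: nonpos_Ints_cases simp: complex_eq_iff)
  qed (auto simp: S_def)
  \<comment> \<open>The equation is known on the real interval (-1, 0), which accumulates at -1/2;
    the identity theorem extends it to the strip.\<close>
  have "zeta_num s / (s - 1) - zeta_reflected s = 0"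
  proof (rule analytic_continuation[OF holo, where U = "of_real ` {-1<..<0}" and \<xi> = "- 1/2"])
    show "open S" unfolding S_def by (intro open_Int open_halfspace_Re_gt open_halfspace_Re_lt)
    show "connected S" unfolding S_def
      by (intro convex_connected convex_Int convex_halfspace_Re_gt convex_halfspace_Re_lt)
    show "complex_of_real ` {-1<..<0} \<subseteq> S" by (auto simp: S_def)
    show "- 1/2 \<in> S" by (simp add: S_def)
    show "- 1/2 islimpt (complex_of_real ` {-1<..<0})"
      unfolding islimpt_approachable
    proof (intro allI impI)
      fix e :: real assume e: "e > 0"
      define x where "x = - 1/2 + min (e / 2) (1 / 4)"
      have x: "x \<in> {-1<..<0}" "x \<noteq> - 1/2" "\<bar>x - (- 1/2)\<bar> < e"
        using e by (auto simp: x_def min_def)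
      have "complex_of_real x - (- 1/2) = of_real (x - (- 1/2))" by simp
      then have "dist (complex_of_real x) (- 1/2) < e"
        unfolding dist_norm using x(3) by (simp only: norm_of_real)
      moreover have "complex_of_real x \<noteq> - 1/2"
        using x(2) by (auto simp: complex_eq_iff)
      ultimately show "\<exists>x'\<in>complex_of_real ` {-1<..<0}. x' \<noteq> - 1/2 \<and> dist x' (- 1/2) < e"
        using x(1) by blast
    qed
    show "s \<in> S" using s by (simp add: S_def)
    fix z assume "z \<in> complex_of_real ` {-1<..<0}"
    then obtain v where v: "-1 < v" "v < 0" and z: "z = of_real v" by auto
    define P Q where "P = Re (zeta_num z / (z - 1))" and "Q = Re (zeta_num (1 - z) / (- z))"
    have PQ: "zeta_num z / (z - 1) = of_real P" "zeta_num (1 - z) / (- z) = of_real Q"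
      using trapezoid_real_sums(2)[OF v] zeta_functional_equation_real(2)[OF v] unfolding P_def Q_def z
      by (metis of_real_Re)+
    have fe: "Gamma v * P = pi / cos (pi * v / 2) * (2 * pi) powr (v - 1) * Q"
      using zeta_functional_equation_real(1)[OF v] unfolding P_def Q_def z by simp
    have refl: "Gamma v * Gamma (1 - v) = pi / sin (pi * v)"
      by (rule Gamma_reflection_real)
    have pv: "- pi < pi * v" "pi * v < 0"
      using mult_strict_left_mono[of "-1" v pi] mult_pos_neg[of pi v] v by simp_all
    have half: "cos (u / 2) > 0 \<and> sin (- (u / 2)) > 0" if "- pi < u" "u < 0" for u
      using that pi_gt_zero by (intro conjI cos_gt_zero_pi sin_gt_zero) linarith+
    have c: "cos (pi * v / 2) > 0" using half[OF pv] by blast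
    have s: "sin (pi * v / 2) \<noteq> 0"
      using half[OF pv] by simp
    have "sin (pi * v) = 2 * sin (pi * v / 2) * cos (pi * v / 2)"
      using sin_double[of "pi * v / 2"] by simp
    \<comment> \<open>The double-angle formula makes the cosine cancel against the one in the Mellin
      integral, which leaves the sine of the classical form.\<close>
    with refl have refl': "Gamma v * Gamma (1 - v) * (2 * sin (pi * v / 2) * cos (pi * v / 2)) = pi"
      using s c by simp
    have G: "Gamma v \<noteq> 0" using refl' by auto
    have "Gamma v * P * cos (pi * v / 2) = pi * ((2 * pi) powr (v - 1) * Q)"
      using fe c by simp
    also have "\<dots> = Gamma v * (2 * (2 * pi) powr (v - 1) * sin (pi * v / 2) * Gamma (1 - v) * Q) * cos (pi * v / 2)"
      by (subst refl'[symmetric]) (simp only: mult_ac)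
    finally have P: "P = 2 * (2 * pi) powr (v - 1) * sin (pi * v / 2) * Gamma (1 - v) * Q"
      using G c by simp
    have "zeta_reflected z = of_real (2 * (2 * pi) powr (v - 1) * sin (pi * v / 2) * Gamma (1 - v) * Q)"
      unfolding zeta_reflected_def PQ(2) unfolding z
      by (simp add: powr_of_real[symmetric] sin_of_real[symmetric] Gamma_complex_of_real[symmetric])
    then show "zeta_num z / (z - 1) - zeta_reflected z = 0"
      unfolding PQ(1) P by simp
  qed
  then show ?thesis by simp
qed

text \<open>At pi s / 2 this growth exp(pi |t| / 2) is exactly compensated by the decay of Gamma(1 -
  s) in the functional equation.\<close>

lemma norm_sin_le_exp: "norm (sin z) \<le> exp \<bar>Im z\<bar>" for z :: complex
proof -
  have "norm (sin z) = norm (exp (\<i> * z) - exp (- (\<i> * z))) / 2"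
    unfolding sin_exp_eq by (simp add: norm_divide norm_mult)
  also have "\<dots> \<le> (norm (exp (\<i> * z)) + norm (exp (- (\<i> * z)))) / 2"
    by (intro divide_right_mono norm_triangle_ineq4) auto
  also have "\<dots> = (exp (- Im z) + exp (Im z)) / 2" by simp
  also have "\<dots> \<le> (exp \<bar>Im z\<bar> + exp \<bar>Im z\<bar>) / 2"
    by (intro divide_right_mono add_mono) auto
  finally show ?thesis by simp
qed

lemma holomorphic_zeta_reflected: "zeta_reflected holomorphic_on {s. Re s < 0}"
  unfolding zeta_reflected_def
proof (intro holomorphic_intros)
  have "zeta_num \<circ> (\<lambda>s. 1 - s) holomorphic_on {s. Re s < 0}"
    by (rule holomorphic_on_compose_gen[OF _ holomorphic_zeta_num]) (auto intro!: holomorphic_intros)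
  then show "(\<lambda>s. zeta_num (1 - s)) holomorphic_on {s. Re s < 0}" by (simp add: o_def)
  show "1 - z \<notin> \<int>\<^sub>\<le>\<^sub>0" if "z \<in> {s. Re s < 0}" for z
    using that by (auto elim!: nonpos_Ints_cases simp: complex_eq_iff)
qed auto

text \<open>The two formulas agree on -1 < Re s < 0, so the function is holomorphic on two
  overlapping open sets that cover the plane without 1. The value at 1 is the one prescribed for
  \<open>zeta\<close>.\<close>

definition zeta_glued :: "complex \<Rightarrow> complex" where
  "zeta_glued s = (if s = 1 then 0 else if Re s > -1 then zeta_num s / (s - 1) else zeta_reflected s)"

lemma zeta_glued_reflected: "Re s < 0 \<Longrightarrow> zeta_glued s = zeta_reflected s"
  using zeta_functional_equation_strip[of s] by (auto simp: zeta_glued_def)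

lemma holomorphic_zeta_glued: "zeta_glued holomorphic_on - {1}"
proof -
  have open1: "open ({s. Re s > -1} - {1})" by (intro open_Diff open_halfspace_Re_gt) auto
  have "(\<lambda>s. zeta_num s / (s - 1)) holomorphic_on {s. Re s > -1} - {1}"
    by (intro holomorphic_intros holomorphic_on_subset[OF holomorphic_zeta_num]) auto
  then have 1: "zeta_glued holomorphic_on {s. Re s > -1} - {1}"
    by (rule holomorphic_transform) (auto simp: zeta_glued_def)
  have 2: "zeta_glued holomorphic_on {s. Re s < 0}"
    by (rule holomorphic_transform[OF holomorphic_zeta_reflected]) (simp add: zeta_glued_reflected)
  have "zeta_glued holomorphic_on ({s. Re s > -1} - {1}) \<union> {s. Re s < 0}"
    by (intro holomorphic_on_Un 1 2 open1 open_halfspace_Re_lt)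
  then show ?thesis by (rule holomorphic_on_subset) auto
qed

text \<open>The glued function is a witness of the description. Any other one agrees with it on Re s
  > 1, hence on the punctured plane, which is connected.\<close>

theorem zeta_eq_glued: "zeta = zeta_glued"
  unfolding zeta_def
proof (rule the_equality)
  have sums: "(\<lambda>n. 1 / of_nat (Suc n) powr s) sums zeta_glued s" if "1 < Re s" for s
    using zeta_num_sums[OF that] that by (auto simp: zeta_glued_def)
  then show "zeta_glued holomorphic_on - {1} \<and> zeta_glued 1 = 0 \<and>
      (\<forall>s. 1 < Re s \<longrightarrow> (\<lambda>n. 1 / of_nat (Suc n) powr s) sums zeta_glued s)"
    using holomorphic_zeta_glued by (simp add: zeta_glued_def)
  fix f assume f: "f holomorphic_on - {1} \<and> f 1 = 0 \<and>
      (\<forall>s. 1 < Re s \<longrightarrow> (\<lambda>n. 1 / of_nat (Suc n) powr s) sums f s)"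
  have "f s = zeta_glued s" if "s \<noteq> 1" for s
  proof (rule analytic_continuation_open[of "{s. Re s > 1}" "- {1}" f zeta_glued])
    show "open {s. 1 < Re s}" by (rule open_halfspace_Re_gt)
    show "{s. 1 < Re s} \<noteq> {}" by (auto intro!: exI[of _ 2])
    show "connected (- {1 :: complex})" by (intro connected_punctured_universe) auto
    show "f z = zeta_glued z" if "z \<in> {s. 1 < Re s}" for z
      using f sums[of z] that by (auto intro: sums_unique2)
  qed (use f that holomorphic_zeta_glued in auto)
  then show "f = zeta_glued" using f by (auto simp: fun_eq_iff zeta_glued_def)
qed

lemma holomorphic_zeta: "zeta holomorphic_on - {1}"
  by (simp add: zeta_eq_glued holomorphic_zeta_glued)

lemma zeta_sums: "1 < Re s \<Longrightarrow> (\<lambda>n. 1 / of_nat (Suc n) powr s) sums zeta s"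
  using zeta_num_sums[of s] by (auto simp: zeta_eq_glued zeta_glued_def)

lemma zeta_eq_num: "Re s > -1 \<Longrightarrow> s \<noteq> 1 \<Longrightarrow> zeta s = zeta_num s / (s - 1)"
  by (simp add: zeta_eq_glued zeta_glued_def)

theorem zeta_functional_equation:
  assumes "Re s < 0"
  shows "zeta s = 2 * (2 * of_real pi) powr (s - 1) * sin (of_real pi * s / 2) * Gamma (1 - s) * zeta (1 - s)"
proof -
  have "zeta (1 - s) = zeta_num (1 - s) / (- s)"
    using assms by (subst zeta_eq_num) auto
  then show ?thesis
    using zeta_glued_reflected[OF assms] by (simp add: zeta_eq_glued zeta_reflected_def)
qed

lemma zeta_0: "zeta 0 = - 1 / 2"
  by (subst zeta_eq_num) (simp_all add: zeta_num_0)

lemma zeta_trivial_zero: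
  assumes "m \<ge> 1"
  shows "zeta (- of_nat (2 * m)) = 0"
proof -
  have "sin (of_real pi * (- of_nat (2 * m)) / 2) = - sin (of_real (pi * real m) :: complex)"
    by simp
  also have "\<dots> = 0" unfolding sin_of_real by (simp add: sin_npi mult.commute)
  finally show ?thesis using assms by (subst zeta_functional_equation) auto
qed

lemma zeta_pole: "((\<lambda>s. zeta s * (s - 1)) \<longlongrightarrow> 1) (at 1)"
proof -
  have "continuous_on {s. Re s > -1} zeta_num"
    by (rule holomorphic_on_imp_continuous_on[OF holomorphic_zeta_num])
  then have "isCont zeta_num 1"
    using open_halfspace_Re_gt[of "-1"] by (auto simp: continuous_on_eq_continuous_at)
  then have lim: "(zeta_num \<longlongrightarrow> 1) (at 1)" by (simp add: isCont_def zeta_num_1)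
  have "eventually (\<lambda>s. s \<in> {s. Re s > -1}) (at 1)"
    by (intro eventually_at_in_open' open_halfspace_Re_gt) auto
  then have "eventually (\<lambda>s. zeta_num s = zeta s * (s - 1)) (at 1)"
    using eventually_neq_at_within[of 1] by eventually_elim (auto simp: zeta_eq_num)
  then show ?thesis by (rule Lim_transform_eventually[OF lim])
qed

text \<open>To the right of -1/2 the trapezoidal series gives the bound. To the left the functional
  equation transfers it, the exponentials of the sine and of Gamma cancelling; the width A + 1
  allows for the reflected point 1 - s.\<close>

theorem zeta_strip_bound:
  "\<exists>C>0. \<exists>N. \<forall>s. \<bar>Re s\<bar> \<le> A \<longrightarrow> 1 \<le> \<bar>Im s\<bar> \<longrightarrow> norm (zeta s) \<le> C * \<bar>Im s\<bar> ^ N"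
proof -
  obtain C where C: "C > 0" and right: "\<And>s. - (1/2) \<le> Re s \<Longrightarrow> \<bar>Re s\<bar> \<le> A + 1 \<Longrightarrow> 1 \<le> \<bar>Im s\<bar> \<Longrightarrow>
      norm (zeta_num s / (s - 1)) \<le> C * \<bar>Im s\<bar> ^ 3"
    using zeta_num_poly_bound[of "A + 1"] by metis
  have right': "norm (zeta s) \<le> C * \<bar>Im s\<bar> ^ 3" if "- (1/2) \<le> Re s" "\<bar>Re s\<bar> \<le> A + 1" "1 \<le> \<bar>Im s\<bar>" for s
    using right[OF that] that by (subst zeta_eq_num) auto
  obtain C' N where C': "C' > 0" and CN: "\<And>s. \<bar>Re s\<bar> \<le> A + 1 \<Longrightarrow> 1 \<le> \<bar>Im s\<bar> \<Longrightarrow>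
      norm (Gamma s) \<le> C' * \<bar>Im s\<bar> ^ N * exp (- (pi / 2) * \<bar>Im s\<bar>)"
    using norm_Gamma_strip_le[of "A + 1"] by metis
  define K where "K = max C (2 * C' * C)"
  have K: "K > 0" using C by (simp add: K_def)
  have "norm (zeta s) \<le> K * \<bar>Im s\<bar> ^ (N + 3)" if s: "\<bar>Re s\<bar> \<le> A" "1 \<le> \<bar>Im s\<bar>" for s
  proof (cases "- (1/2) \<le> Re s")
    case True
    then have "norm (zeta s) \<le> C * \<bar>Im s\<bar> ^ 3" using s by (intro right') auto
    also have "\<dots> \<le> K * \<bar>Im s\<bar> ^ (N + 3)"
      using C s K by (intro mult_mono power_increasing) (auto simp: K_def)
    finally show ?thesis .
  next
    case False
    have p: "norm ((2 * of_real pi) powr (s - 1) :: complex) \<le> 1"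
    proof -
      have "norm ((2 * of_real pi) powr (s - 1) :: complex) = (2 * pi) powr (Re s - 1)"
        using norm_powr_real_powr[of "of_real (2 * pi)" "s - 1"] by simp
      also have "\<dots> \<le> (2 * pi) powr 0"
        using False pi_gt3 by (intro powr_mono) auto
      finally show ?thesis by simp
    qed
    have sn: "norm (sin (of_real pi * s / 2)) \<le> exp ((pi / 2) * \<bar>Im s\<bar>)"
      using norm_sin_le_exp[of "of_real pi * s / 2"] by (simp add: abs_mult)
    have G: "norm (Gamma (1 - s)) \<le> C' * \<bar>Im s\<bar> ^ N * exp (- (pi / 2) * \<bar>Im s\<bar>)"
      using CN[of "1 - s"] s by simp
    have z: "norm (zeta (1 - s)) \<le> C * \<bar>Im s\<bar> ^ 3"
      using right'[of "1 - s"] s False by simp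
    have "norm (zeta s) = 2 * norm ((2 * of_real pi) powr (s - 1) :: complex) * norm (sin (of_real pi * s / 2)) * norm (Gamma (1 - s)) * norm (zeta (1 - s))"
      using False by (subst zeta_functional_equation) (auto simp: norm_mult)
    also have "\<dots> \<le> 2 * 1 * exp ((pi / 2) * \<bar>Im s\<bar>) * (C' * \<bar>Im s\<bar> ^ N * exp (- (pi / 2) * \<bar>Im s\<bar>)) * (C * \<bar>Im s\<bar> ^ 3)"
      using C' C by (intro mult_mono p sn G z mult_nonneg_nonneg) auto
    also have "\<dots> = (2 * C' * C) * \<bar>Im s\<bar> ^ (N + 3) * (exp ((pi / 2) * \<bar>Im s\<bar>) * exp (- (pi / 2) * \<bar>Im s\<bar>))"
      by (simp only: power_add mult_ac mult_1_right mult_1_left)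
    also have "exp ((pi / 2) * \<bar>Im s\<bar>) * exp (- (pi / 2) * \<bar>Im s\<bar>) = 1"
      by (simp add: exp_minus)
    also have "(2 * C' * C) * \<bar>Im s\<bar> ^ (N + 3) * 1 \<le> K * \<bar>Im s\<bar> ^ (N + 3)"
      unfolding mult_1_right by (intro mult_right_mono) (auto simp: K_def)
    finally show ?thesis .
  qed
  then show ?thesis using K by blast
qed

section \<open>Dirichlet series of power divisor sums\<close>

text \<open>The pairs $(n, d)$ with $d^k \mid n$ correspond to the pairs $(d, m)$ through $n = d^k m$;
  all indices are shifted by one.\<close>

lemma power_divisor_convolution_has_sum:
  fixes a b :: "nat \<Rightarrow> 'a :: {real_normed_field, banach, second_countable_topology}"
  assumes k: "k > 0"
    and a: "summable (\<lambda>d. norm (a (Suc d)))" and b: "summable (\<lambda>m. norm (b (Suc m)))"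
  shows "((\<lambda>n. \<Sum>d | Suc d ^ k dvd Suc n. a (Suc d) * b (Suc n div Suc d ^ k)) has_sum
           ((\<Sum>d. a (Suc d)) * (\<Sum>m. b (Suc m)))) UNIV"
proof -
  let ?S = "(\<Sum>d. a (Suc d)) * (\<Sum>m. b (Suc m))" and ?N = "\<Sum>m. norm (b (Suc m))"
  have A: "((\<lambda>d. a (Suc d)) has_sum (\<Sum>d. a (Suc d))) UNIV"
    using norm_summable_imp_has_sum[OF a summable_sums[OF summable_norm_cancel[OF a]]] .
  have B: "((\<lambda>m. b (Suc m)) has_sum (\<Sum>m. b (Suc m))) UNIV"
    using norm_summable_imp_has_sum[OF b summable_sums[OF summable_norm_cancel[OF b]]] .
  define f where "f = (\<lambda>(d, m). a (Suc d) * b (Suc m))"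
  \<comment> \<open>Absolute summability over all pairs (d, m) is what permits collecting them by n
    = d^k m.\<close>
  have "(\<lambda>(d, m). norm (a (Suc d)) * norm (b (Suc m))) summable_on UNIV \<times> UNIV"
  proof (rule summable_on_SigmaI)
    fix d :: nat
    have "((\<lambda>m. norm (b (Suc m))) has_sum ?N) UNIV"
      using b by (intro norm_summable_imp_has_sum summable_sums) auto
    then show "((\<lambda>m. case (d, m) of (d, m) \<Rightarrow> norm (a (Suc d)) * norm (b (Suc m))) has_sum norm (a (Suc d)) * ?N) UNIV"
      unfolding prod.case by (rule has_sum_cmult_right)
  next
    show "(\<lambda>d. norm (a (Suc d)) * ?N) summable_on UNIV"
      using a by (intro summable_on_cmult_left norm_summable_imp_summable_on) auto
  qed auto
  then have "(\<lambda>p. norm (f p)) summable_on UNIV \<times> UNIV"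
    by (simp add: f_def case_prod_beta' norm_mult)
  then have summable: "f summable_on UNIV \<times> UNIV"
    by (rule abs_summable_summable)
  have "(f has_sum ?S) (UNIV \<times> UNIV)"
  proof (rule has_sum_SigmaI[OF _ _ summable])
    show "((\<lambda>m. f (d, m)) has_sum a (Suc d) * (\<Sum>m. b (Suc m))) UNIV" for d
      unfolding f_def prod.case by (intro has_sum_cmult_right B)
    show "((\<lambda>d. a (Suc d) * (\<Sum>m. b (Suc m))) has_sum (\<Sum>d. a (Suc d)) * (\<Sum>m. b (Suc m))) UNIV"
      by (intro has_sum_cmult_left A)
  qed
  also have "(f has_sum ?S) (UNIV \<times> UNIV) \<longleftrightarrow>
      ((\<lambda>(n, d). a (Suc d) * b (Suc n div Suc d ^ k)) has_sum ?S)
        (SIGMA n:UNIV. {d. Suc d ^ k dvd Suc n})"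
  proof (rule has_sum_reindex_bij_witness[where i = "\<lambda>(n, d). (d, Suc n div Suc d ^ k - 1)"
        and j = "\<lambda>(d, m). (Suc d ^ k * Suc m - 1, d)"])
    fix p :: "nat \<times> nat"
    obtain d m where p: "p = (d, m)" by force
    have pos: "Suc d ^ k * Suc m > 0" by simp
    then have e: "Suc (Suc d ^ k * Suc m - 1) = Suc d ^ k * Suc m" by simp
    show "(case case p of (d, m) \<Rightarrow> (Suc d ^ k * Suc m - 1, d) of (n, d) \<Rightarrow> (d, Suc n div Suc d ^ k - 1)) = p"
      unfolding p prod.case e by simp
    show "(case p of (d, m) \<Rightarrow> (Suc d ^ k * Suc m - 1, d)) \<in> (SIGMA n:UNIV. {d. Suc d ^ k dvd Suc n})"
      unfolding p prod.case mem_Sigma_iff mem_Collect_eq e by simp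
    show "(case case p of (d, m) \<Rightarrow> (Suc d ^ k * Suc m - 1, d) of (n, d) \<Rightarrow> a (Suc d) * b (Suc n div Suc d ^ k)) = f p"
      unfolding p prod.case e f_def by simp
  next
    fix q :: "nat \<times> nat" assume "q \<in> (SIGMA n:UNIV. {d. Suc d ^ k dvd Suc n})"
    then obtain n d where q: "q = (n, d)" "Suc d ^ k dvd Suc n" by auto
    then obtain m where m: "Suc n = Suc d ^ k * m" by (auto elim: dvdE)
    then have "m > 0" by (cases m) auto
    have "Suc n div Suc d ^ k = m" unfolding m by simp
    then show "(case case q of (n, d) \<Rightarrow> (d, Suc n div Suc d ^ k - 1) of (d, m) \<Rightarrow> (Suc d ^ k * Suc m - 1, d)) = q"
      unfolding q prod.case using \<open>m > 0\<close> m by simp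
    show "(case q of (n, d) \<Rightarrow> (d, Suc n div Suc d ^ k - 1)) \<in> UNIV \<times> UNIV" by simp
  qed simp
  finally show ?thesis
  proof (rule has_sum_SigmaD)
    fix n :: nat
    have "{d. Suc d ^ k dvd Suc n} \<subseteq> {..n}"
    proof
      fix d assume "d \<in> {d. Suc d ^ k dvd Suc n}"
      then have "Suc d ^ k \<le> Suc n" by (auto dest: dvd_imp_le)
      moreover have "Suc d \<le> Suc d ^ k" using k by (intro self_le_power) auto
      ultimately show "d \<in> {..n}" by simp
    qed
    then have "finite {d. Suc d ^ k dvd Suc n}" by (rule finite_subset) auto
    from has_sum_finite[OF this, of "\<lambda>d. a (Suc d) * b (Suc n div Suc d ^ k)"]
    show "((\<lambda>d. case (n, d) of (n, d) \<Rightarrow> a (Suc d) * b (Suc n div Suc d ^ k)) has_sum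
        (\<Sum>d | Suc d ^ k dvd Suc n. a (Suc d) * b (Suc n div Suc d ^ k))) {d. Suc d ^ k dvd Suc n}"
      by simp
  qed
qed

lemma summable_norm_zeta_series: "1 < Re s \<Longrightarrow> summable (\<lambda>n. norm (1 / of_nat (Suc n) powr s))"
proof -
  assume "1 < Re s"
  then have "summable (\<lambda>n. real (Suc n) powr (- Re s))"
    by (subst summable_Suc_iff) (simp add: summable_real_powr_iff)
  moreover have "norm (1 / of_nat (Suc n) powr s) = real (Suc n) powr (- Re s)" for n
    using norm_powr_real_powr[of "of_nat (Suc n)" s]
    by (simp add: norm_divide powr_minus_divide del: of_nat_Suc)
  ultimately show ?thesis by simp
qed

lemma of_nat_powr_eq_exp: "n > 0 \<Longrightarrow> of_nat n powr z = exp (z * of_real (ln (real n)))" for z :: complex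
  by (simp add: powr_def Ln_of_nat)

text \<open>A common generalisation of both divisor sums, so that one Dirichlet series serves the
  two sides of the formula.\<close>

definition power_divisor_sum :: "nat \<Rightarrow> int \<Rightarrow> nat \<Rightarrow> nat \<Rightarrow> real" where
  "power_divisor_sum k p q n = (\<Sum>d | 1 \<le> d \<and> d ^ k dvd n. (real n / real (d ^ k)) powi p * real d ^ q)"

lemma D_sum_eq: "D_sum k r = power_divisor_sum k r 0"
  and S_sum_eq: "S_sum k r = power_divisor_sum k (- r) (k - 1)"
  by (auto simp: D_sum_def S_sum_def power_divisor_sum_def)

text \<open>For n = d^k m the term m^p d^q n^(-s) factors as d^(-(k s - q)) m^(-(s - p)). Absolute
  convergence is stated separately because it dominates the termwise integrations.\<close>

theorem power_divisor_Dirichlet_series: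
  assumes k: "k > 0" and s1: "1 < Re (of_nat k * s - of_nat q)" and s2: "1 < Re (s - of_int p)"
  shows "(\<lambda>n. of_real (power_divisor_sum k p q (Suc n)) * of_nat (Suc n) powr (- s)) sums
           (zeta (of_nat k * s - of_nat q) * zeta (s - of_int p))"
    and "summable (\<lambda>n. norm (of_real (power_divisor_sum k p q (Suc n)) * of_nat (Suc n) powr (- s) :: complex))"
proof -
  define a b :: "nat \<Rightarrow> complex" where "a d = 1 / of_nat d powr (of_nat k * s - of_nat q)" and "b m = 1 / of_nat m powr (s - of_int p)" for d m
  let ?P = "\<lambda>n. complex_of_real (power_divisor_sum k p q (Suc n)) * of_nat (Suc n) powr (- s)"
  have coeff: "?P n
      = (\<Sum>d | Suc d ^ k dvd Suc n. a (Suc d) * b (Suc n div Suc d ^ k))" for n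
  proof -
    let ?t = "\<lambda>d. (real (Suc n) / real (Suc d ^ k)) powi p * real (Suc d) ^ q"
    have "power_divisor_sum k p q (Suc n) = (\<Sum>d | Suc d ^ k dvd Suc n. ?t d)"
      unfolding power_divisor_sum_def
      by (rule sum.reindex_bij_witness[of _ Suc "\<lambda>d. d - 1"]) auto
    then have "?P n
       = (\<Sum>d | Suc d ^ k dvd Suc n. complex_of_real (?t d) * of_nat (Suc n) powr (- s))"
      by (simp only: of_real_sum sum_distrib_right)
    also have "\<dots> = (\<Sum>d | Suc d ^ k dvd Suc n. a (Suc d) * b (Suc n div Suc d ^ k))"
    proof (intro sum.cong refl)
      fix d assume "d \<in> {d. Suc d ^ k dvd Suc n}"
      then obtain m where m: "Suc n = Suc d ^ k * m" by (auto elim: dvdE)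
      then have m0: "m > 0" by (cases m) auto
      \<comment> \<open>All powers become exponentials in these two logarithms, so the factorisation
        reduces to a linear identity between exponents.\<close>
      define x y where "x = complex_of_real (ln (real m))" and "y = complex_of_real (ln (real (Suc d)))"
      have div: "Suc n div Suc d ^ k = m" unfolding m by simp
      have quot: "real (Suc n) / real (Suc d ^ k) = real m" unfolding m by simp
      have "complex_of_real (real m powi p) = of_nat m powi p" by simp
      also have "\<dots> = of_nat m powr of_int p" using m0 by (subst complex_powr_of_int) auto
      finally have e1: "complex_of_real (real m powi p) = exp (of_int p * x)"
        using m0 by (simp add: of_nat_powr_eq_exp x_def)
      have "exp y = of_nat (Suc d)" by (simp add: y_def exp_of_real del: of_nat_Suc)
      then have e2: "complex_of_real (real (Suc d) ^ q) = exp (of_nat q * y)"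
        by (simp add: exp_of_nat_mult del: of_nat_Suc)
      have "ln (real (Suc n)) = real k * ln (real (Suc d)) + ln (real m)"
        unfolding m using m0 by (simp add: ln_mult ln_realpow del: of_nat_Suc)
      then have e3: "of_nat (Suc n) powr (- s) = exp (- s * (of_nat k * y + x))"
        by (simp add: of_nat_powr_eq_exp x_def y_def del: of_nat_Suc)
      have ea: "a (Suc d) = exp (- (of_nat k * s - of_nat q) * y)"
        by (simp add: a_def of_nat_powr_eq_exp y_def exp_minus[symmetric] inverse_eq_divide[symmetric] algebra_simps del: of_nat_Suc)
      have eb: "b m = exp (- (s - of_int p) * x)"
        using m0 by (simp add: b_def of_nat_powr_eq_exp x_def exp_minus[symmetric] inverse_eq_divide[symmetric] algebra_simps)
      show "complex_of_real (?t d) * of_nat (Suc n) powr (- s)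
          = a (Suc d) * b (Suc n div Suc d ^ k)"
        unfolding quot div of_real_mult e1 e2 e3 ea eb exp_add[symmetric]
        by (rule arg_cong[of _ _ exp]) (simp add: algebra_simps)
    qed
    finally show ?thesis .
  qed
  have sa: "summable (\<lambda>d. norm (a (Suc d)))" and sb: "summable (\<lambda>m. norm (b (Suc m)))"
    unfolding a_def b_def by (intro summable_norm_zeta_series s1 s2)+
  have za: "(\<Sum>d. a (Suc d)) = zeta (of_nat k * s - of_nat q)" and zb: "(\<Sum>m. b (Suc m)) = zeta (s - of_int p)"
    unfolding a_def b_def using zeta_sums[OF s1] zeta_sums[OF s2] by (simp_all only: sums_iff)
  show "(\<lambda>n. ?P n) sums
           (zeta (of_nat k * s - of_nat q) * zeta (s - of_int p))"
    using has_sum_imp_sums[OF power_divisor_convolution_has_sum[OF k sa sb]] unfolding coeff za zb .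
  have "summable (\<lambda>n. \<Sum>d | Suc d ^ k dvd Suc n. norm (a (Suc d)) * norm (b (Suc n div Suc d ^ k)))"
    using sums_summable[OF has_sum_imp_sums[OF power_divisor_convolution_has_sum[OF k, of "\<lambda>d. norm (a d)" "\<lambda>m. norm (b m)"]]] sa sb
    by simp
  then show "summable (\<lambda>n. norm (?P n))"
  proof (rule summable_comparison_test')
    show "norm (norm (?P n))
       \<le> (\<Sum>d | Suc d ^ k dvd Suc n. norm (a (Suc d)) * norm (b (Suc n div Suc d ^ k)))" for n
      unfolding coeff real_norm_def abs_norm_cancel by (intro order_trans[OF norm_sum]) (simp add: norm_mult)
  qed
qed

section \<open>The multiplication formula of Gauss\<close>

text \<open>z^n - 1 is monic without double roots, hence the product of the linear factors of its
  roots.\<close>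

lemma prod_minus_roots_of_unity:
  assumes "n > 0"
  shows "(\<Prod>l<n. x - cis (2 * pi * real l / real n)) = x ^ n - 1"
proof -
  define p :: "complex poly" where "p = monom 1 n - 1"
  have roots: "{z. poly p z = 0} = {z. z ^ n = 1}"
    by (simp add: p_def poly_monom)
  have "poly (pderiv p) z \<noteq> 0" if "poly p z = 0" for z
  proof -
    have "z \<noteq> 0" using that assms by (auto simp: p_def poly_monom power_0_left)
    then show ?thesis using assms by (simp add: p_def pderiv_diff pderiv_monom poly_monom)
  qed
  then have "rsquarefree p" by (auto simp: rsquarefree_roots)
  then have "p = smult (lead_coeff p) (\<Prod>z\<in>{z. poly p z = 0}. [:- z, 1:])"
    by (rule complex_poly_decompose_rsquarefree[symmetric])
  moreover have "lead_coeff p = 1"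
  proof -
    have "degree (1 :: complex poly) < degree (monom (1 :: complex) n)"
      using assms by (simp add: degree_monom_eq)
    then have "degree p = n"
      using degree_add_eq_left[of "- 1" "monom (1 :: complex) n"] by (simp add: p_def degree_monom_eq)
    then show ?thesis using assms by (simp add: p_def)
  qed
  ultimately have "p = (\<Prod>z\<in>{z. z ^ n = 1}. [:- z, 1:])" by (simp add: roots)
  also have "\<dots> = (\<Prod>l<n. [:- cis (2 * pi * real l / real n), 1:])"
    by (rule prod.reindex_bij_betw[OF Complex.bij_betw_roots_unity[OF assms], symmetric])
  finally have "poly p x = (\<Prod>l<n. x - cis (2 * pi * real l / real n))"
    by (simp add: poly_prod)
  then show ?thesis by (simp add: p_def poly_monom)
qed

text \<open>Cancelling the factor x - 1 leaves a geometric sum, whose value at 1 is reached as a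
  limit.\<close>

lemma prod_one_minus_roots_of_unity:
  assumes "n > 0"
  shows "(\<Prod>l\<in>{1..<n}. 1 - cis (2 * pi * real l / real n)) = of_nat n"
proof -
  let ?f = "\<lambda>x. \<Prod>l\<in>{1..<n}. x - cis (2 * pi * real l / real n)"
  have "?f x = (\<Sum>i<n. x ^ i)" if "x \<noteq> 1" for x
  proof -
    have "{..<n} = insert 0 {1..<n}" using assms by auto
    then have "(x - 1) * ?f x = x ^ n - 1"
      using prod_minus_roots_of_unity[OF assms, of x] by simp
    also have "\<dots> = (x - 1) * (\<Sum>i<n. x ^ i)" by (rule power_diff_1_eq)
    finally show ?thesis using that by simp
  qed
  then have ev: "eventually (\<lambda>x. ?f x = (\<Sum>i<n. x ^ i)) (at 1)"
    by (simp add: eventually_at_filter)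
  have "(?f \<longlongrightarrow> ?f 1) (at 1)" by (intro tendsto_intros)
  then have "((\<lambda>x. \<Sum>i<n. x ^ i) \<longlongrightarrow> ?f 1) (at 1)"
    using tendsto_cong[OF ev] by blast
  moreover have "((\<lambda>x::complex. \<Sum>i<n. x ^ i) \<longlongrightarrow> (\<Sum>i<n. 1 ^ i)) (at 1)" by (intro tendsto_intros)
  ultimately have "?f 1 = (\<Sum>i<n. 1 ^ i)" by (rule tendsto_unique[rotated]) auto
  then show ?thesis by simp
qed

text \<open>|1 - e^(2 i a)| = 2 sin a for 0 <= a <= pi turns the product over the roots of unity
  into sines.\<close>

lemma prod_sin_fractions:
  assumes "n > 0"
  shows "(\<Prod>l\<in>{1..<n}. sin (pi * real l / real n)) = real n / 2 ^ (n - 1)"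
proof -
  have "norm (1 - cis (2 * pi * real l / real n)) = 2 * sin (pi * real l / real n)" if l: "l \<in> {1..<n}" for l
  proof -
    define a where "a = pi * real l / real n"
    have a: "0 \<le> a" "a \<le> pi" using l by (auto simp: a_def field_simps)
    have "1 - cis (2 * a) = - 2 * \<i> * of_real (sin a) * cis a"
      using sin_cos_squared_add[of a]
      by (simp add: complex_eq_iff cis.code sin_double cos_double_sin power2_eq_square)
    then have "norm (1 - cis (2 * a)) = 2 * \<bar>sin a\<bar>" by (simp add: norm_mult)
    then show ?thesis using sin_ge_zero[OF a] by (simp add: a_def mult.assoc)
  qed
  then have "(\<Prod>l\<in>{1..<n}. 2 * sin (pi * real l / real n)) = (\<Prod>l\<in>{1..<n}. norm (1 - cis (2 * pi * real l / real n)))"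
    by (intro prod.cong) auto
  also have "\<dots> = real n"
    using prod_one_minus_roots_of_unity[OF assms] by (simp add: prod_norm)
  finally show ?thesis by (simp add: prod.distrib field_simps)
qed

text \<open>Pairing l with n - l and applying the reflection formula reduces the square of the
  product to the product of sines.\<close>

lemma prod_Gamma_fractions:
  assumes "n > 0"
  shows "(\<Prod>l\<in>{1..<n}. Gamma (real l / real n)) = sqrt ((2 * pi) ^ (n - 1) / real n)"
proof -
  let ?P = "\<Prod>l\<in>{1..<n}. Gamma (real l / real n)"
  have "?P = (\<Prod>l\<in>{1..<n}. Gamma (1 - real l / real n))"
  proof (rule prod.reindex_bij_witness[of _ "\<lambda>l. n - l" "\<lambda>l. n - l"])
    fix l assume l: "l \<in> {1..<n}"
    have "1 - real (n - l) / real n = real l / real n"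
      using l by (simp add: of_nat_diff field_simps)
    then show "Gamma (1 - real (n - l) / real n) = Gamma (real l / real n)" by simp
  qed auto
  then have "?P ^ 2 = (\<Prod>l\<in>{1..<n}. Gamma (real l / real n) * Gamma (1 - real l / real n))"
    by (simp add: power2_eq_square prod.distrib)
  also have "\<dots> = (\<Prod>l\<in>{1..<n}. pi / sin (pi * real l / real n))"
    by (intro prod.cong) (simp_all add: Gamma_reflection_real)
  also have "\<dots> = pi ^ (n - 1) / (real n / 2 ^ (n - 1))"
    by (simp only: prod_dividef prod_sin_fractions[OF assms]) simp
  also have "\<dots> = (2 * pi) ^ (n - 1) / real n"
    by (simp add: power_mult_distrib)
  finally have "?P ^ 2 = (2 * pi) ^ (n - 1) / real n" .
  moreover have "?P \<ge> 0" by (intro prod_nonneg) (auto intro!: less_imp_le Gamma_real_pos divide_pos_pos)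
  ultimately show ?thesis by (metis real_sqrt_unique)
qed

text \<open>The factors are grouped into m blocks of length n; each factor of a block is n times one
  of the shifted arguments.\<close>

lemma pochhammer_multiple:
  fixes z :: complex
  assumes "n > 0"
  shows "pochhammer (of_nat n * z) (n * m) = of_nat n ^ (n * m) * (\<Prod>l<n. pochhammer (z + of_nat l / of_nat n) m)"
proof (induction m)
  case (Suc m)
  have "pochhammer (of_nat n * z) (n * Suc m) = pochhammer (of_nat n * z) (n * m + n)"
    by (simp add: add.commute)
  also have "\<dots> = pochhammer (of_nat n * z) (n * m) * pochhammer (of_nat n * z + of_nat (n * m)) n"
    by (rule pochhammer_product')
  also have "pochhammer (of_nat n * z + of_nat (n * m)) n = (\<Prod>l<n. of_nat n * (z + of_nat l / of_nat n + of_nat m))"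
    unfolding pochhammer_prod atLeast0LessThan using assms
    by (intro prod.cong) (auto simp: algebra_simps)
  also have "\<dots> = of_nat n ^ n * (\<Prod>l<n. z + of_nat l / of_nat n + of_nat m)"
    by (simp add: prod.distrib)
  finally show ?case
    unfolding Suc.IH by (simp add: pochhammer_Suc prod.distrib power_add)
qed simp

text \<open>In Euler's limit for both sides the dependence on z cancels, so n^(n z) times the
  product over l, divided by Gamma(n z), is a constant. It is evaluated at z = 1 / n, where Gamma(n
  z) = 1 and the product is known from \<open>prod_Gamma_fractions\<close>.\<close>

theorem Gamma_multiplication:
  fixes z :: complex
  assumes n: "n > 0" and z: "of_nat n * z \<notin> \<int>\<^sub>\<le>\<^sub>0"
  shows "Gamma (of_nat n * z) = of_real ((2 * pi) powr ((1 - real n) / 2)) * of_nat n powr (of_nat n * z - 1 / 2)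
           * (\<Prod>l<n. Gamma (z + of_nat l / of_nat n))"
proof -
  let ?G = "\<lambda>z. \<Prod>l<n. Gamma (z + of_nat l / of_nat n)"
  let ?c = "(2 * pi) powr ((1 - real n) / 2)" and ?d = "of_real ((real n - 1) / 2)"
  define pw where "pw b a = exp (a * of_real (ln (real b)))" for b :: nat and a :: complex
  \<comment> \<open>The m-th approximant of that quotient, from which z has dropped out.\<close>
  define h where "h m = fact (m - 1) ^ n * pw m (?d) * of_nat n ^ (n * m) / fact (n * m - 1)" for m
  have lim: "h \<longlonglongrightarrow> pw n (of_nat n * z) * ?G z / Gamma (of_nat n * z)"
    if z: "of_nat n * z \<notin> \<int>\<^sub>\<le>\<^sub>0" for z :: complex
  proof -
    define g where "g m = pw n (of_nat n * z) * (\<Prod>l<n. Gamma_series' (z + of_nat l / of_nat n) m) / Gamma_series' (of_nat n * z) (n * m)" for m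
    have "eventually (\<lambda>m. g m = h m) sequentially"
      using eventually_gt_at_top[of 0]
    proof eventually_elim
      fix m :: nat assume m: "m > 0"
      define Q where "Q = (\<Prod>l<n. pochhammer (z + of_nat l / of_nat n) m)"
      have pz: "pochhammer (of_nat n * z) (n * m) \<noteq> 0"
        using z by (auto dest: pochhammer_eq_0_imp_nonpos_Int)
      \<comment> \<open>Gamma(n z) is approximated along the subsequence n m of Euler's limit
        because its Pochhammer symbol then splits into those of the numerator.\<close>
      have poch: "pochhammer (of_nat n * z) (n * m) = of_nat n ^ (n * m) * Q"
        unfolding Q_def by (rule pochhammer_multiple[OF n])
      have Q: "Q \<noteq> 0" using pz unfolding poch by auto
      have "(\<Prod>l<n. pw m (z + of_nat l / of_nat n)) = pw m (\<Sum>l<n. z + of_nat l / of_nat n)"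
        unfolding pw_def sum_distrib_right by (rule exp_sum[symmetric]) simp
      also have "(\<Sum>l<n. z + of_nat l / of_nat n) = of_nat n * z + ?d"
      proof -
        have "2 * (\<Sum>l<n. complex_of_nat l) = of_nat n * (of_nat n - 1)"
          by (induction n) (simp_all add: algebra_simps)
        then show ?thesis using n by (simp add: sum.distrib sum_divide_distrib[symmetric] field_simps)
      qed
      also have "pw m (of_nat n * z + ?d) = pw m (of_nat n * z) * pw m (?d)"
        by (simp add: pw_def distrib_right exp_add)
      finally have P: "(\<Prod>l<n. pw m (z + of_nat l / of_nat n)) = pw m (of_nat n * z) * pw m (?d)" .
      have A: "(\<Prod>l<n. Gamma_series' (z + of_nat l / of_nat n) m) = fact (m - 1) ^ n * (pw m (of_nat n * z) * pw m (?d)) / Q"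
        unfolding P[symmetric] Q_def by (simp add: Gamma_series'_def pw_def prod.distrib prod_dividef)
      have "pw (n * m) (of_nat n * z) = pw n (of_nat n * z) * pw m (of_nat n * z)"
        using n m by (simp add: pw_def ln_mult distrib_left exp_add)
      then have B: "Gamma_series' (of_nat n * z) (n * m) = fact (n * m - 1) * (pw n (of_nat n * z) * pw m (of_nat n * z)) / (of_nat n ^ (n * m) * Q)"
        unfolding Gamma_series'_def poch by (simp add: pw_def)
      have "pw b a \<noteq> 0" for a b by (simp add: pw_def)
      then show "g m = h m"
        unfolding g_def h_def A B using Q n by (simp add: field_simps)
    qed
    moreover have "g \<longlonglongrightarrow> pw n (of_nat n * z) * ?G z / Gamma (of_nat n * z)"
      unfolding g_def
    proof (intro tendsto_intros Gamma_series'_LIMSEQ)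
      have "strict_mono ((*) n)" using n by (simp add: strict_mono_def)
      from LIMSEQ_subseq_LIMSEQ[OF Gamma_series'_LIMSEQ this, of "of_nat n * z"]
      show "(\<lambda>m. Gamma_series' (of_nat n * z) (n * m)) \<longlonglongrightarrow> Gamma (of_nat n * z)" by (simp add: o_def)
      show "Gamma (of_nat n * z) \<noteq> 0" using z by (simp add: Gamma_eq_zero_iff)
    qed
    ultimately show ?thesis by (rule Lim_transform_eventually[rotated])
  qed
  have n1: "of_nat n * (1 / of_nat n) \<notin> (\<int>\<^sub>\<le>\<^sub>0 :: complex set)" using n by simp
  define L where "L = complex_of_real (sqrt (real n) * sqrt ((2 * pi) ^ (n - 1)))"
  have "pw n (of_nat n * (1 / of_nat n)) * ?G (1 / of_nat n) / Gamma (of_nat n * (1 / of_nat n)) = L"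
  proof -
    have "?G (1 / of_nat n) = complex_of_real (\<Prod>l<n. Gamma (real (Suc l) / real n))"
      by (simp add: Gamma_complex_of_real[symmetric] add_divide_distrib)
    also have "(\<Prod>l<n. Gamma (real (Suc l) / real n)) = (\<Prod>l\<in>{1..n}. Gamma (real l / real n))"
      by (rule prod.reindex_bij_witness[of _ "\<lambda>l. l - 1" Suc]) auto
    also have "{1..n} = insert n {1..<n}" using n by auto
    also have "(\<Prod>l\<in>insert n {1..<n}. Gamma (real l / real n)) = sqrt ((2 * pi) ^ (n - 1) / real n)"
      using n prod_Gamma_fractions[OF n] by simp
    finally have "?G (1 / of_nat n) = complex_of_real (sqrt ((2 * pi) ^ (n - 1) / real n))" .
    moreover have "pw n (of_nat n * (1 / of_nat n)) = complex_of_real (real n)"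
      using n by (simp add: pw_def exp_of_real)
    moreover have "real n * sqrt ((2 * pi) ^ (n - 1) / real n) = sqrt (real n) * sqrt ((2 * pi) ^ (n - 1))"
      using n by (simp add: real_sqrt_divide field_simps)
    ultimately have "pw n (of_nat n * (1 / of_nat n)) * ?G (1 / of_nat n) = L"
      unfolding L_def by (simp only: of_real_mult[symmetric])
    then show ?thesis using n by simp
  qed
  with lim[OF n1] have "h \<longlonglongrightarrow> L" by simp
  from LIMSEQ_unique[OF lim[OF z] this]
  have main: "pw n (of_nat n * z) * ?G z = L * Gamma (of_nat n * z)"
    using z by (simp add: Gamma_eq_zero_iff field_simps)
  have const: "complex_of_real (?c) * of_nat n powr (of_nat n * z - 1 / 2) * L = pw n (of_nat n * z)"
  proof -
    have "sqrt ((2 * pi) ^ (n - 1)) = (2 * pi) powr ((real n - 1) / 2)"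
    proof -
      have "(2 * pi) ^ (n - 1) = (2 * pi) powr (real n - 1)"
        using n powr_realpow[of "2 * pi" "n - 1"] by (simp add: of_nat_diff)
      then have "sqrt ((2 * pi) ^ (n - 1)) = ((2 * pi) powr (real n - 1)) powr (1 / 2)"
        by (simp only: powr_half_sqrt powr_ge_zero)
      then show ?thesis by (simp only: powr_powr) simp
    qed
    moreover have "(1 - real n) / 2 = - ((real n - 1) / 2)" unfolding minus_divide_left by simp
    ultimately have 1: "?c * sqrt ((2 * pi) ^ (n - 1)) = 1"
      by (simp only: powr_minus) simp
    have "of_nat n powr (of_nat n * z - 1 / 2) * complex_of_real (sqrt (real n)) = of_nat n powr (of_nat n * z)"
    proof -
      have "complex_of_real (sqrt (real n)) = of_real (real n powr (1/2))" by (simp add: powr_half_sqrt)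
      also have "\<dots> = of_nat n powr (1/2)" by (simp add: powr_of_real[symmetric])
      finally show ?thesis using n by (simp add: powr_add[symmetric])
    qed
    moreover have "of_nat n powr (of_nat n * z) = pw n (of_nat n * z)"
      using n by (simp add: powr_def pw_def Ln_of_nat)
    moreover have "complex_of_real (?c) * of_nat n powr (of_nat n * z - 1 / 2) * L
       = of_real (?c * sqrt ((2 * pi) ^ (n - 1))) * (of_nat n powr (of_nat n * z - 1 / 2) * complex_of_real (sqrt (real n)))"
      unfolding L_def of_real_mult by (simp only: mult_ac)
    ultimately show ?thesis unfolding 1 by simp
  qed
  have "L * Gamma (of_nat n * z) = (complex_of_real (?c) * of_nat n powr (of_nat n * z - 1 / 2) * L)
      * ?G z"
    unfolding const main ..
  also have "\<dots> = L * (of_real (?c) * of_nat n powr (of_nat n * z - 1 / 2)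
      * ?G z)"
    by (simp only: mult_ac)
  finally show ?thesis using n by (simp add: L_def)
qed

section \<open>The transformation formula\<close>

text \<open>The dominating functions have the product form b n * G t, since on a vertical line the
  modulus of n^(-s) does not depend on t.\<close>

lemma sums_integral_dominated:
  fixes f :: "nat \<Rightarrow> real \<Rightarrow> complex"
  assumes int: "\<And>n. integrable lborel (f n)" and G: "integrable lborel (G :: real \<Rightarrow> real)"
    and le: "\<And>n t. norm (f n t) \<le> b n * G t" and b: "summable b"
    and F: "\<And>t. (\<lambda>n. f n t) sums F t"
  shows "integrable lborel F" and "(\<lambda>n. integral\<^sup>L lborel (f n)) sums integral\<^sup>L lborel F"
proof -
  have 1: "AE t in lborel. summable (\<lambda>n. norm (f n t))"
    by (intro AE_I2 summable_comparison_test'[OF summable_mult2[OF b]]) (use le in auto)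
  have 2: "summable (\<lambda>n. \<integral>t. norm (f n t) \<partial>lborel)"
  proof (rule summable_comparison_test'[OF summable_mult2[OF b, of "integral\<^sup>L lborel G"]])
    fix n :: nat
    have "(\<integral>t. norm (f n t) \<partial>lborel) \<le> (\<integral>t. b n * G t \<partial>lborel)"
      using int G le by (intro integral_mono) auto
    then show "norm (\<integral>t. norm (f n t) \<partial>lborel) \<le> b n * integral\<^sup>L lborel G"
      by simp
  qed
  have "(\<lambda>t. \<Sum>n. f n t) = F" using F by (auto simp: sums_iff)
  with integrable_suminf[OF int 1 2] sums_integral[OF int 1 2]
  show "integrable lborel F" "(\<lambda>n. integral\<^sup>L lborel (f n)) sums integral\<^sup>L lborel F"
    by simp_all
qed

text \<open>The exponents of the Laurent polynomial (w^k - w^(-k)) / (w - w^(-1)).\<close>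

definition odd_range :: "nat \<Rightarrow> int set" where
  "odd_range k = {j \<in> {- (int k - 1)..int k - 1}. [j = int k - 1] (mod 2)}"

lemma odd_range_eq: "odd_range k = (\<lambda>l. 2 * int l - (int k - 1)) ` {..<k}"
proof (intro equalityI subsetI)
  fix j assume j: "j \<in> odd_range k"
  then have "2 dvd j + (int k - 1)" unfolding odd_range_def cong_def by auto
  then obtain q where q: "j + (int k - 1) = 2 * q" by (rule dvdE)
  then have "j = 2 * int (nat q) - (int k - 1)" "nat q < k" using j by (auto simp: odd_range_def)
  then show "j \<in> (\<lambda>l. 2 * int l - (int k - 1)) ` {..<k}" by (intro image_eqI[of _ _ "nat q"]) auto
next
  fix j assume "j \<in> (\<lambda>l. 2 * int l - (int k - 1)) ` {..<k}"
  then obtain l where "l < k" "j = 2 * int l - (int k - 1)" by auto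
  moreover have "[2 * int l - (int k - 1) = int k - 1] (mod 2)"
    unfolding cong_def by presburger
  ultimately show "j \<in> odd_range k" by (auto simp: odd_range_def)
qed

lemma sum_powi_odd_range:
  fixes w :: complex
  assumes w: "w \<noteq> 0"
  shows "(w - inverse w) * (\<Sum>j\<in>odd_range k. w powi j) = w ^ k - inverse w ^ k"
proof (cases k)
  case (Suc n)
  have "(\<Sum>j\<in>odd_range k. w powi j) = (\<Sum>l<k. w powi (2 * int l - (int k - 1)))"
    unfolding odd_range_eq by (subst sum.reindex) (auto simp: inj_on_def)
  also have "\<dots> = (\<Sum>l<k. (w\<^sup>2) ^ l * inverse w ^ n)"
  proof (intro sum.cong refl)
    fix l
    have "w powi (2 * int l - (int k - 1)) = w powi (int (2 * l)) * w powi (- int n)"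
      using w Suc by (simp add: power_int_add[symmetric])
    also have "\<dots> = (w\<^sup>2) ^ l * inverse w ^ n"
      unfolding power_int_of_nat power_mult by (simp add: power_int_minus power_inverse)
    finally show "w powi (2 * int l - (int k - 1)) = (w\<^sup>2) ^ l * inverse w ^ n" .
  qed
  also have "\<dots> = inverse w ^ n * (\<Sum>l<k. (w\<^sup>2) ^ l)"
    by (simp add: sum_distrib_left mult.commute)
  finally have S: "(\<Sum>j\<in>odd_range k. w powi j) = inverse w ^ n * (\<Sum>l<k. (w\<^sup>2) ^ l)" .
  have "w - inverse w = inverse w * (w\<^sup>2 - 1)"
    using w by (simp add: field_simps power2_eq_square)
  moreover have "inverse w ^ k = inverse w * inverse w ^ n" by (simp add: Suc)
  ultimately have "(w - inverse w) * (\<Sum>j\<in>odd_range k. w powi j) = inverse w ^ k * ((w\<^sup>2 - 1) * (\<Sum>l<k. (w\<^sup>2) ^ l))"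
    unfolding S by (simp only: mult_ac)
  also have "(w\<^sup>2 - 1) * (\<Sum>l<k. (w\<^sup>2) ^ l) = (w\<^sup>2) ^ k - 1"
    by (rule power_diff_1_eq[symmetric])
  also have "inverse w ^ k * ((w\<^sup>2) ^ k - 1) = w ^ k - inverse w ^ k"
    using w by (simp add: field_simps power2_eq_square power_mult_distrib)
  finally show ?thesis .
qed (simp add: odd_range_eq)

text \<open>The right-hand side is the Laurent polynomial $\sum_j w^j$ at $w = i e^{i \pi u / 2}$.\<close>

lemma reflection_sine_quotient:
  fixes u :: complex
  assumes k: "even k" and r: "odd r" and u: "sin (of_real pi * u) \<noteq> 0"
  shows "2 * sin (of_real pi * (of_nat k * (1 - u)) / 2) * sin (of_real pi * (1 - u - of_int r) / 2) / sin (of_real pi * u)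
     = (-1) powi ((2 * int k + r - 1) div 2) * (\<Sum>j\<in>odd_range k. \<i> powi j * exp (\<i> * of_int j * of_real pi * u / 2))"
proof -
  obtain h where h: "k = 2 * h" using k by blast
  obtain m where m: "r = 2 * m + 1" using r by (elim oddE)
  define \<phi> where "\<phi> = of_real pi * u / 2"
  \<comment> \<open>The shift by pi / 2 makes w - 1 / w equal to 2 i cos phi; as k is even, w^k -
    w^(-k) is still a multiple of sin (k phi).\<close>
  define w where "w = exp (\<i> * (\<phi> + of_real (pi / 2)))"
  have w0: "w \<noteq> 0" by (simp add: w_def)
  have w_eq: "w = \<i> * exp (\<i> * \<phi>)"
  proof -
    have "exp (\<i> * of_real (pi / 2)) = \<i>" unfolding cis_conv_exp[symmetric] by simp
    then show ?thesis unfolding w_def distrib_left exp_add by (simp only: mult.commute)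
  qed
  have inv: "inverse w = - \<i> * exp (- (\<i> * \<phi>))"
    unfolding w_eq inverse_mult_distrib exp_minus by simp
  have sinu: "sin (of_real pi * u) = 2 * sin \<phi> * cos \<phi>"
    using sin_double[of \<phi>] by (simp add: \<phi>_def)
  have s0: "sin \<phi> \<noteq> 0" "cos \<phi> \<noteq> 0" using u unfolding sinu by auto
  have diff: "w - inverse w = 2 * \<i> * cos \<phi>"
    unfolding inv unfolding w_eq cos_exp_eq by (simp add: algebra_simps)
  have "w ^ k - inverse w ^ k = (-1) ^ h * (exp (\<i> * (of_nat k * \<phi>)) - exp (- (\<i> * (of_nat k * \<phi>))))"
  proof -
    have "\<i> ^ k = (-1) ^ h" "(- \<i>) ^ k = (-1) ^ h" by (simp_all add: h power_mult)
    moreover have "exp (\<i> * \<phi>) ^ k = exp (\<i> * (of_nat k * \<phi>))" "exp (- (\<i> * \<phi>)) ^ k = exp (- (\<i> * (of_nat k * \<phi>)))"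
      unfolding exp_of_nat_mult[symmetric] by (simp_all add: mult_ac)
    moreover have "inverse w ^ k = (- \<i>) ^ k * exp (- (\<i> * \<phi>)) ^ k"
      unfolding inv by (rule power_mult_distrib)
    moreover have "w ^ k = \<i> ^ k * exp (\<i> * \<phi>) ^ k"
      unfolding w_eq by (rule power_mult_distrib)
    ultimately show ?thesis by (simp only: right_diff_distrib)
  qed
  also have "\<dots> = (-1) ^ h * (2 * \<i> * sin (of_nat k * \<phi>))"
    unfolding sin_exp_eq by simp
  finally have "2 * \<i> * cos \<phi> * (\<Sum>j\<in>odd_range k. w powi j) = (-1) ^ h * (2 * \<i> * sin (of_nat k * \<phi>))"
    using sum_powi_odd_range[OF w0, of k] unfolding diff by simp
  then have sum: "cos \<phi> * (\<Sum>j\<in>odd_range k. w powi j) = (-1) ^ h * sin (of_nat k * \<phi>)"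
    by (simp add: mult_ac)
  have wj: "w powi j = \<i> powi j * exp (\<i> * of_int j * of_real pi * u / 2)" for j
  proof -
    have "exp (\<i> * \<phi>) powi j = exp (\<i> * \<phi>) powr of_int j" by (subst complex_powr_of_int) auto
    also have "\<dots> = exp (of_int j * (\<i> * \<phi>))"
      unfolding complex_powr_of_int[of "exp (\<i> * \<phi>)" j, simplified] by (simp add: exp_power_int mult.commute)
    finally show ?thesis unfolding w_eq power_int_mult_distrib by (simp add: \<phi>_def mult_ac)
  qed
  have A: "sin (of_real pi * (of_nat k * (1 - u)) / 2) = - ((-1) ^ h * sin (of_nat k * \<phi>))"
  proof -
    have "of_real pi * (of_nat k * (1 - u)) / 2 = of_real (pi * real h) - of_nat k * \<phi>"
      by (simp add: h \<phi>_def field_simps)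
    moreover have "sin (of_real (pi * real h) :: complex) = 0" "cos (of_real (pi * real h) :: complex) = (-1) ^ h"
      unfolding sin_of_real cos_of_real by (simp_all add: mult.commute[of pi] sin_npi cos_npi)
    ultimately show ?thesis by (simp only: sin_diff) simp
  qed
  have B: "sin (of_real pi * (1 - u - of_int r) / 2) = - ((-1) powi m * sin \<phi>)"
  proof -
    have "of_real pi * (1 - u - of_int r) / 2 = - (\<phi> + of_real (pi * of_int m))"
      by (simp add: m \<phi>_def field_simps)
    moreover have "sin (of_real (pi * of_int m) :: complex) = 0" "cos (of_real (pi * of_int m) :: complex) = (-1) powi m"
    proof -
      have "cis (pi * of_int m) = of_real ((-1) powi m)"
        using cis_power_int[of pi m] by (simp add: mult.commute)
      then have "Re (cis (pi * of_int m)) = (-1) powi m" "Im (cis (pi * of_int m)) = 0"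
        by (simp_all only: Re_complex_of_real Im_complex_of_real)
      then show "sin (of_real (pi * of_int m) :: complex) = 0" "cos (of_real (pi * of_int m) :: complex) = (-1) powi m"
        unfolding sin_of_real cos_of_real by simp_all
    qed
    ultimately show ?thesis by (simp only: sin_minus sin_add) simp
  qed
  \<comment> \<open>With r = 2 m + 1 the exponent is k + m, and k is even. The sign (-1)^h from k =
    2 h occurs both in the sine of the zeta factor and in the Laurent sum, and cancels.\<close>
  have sgn: "(-1) powi ((2 * int k + r - 1) div 2) = ((-1) powi m :: complex)"
  proof -
    have "(2 * int k + r - 1) div 2 = int k + m" by (simp add: m)
    then show ?thesis using k by (auto simp: power_int_add)
  qed
  have "2 * sin (of_real pi * (of_nat k * (1 - u)) / 2) * sin (of_real pi * (1 - u - of_int r) / 2) / sin (of_real pi * u)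
      = (-1) powi m * ((-1) ^ h * sin (of_nat k * \<phi>)) / cos \<phi>"
    unfolding A B sinu using s0 by (simp add: field_simps)
  also have "\<dots> = (-1) powi m * (\<Sum>j\<in>odd_range k. w powi j)"
    unfolding sum[symmetric] using s0 by simp
  finally show ?thesis unfolding sgn wj .
qed

section \<open>The kernel and its reflection\<close>

locale lambert_transform =
  fixes k :: nat and r :: int and x :: real
  assumes k2: "k \<ge> 2" and k_even: "even k" and r_odd: "odd r" and r_ne: "r \<noteq> -1" and x_pos: "x > 0"
begin

definition params :: "complex list" where
  "params = of_int r # map (\<lambda>l. - (of_nat l / of_nat k)) [1..<k]"

text \<open>A half-integer, so that neither the line nor its reflection meets a pole of the gamma function.\<close>

definition line :: real where "line = \<bar>of_int r\<bar> + 5 / 2"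

definition kernel :: "complex \<Rightarrow> complex" where
  "kernel s = Gamma s * zeta (of_nat k * s) * zeta (s - of_int r) * of_real x powr (- s)"

definition dual_const :: complex where
  "dual_const = (- 1) powi ((2 * int k + r - 1) div 2)
     * of_real ((2 * pi) powr ((real k + 1 - 2 * of_int r) / 2) / (x * real k powr ((2 * real k - 1) / 2)))"

definition dual_zeta :: "complex \<Rightarrow> complex" where
  "dual_zeta u = zeta (of_nat k * u - of_nat (k - 1)) * zeta (u + of_int r)"

lemma params_real: "\<forall>b\<in>set params. b \<in> \<real>"
  by (auto simp: params_def)

lemma length_params: "length params = k"
  using k2 by (simp add: params_def)

lemma line_gt: "\<forall>b\<in>set params. - Re b < line"
proof
  fix b assume "b \<in> set params"
  then consider "b = of_int r" | l where "l < k" "b = - (of_nat l / of_nat k)"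
    by (auto simp: params_def)
  then show "- Re b < line"
  proof cases
    case 2
    then have "- Re b = real l / real k" by (simp add: Re_divide_of_nat)
    also have "\<dots> < 1" using 2 by simp
    also have "1 < line" by (simp add: line_def)
    finally show ?thesis .
  qed (simp add: line_def)
qed

text \<open>A rotation by at most (k - 1) pi / 2 leaves a margin of pi / 2 inside the sector of
  convergence.\<close>

lemma X_arg_bound: "j \<in> odd_range k \<Longrightarrow> \<bar>X_arg j\<bar> < real (length params) * (pi / 2)"
proof -
  assume "j \<in> odd_range k"
  then have "\<bar>j\<bar> < int k" by (auto simp: odd_range_def)
  then have "\<bar>real_of_int j\<bar> < real k" by linarith
  then show ?thesis by (simp add: X_arg_def length_params abs_mult)
qed

lemma X_abs_pos: "n > 0 \<Longrightarrow> X_abs k x n > 0"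
  using k2 x_pos by (simp add: X_abs_def)

lemma prod_list_params:
  "(\<Prod>b\<leftarrow>params. Gamma (b + u)) = Gamma (u + of_int r) * (\<Prod>l\<in>{1..<k}. Gamma (u - of_nat l / of_nat k))"
proof -
  have "(\<Prod>b\<leftarrow>map (\<lambda>l. - (of_nat l / of_nat k)) [1..<k]. Gamma (b + u))
      = (\<Prod>l\<in>set [1..<k]. Gamma (- (of_nat l / of_nat k) + u))"
    by (subst prod.distinct_set_conv_list) (simp_all add: o_def)
  then show ?thesis by (simp add: params_def add.commute)
qed

text \<open>X(j) is proportional to n, so n^(-u) splits off the integrand and the sum over n becomes
  a Dirichlet series.\<close>

lemma meijer_integrand_X_abs:
  assumes "n > 0"
  shows "meijer_integrand params (X_abs k x n) \<theta> u = meijer_integrand params (X_abs k x 1) \<theta> u * of_nat n powr (- u)"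
proof -
  have "X_abs k x n = X_abs k x 1 * real n" by (simp add: X_abs_def)
  then have "ln (X_abs k x n) = ln (X_abs k x 1) + ln (real n)"
    using X_abs_pos[of 1] assms by (simp add: ln_mult)
  then have "Complex (ln (X_abs k x n)) \<theta> = Complex (ln (X_abs k x 1)) \<theta> + of_real (ln (real n))"
    by (simp add: complex_eq_iff)
  then show ?thesis
    using assms by (simp add: meijer_integrand_def polar_power_def of_nat_powr_eq_exp distrib_left exp_add exp_diff exp_minus field_simps)
qed

text \<open>The conditions on Re u place both zeta arguments, k (1 - u) and 1 - u - r, in the
  half-plane of the functional equation. Its gamma factors are Gamma(u + r), already a factor of the
  Meijer integrand, and Gamma(1 - k (1 - u)), which Gauss's formula splits into the Gamma(u - l /
  k). The factor with l = 0 does not belong to the parameters: together with Gamma(1 - u) it forms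
  pi / sin (pi u).\<close>

lemma kernel_reflection:
  assumes u1: "Re u > 1" and u2: "Re u > 1 - of_int r" and u: "sin (of_real pi * u) \<noteq> 0"
  shows "kernel (1 - u) = dual_const *
    (\<Sum>j\<in>odd_range k. \<i> powi j * (meijer_integrand params (X_abs k x 1) (X_arg j) u * dual_zeta u))"
proof -
  define L Lk Lx where "L = complex_of_real (ln (2 * pi))" and "Lk = complex_of_real (ln (real k))" and "Lx = complex_of_real (ln x)"
  let ?e1 = "exp ((of_nat k * (1 - u) - 1) * L)"
    and ?e2 = "exp ((- u - of_int r) * L)"
    and ?e3 = "exp ((1 - of_nat k) / 2 * L)"
    and ?e4 = "exp ((1 - of_nat k * (1 - u) - 1 / 2) * Lk)"
    and ?e5 = "exp (- (1 - u) * Lx)"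
    and ?c = "(2 * pi) powr ((real k + 1 - 2 * of_int r) / 2) / (x * real k powr ((2 * real k - 1) / 2))"
    and ?G = "\<Prod>l\<in>{1..<k}. Gamma (u - of_nat l / of_nat k)"
    and ?eX = "exp (- u * of_real (ln (X_abs k x 1)))"
    and ?ej = "\<lambda>j. exp (\<i> * of_int j * of_real pi * u / 2)"
  define sA sB where "sA = sin (of_real pi * (of_nat k * (1 - u)) / 2)" and "sB = sin (of_real pi * (1 - u - of_int r) / 2)"
  define W where "W = (\<Prod>b\<leftarrow>params. Gamma (b + u))"
  have kpos: "real k > 0" using k2 by simp
  have pw2pi: "(2 * of_real pi) powr z = exp (z * L)" for z :: complex
  proof -
    have "Ln (2 * of_real pi) = L"
      using Ln_of_real[of "2 * pi"] by (simp add: L_def)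
    then show ?thesis by (simp add: powr_def)
  qed
  have pwk: "of_nat k powr z = exp (z * Lk)" for z :: complex
    using k2 by (simp add: of_nat_powr_eq_exp Lk_def)
  have pwx: "of_real x powr z = exp (z * Lx)" for z :: complex
    using x_pos by (simp add: powr_def Ln_of_real Lx_def)
  have "Re (of_nat k * (1 - u)) < 0" using u1 kpos by (simp add: mult_pos_neg)
  from zeta_functional_equation[OF this]
  have F1: "zeta (of_nat k * (1 - u)) = 2 * ?e1 * sA
      * Gamma (1 - of_nat k * (1 - u)) * zeta (1 - of_nat k * (1 - u))"
    by (simp add: pw2pi sA_def)
  have "Re (1 - u - of_int r) < 0" using u2 by simp
  from zeta_functional_equation[OF this]
  have F2: "zeta (1 - u - of_int r) = 2 * ?e2 * sB * Gamma (u + of_int r) * zeta (u + of_int r)"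
    by (simp add: pw2pi sB_def)
  have zk: "1 - of_nat k * (1 - u) = of_nat k * u - of_nat (k - 1)"
    using k2 by (simp add: of_nat_diff algebra_simps)
  have Gu: "Gamma (1 - u) * Gamma u = of_real pi / sin (of_real pi * u)"
    using Gamma_reflection_complex[of u] by (simp add: mult.commute)
  have GM: "Gamma (1 - of_nat k * (1 - u)) = ?e3 * ?e4
      * (Gamma u * (?G))"
  proof -
    \<comment> \<open>Chosen so that k z = 1 - k (1 - u); the arguments z + l / k then run through
      the u - l / k in reverse order.\<close>
    define z where "z = u - 1 + 1 / of_nat k"
    have kz: "of_nat k * z = 1 - of_nat k * (1 - u)" using k2 by (simp add: z_def field_simps)
    have "Re (of_nat k * z) > 0"
    proof -
      have "0 < real k * (Re u - 1)" using u1 kpos by simp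
      then show ?thesis unfolding kz by (simp add: algebra_simps)
    qed
    then have "of_nat k * z \<notin> \<int>\<^sub>\<le>\<^sub>0" by (rule not_nonpos_Int_Re)
    from Gamma_multiplication[OF _ this] have "Gamma (of_nat k * z) = of_real ((2 * pi) powr ((1 - real k) / 2)) * of_nat k powr (of_nat k * z - 1 / 2)
           * (\<Prod>l<k. Gamma (z + of_nat l / of_nat k))" using k2 by simp
    moreover have "complex_of_real ((2 * pi) powr ((1 - real k) / 2)) = ?e3"
      by (simp add: powr_def L_def exp_of_real[symmetric])
    moreover have "(\<Prod>l<k. Gamma (z + of_nat l / of_nat k)) = Gamma u * (?G)"
    proof -
      have "(\<Prod>l<k. Gamma (z + of_nat l / of_nat k)) = (\<Prod>l<k. Gamma (u - of_nat l / of_nat k))"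
      proof (rule prod.reindex_bij_witness[of _ "\<lambda>l. k - 1 - l" "\<lambda>l. k - 1 - l"])
        fix l assume l: "l \<in> {..<k}"
        have "complex_of_nat (k - 1 - l) = of_nat k - 1 - of_nat l" using l by (simp add: of_nat_diff)
        then have "u - of_nat (k - 1 - l) / of_nat k = z + of_nat l / of_nat k"
          using kpos by (simp add: z_def field_simps)
        then show "Gamma (u - of_nat (k - 1 - l) / of_nat k) = Gamma (z + of_nat l / of_nat k)" by simp
      qed auto
      also have "\<dots> = (\<Prod>l\<in>insert 0 {1..<k}. Gamma (u - of_nat l / of_nat k))"
        by (intro prod.cong refl) (use k2 in auto)
      finally show ?thesis by simp
    qed
    ultimately show ?thesis unfolding kz pwk by simp
  qed
  have trig: "2 * sA * sB / sin (of_real pi * u)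
     = (-1) powi ((2 * int k + r - 1) div 2) * (\<Sum>j\<in>odd_range k. \<i> powi j * ?ej j)"
    unfolding sA_def sB_def by (rule reflection_sine_quotient[OF k_even r_odd u])
  have twopi: "2 * of_real pi = exp L"
    by (simp add: L_def exp_of_real)
  \<comment> \<open>All powers of 2 pi, k and x are collected into one exponential. Its part linear
    in u is the power of \<open>X_abs k x 1\<close>, the rest is the positive factor of
    \<open>dual_const\<close>.\<close>
  define E where "E = exp (L + (of_nat k * (1 - u) - 1) * L + (- u - of_int r) * L + (1 - of_nat k) / 2 * L
      + (1 - of_nat k * (1 - u) - 1 / 2) * Lk - (1 - u) * Lx)"
  have E_split: "E = exp L * ?e1 * ?e2 * ?e3
      * ?e4 * ?e5"
    unfolding E_def exp_add[symmetric] by (rule arg_cong[of _ _ exp]) (simp add: algebra_simps)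
  have "kernel (1 - u) = (Gamma (1 - u) * Gamma u) * (2 * ?e1 * sA)
      * (?e3 * ?e4)
      * (2 * ?e2 * sB) * ?e5
      * (Gamma (u + of_int r) * (?G))
      * (zeta (of_nat k * u - of_nat (k - 1)) * zeta (u + of_int r))"
    unfolding kernel_def pwx F1 F2 GM unfolding zk by (simp only: mult_ac)
  also have "\<dots> = (2 * of_real pi) * (2 * sA * sB / sin (of_real pi * u)) * (?e1 * ?e2
      * ?e3 * ?e4 * ?e5) * W * dual_zeta u"
    unfolding Gu W_def prod_list_params dual_zeta_def by (simp only: mult_ac times_divide_eq_left times_divide_eq_right)
  also have "\<dots> = (2 * sA * sB / sin (of_real pi * u)) * E * W * dual_zeta u"
    unfolding twopi E_split by (simp only: mult_ac)
  also have "E = of_real (?c)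
      * ?eX"
  proof -
    have "?c
        = exp ((real k + 1 - 2 * of_int r) / 2 * ln (2 * pi) - ln x - (2 * real k - 1) / 2 * ln (real k))"
      using kpos x_pos by (simp add: powr_def exp_diff)
    then have e1: "complex_of_real (?c)
        = exp ((of_nat k + 1 - 2 * of_int r) / 2 * L - Lx - (2 * of_nat k - 1) / 2 * Lk)"
      by (simp only:) (simp add: exp_of_real[symmetric] L_def Lk_def Lx_def)
    have "ln (X_abs k x 1) = (real k + 1) * ln (2 * pi) - (real k * ln (real k) + ln x)"
      using kpos x_pos by (simp add: X_abs_def ln_div ln_mult ln_realpow algebra_simps del: power_Suc)
    then have e2: "complex_of_real (ln (X_abs k x 1)) = (of_nat k + 1) * L - (of_nat k * Lk + Lx)"
      by (simp add: L_def Lk_def Lx_def)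
    show ?thesis unfolding E_def e1 e2 exp_add[symmetric]
      by (rule arg_cong[of _ _ exp]) (simp add: field_simps)
  qed
  also have "(2 * sA * sB / sin (of_real pi * u)) * (of_real (?c)
      * ?eX) * W * dual_zeta u
     = dual_const * ((\<Sum>j\<in>odd_range k. \<i> powi j * ?ej j) * (?eX * W * dual_zeta u))"
    unfolding trig dual_const_def by (simp only: mult_ac)
  also have "(\<Sum>j\<in>odd_range k. \<i> powi j * ?ej j) * (?eX * W * dual_zeta u)
     = (\<Sum>j\<in>odd_range k. \<i> powi j * (meijer_integrand params (X_abs k x 1) (X_arg j) u * dual_zeta u))"
    unfolding sum_distrib_right
  proof (intro sum.cong refl)
    fix j
    \<comment> \<open>The angle \<open>X_arg j\<close> contributes the exponent i pi j u / 2, which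
      is that of the j-th monomial.\<close>
    have "polar_power (X_abs k x 1) (X_arg j) (- u) = ?ej j * ?eX"
      unfolding polar_power_def exp_add[symmetric]
      by (rule arg_cong[of _ _ exp]) (simp add: Complex_eq X_arg_def field_simps)
    then show "\<i> powi j * ?ej j * (?eX * W * dual_zeta u)
       = \<i> powi j * (meijer_integrand params (X_abs k x 1) (X_arg j) u * dual_zeta u)"
      unfolding meijer_integrand_def W_def by (simp only: mult_ac)
  qed
  finally show ?thesis .
qed

lemma meijer_series_sums:
  assumes u1: "Re u > 1" and u2: "Re u > 1 - of_int r"
  shows "(\<lambda>n. of_real (S_sum k r (Suc n)) * meijer_integrand params (X_abs k x (Suc n)) \<theta> u)
     sums (meijer_integrand params (X_abs k x 1) \<theta> u * dual_zeta u)"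
proof -
  have "real k * (Re u - 1) > 0" using u1 k2 by simp
  then have s1: "1 < Re (of_nat k * u - of_nat (k - 1))" using k2 by (simp add: of_nat_diff algebra_simps)
  have "(\<lambda>n. of_real (power_divisor_sum k (- r) (k - 1) (Suc n)) * of_nat (Suc n) powr (- u)) sums
      (zeta (of_nat k * u - of_nat (k - 1)) * zeta (u - of_int (- r)))"
    using k2 u2 by (intro power_divisor_Dirichlet_series s1) auto
  then have "(\<lambda>n. of_real (S_sum k r (Suc n)) * of_nat (Suc n) powr (- u)) sums dual_zeta u"
    by (simp add: S_sum_eq dual_zeta_def)
  from sums_mult[OF this, of "meijer_integrand params (X_abs k x 1) \<theta> u"]
  show ?thesis by (simp only: meijer_integrand_X_abs[OF zero_less_Suc] mult_ac)
qed

end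

section \<open>Poles and residues of the kernel\<close>

context lambert_transform
begin

text \<open>Besides the three actual poles these are the points where a pole of the gamma function is removable.\<close>

definition special_points :: "complex set" where
  "special_points = insert (1 / of_nat k) (insert (1 + of_int r) ((\<lambda>m. - of_nat m) ` {..nat \<bar>r\<bar> + 1}))"

lemma finite_special_points: "finite special_points"
  by (simp add: special_points_def)

lemma of_int_in_nonpos_Ints: "of_int i \<in> (\<int>\<^sub>\<le>\<^sub>0 :: complex set) \<longleftrightarrow> i \<le> 0"
  by (auto simp: nonpos_Ints_def)

lemma special_points_Re: "p \<in> special_points \<Longrightarrow> 1 - line < Re p \<and> Re p < line"
proof -
  assume "p \<in> special_points"
  then consider "p = 1 / of_nat k" | "p = 1 + of_int r" | m where "m \<le> nat \<bar>r\<bar> + 1" "p = - of_nat m"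
    by (auto simp: special_points_def)
  then show ?thesis
  proof cases
    case 1
    then have "Re p = 1 / real k" by (simp add: Re_divide_of_nat)
    moreover have "0 < 1 / real k" "1 / real k \<le> 1" using k2 by auto
    ultimately show ?thesis unfolding line_def by linarith
  next
    case 3
    have "real m \<le> real (nat \<bar>r\<bar> + 1)" using 3(1) by (rule of_nat_mono)
    then have "real m \<le> \<bar>real_of_int r\<bar> + 1" by simp
    then show ?thesis using 3(2) by (simp add: line_def)
  qed (auto simp: line_def)
qed

lemma kernel_holomorphic:
  "kernel holomorphic_on {s. 1 - line - 1 / 4 < Re s \<and> Re s < line + 1} - special_points"
proof -
  define S where "S = {s. 1 - line - 1 / 4 < Re s \<and> Re s < line + 1} - special_points"
  have k0: "(of_nat k :: complex) \<noteq> 0" using k2 by simp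
  have "s \<notin> \<int>\<^sub>\<le>\<^sub>0" if "s \<in> S" for s
  proof
    assume "s \<in> \<int>\<^sub>\<le>\<^sub>0"
    then obtain m where m: "s = - of_nat m" by (auto elim!: nonpos_Ints_cases')
    \<comment> \<open>The strip begins at 1 - line - 1/4 = -|r| - 7/4, so the nonpositive integers
      in it go down to -(|r| + 1) only.\<close>
    then have "- real m > - \<bar>real_of_int r\<bar> - 7 / 4" using that by (simp add: S_def line_def)
    then have "int m < \<bar>r\<bar> + 2" by linarith
    then have "m \<le> nat \<bar>r\<bar> + 1" by linarith
    then show False using that m by (auto simp: S_def special_points_def)
  qed
  moreover have "(\<lambda>s. zeta (of_nat k * s)) holomorphic_on S"
  proof -
    have "zeta \<circ> (\<lambda>s. of_nat k * s) holomorphic_on S"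
      by (rule holomorphic_on_compose_gen[OF _ holomorphic_zeta])
        (use k0 in \<open>auto simp: S_def special_points_def field_simps intro!: holomorphic_intros\<close>)
    then show ?thesis by (simp add: o_def)
  qed
  moreover have "(\<lambda>s. zeta (s - of_int r)) holomorphic_on S"
  proof -
    have "zeta \<circ> (\<lambda>s. s - of_int r) holomorphic_on S"
      by (rule holomorphic_on_compose_gen[OF _ holomorphic_zeta])
        (auto simp: S_def special_points_def algebra_simps intro!: holomorphic_intros)
    then show ?thesis by (simp add: o_def)
  qed
  ultimately have "(\<lambda>s. Gamma s * zeta (of_nat k * s) * zeta (s - of_int r) * of_real x powr (- s)) holomorphic_on S"
    using x_pos by (intro holomorphic_intros) auto
  then show ?thesis unfolding kernel_def[abs_def] S_def .
qed

text \<open>Gamma alone supplies the exponential decay; the zeta factors, taken in strips of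
  half-width k * line and 2 * line, are polynomially bounded.\<close>

lemma kernel_bound:
  "\<exists>C. \<forall>s. 1 - line \<le> Re s \<longrightarrow> Re s \<le> line \<longrightarrow> 1 \<le> \<bar>Im s\<bar> \<longrightarrow> norm (kernel s) \<le> C / (1 + (Im s)\<^sup>2)"
proof -
  have l: "line \<ge> 5 / 2" "\<bar>real_of_int r\<bar> \<le> line" by (auto simp: line_def)
  obtain C1 N1 where C1: "C1 > 0" and G: "\<And>s. \<bar>Re s\<bar> \<le> line \<Longrightarrow> 1 \<le> \<bar>Im s\<bar> \<Longrightarrow>
      norm (Gamma s) \<le> C1 * \<bar>Im s\<bar> ^ N1 * exp (- (pi / 2) * \<bar>Im s\<bar>)"
    using norm_Gamma_strip_le[of line] by metis
  obtain C2 N2 where C2: "C2 > 0" and Z1: "\<And>s. \<bar>Re s\<bar> \<le> real k * line \<Longrightarrow> 1 \<le> \<bar>Im s\<bar> \<Longrightarrow>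
      norm (zeta s) \<le> C2 * \<bar>Im s\<bar> ^ N2"
    using zeta_strip_bound[of "real k * line"] by metis
  obtain C3 N3 where C3: "C3 > 0" and Z2: "\<And>s. \<bar>Re s\<bar> \<le> 2 * line \<Longrightarrow> 1 \<le> \<bar>Im s\<bar> \<Longrightarrow>
      norm (zeta s) \<le> C3 * \<bar>Im s\<bar> ^ N3"
    using zeta_strip_bound[of "2 * line"] by metis
  obtain D where D: "D > 0" "\<And>t. 1 \<le> \<bar>t\<bar> \<Longrightarrow> \<bar>t\<bar> ^ (N1 + N2 + N3) * exp (- (pi / 2) * \<bar>t\<bar>) \<le> D / (1 + t\<^sup>2)"
    using power_times_exp_decay[of "pi / 2" "N1 + N2 + N3"] pi_gt_zero by (metis half_gt_zero)
  define B where "B = exp (line * \<bar>ln x\<bar>)"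
  define K where "K = C1 * (C2 * real k ^ N2) * C3 * B"
  have "norm (kernel s) \<le> K * D / (1 + (Im s)\<^sup>2)" if s: "1 - line \<le> Re s" "Re s \<le> line" "1 \<le> \<bar>Im s\<bar>" for s
  proof -
    have re: "\<bar>Re s\<bar> \<le> line" using s by linarith
    have z1: "norm (zeta (of_nat k * s)) \<le> C2 * (real k * \<bar>Im s\<bar>) ^ N2"
    proof -
      have "norm (zeta (of_nat k * s)) \<le> C2 * \<bar>Im (of_nat k * s)\<bar> ^ N2"
      proof (rule Z1)
        show "\<bar>Re (of_nat k * s)\<bar> \<le> real k * line" using re by (simp add: abs_mult mult_left_mono)
        show "1 \<le> \<bar>Im (of_nat k * s)\<bar>" using mult_mono[of 1 "real k" 1 "\<bar>Im s\<bar>"] k2 s by (simp add: abs_mult)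
      qed
      then show ?thesis by (simp add: abs_mult)
    qed
    have "Re (s - of_int r) = Re s - real_of_int r" "Im (s - of_int r) = Im s" by simp_all
    then have z2: "norm (zeta (s - of_int r)) \<le> C3 * \<bar>Im s\<bar> ^ N3"
      using Z2[of "s - of_int r"] re s l by (metis (no_types, lifting) abs_triangle_ineq4 add_mono mult_2 order_trans)
    have xs: "norm (of_real x powr (- s)) \<le> B"
    proof -
      have "norm (of_real x powr (- s)) = exp (- Re s * ln x)"
        using x_pos by (simp add: norm_powr_real_powr powr_def)
      also have "- Re s * ln x \<le> \<bar>Re s\<bar> * \<bar>ln x\<bar>" by (metis abs_ge_self abs_minus_cancel abs_mult)
      also have "\<dots> \<le> line * \<bar>ln x\<bar>" using re by (intro mult_right_mono) auto
      finally show ?thesis by (simp add: B_def)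
    qed
    have "norm (kernel s) \<le> (C1 * \<bar>Im s\<bar> ^ N1 * exp (- (pi / 2) * \<bar>Im s\<bar>)) * (C2 * (real k * \<bar>Im s\<bar>) ^ N2) * (C3 * \<bar>Im s\<bar> ^ N3) * B"
      unfolding kernel_def norm_mult using C1 C2 C3
      by (intro mult_mono G z1 z2 xs re s mult_nonneg_nonneg) auto
    also have "\<dots> = K * (\<bar>Im s\<bar> ^ (N1 + N2 + N3) * exp (- (pi / 2) * \<bar>Im s\<bar>))"
      unfolding K_def power_add power_mult_distrib by (simp only: mult_ac)
    also have "\<dots> \<le> K * (D / (1 + (Im s)\<^sup>2))"
      using C1 C2 C3 by (intro mult_left_mono D(2) s) (auto simp: K_def B_def)
    finally show ?thesis by simp
  qed
  then show ?thesis by blast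
qed

text \<open>The singularities of the kernel in the strip are at most simple poles, so every residue
  is a limit; a removable one is covered by the limit 0.\<close>

lemma kernel_residue:
  assumes p: "p \<in> special_points" and lim: "((\<lambda>w. kernel w * (w - p)) \<longlongrightarrow> c) (at p)"
  shows "residue kernel p = c"
proof (rule residue_simple')
  have "open ({s. Re s > 1 - line - 1 / 4} \<inter> {s. Re s < line + 1})"
    by (intro open_Int open_halfspace_Re_gt open_halfspace_Re_lt)
  moreover have "closed (special_points - {p})"
    by (intro finite_imp_closed finite_Diff finite_special_points)
  ultimately show "open ({s. Re s > 1 - line - 1 / 4} \<inter> {s. Re s < line + 1} - (special_points - {p}))"
    by (rule open_Diff)
  show "p \<in> {s. Re s > 1 - line - 1 / 4} \<inter> {s. Re s < line + 1} - (special_points - {p})"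
    using special_points_Re[OF p] by auto
  show "kernel holomorphic_on {s. Re s > 1 - line - 1 / 4} \<inter> {s. Re s < line + 1} - (special_points - {p}) - {p}"
    by (rule holomorphic_on_subset[OF kernel_holomorphic]) auto
qed (rule lim)

lemma zeta_tendsto:
  assumes "(f \<longlongrightarrow> z) F" and "z \<noteq> 1"
  shows "((\<lambda>w. zeta (f w)) \<longlongrightarrow> zeta z) F"
proof (rule isCont_tendsto_compose[OF _ assms(1)])
  have "open (- {1 :: complex})" by (intro open_Compl closed_singleton)
  then show "isCont zeta z"
    using holomorphic_on_imp_continuous_on[OF holomorphic_zeta] assms(2)
    by (auto simp: continuous_on_eq_continuous_at)
qed

lemma x_powr_tendsto: "((\<lambda>w. of_real x powr (- w)) \<longlongrightarrow> of_real x powr (- p)) (at p)" for p :: complex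
proof -
  have "isCont (\<lambda>w. of_real x powr (- w)) p" using x_pos by (intro continuous_intros) auto
  then show ?thesis by (simp add: isCont_def)
qed

lemma zeta_shift_tendsto: "p \<noteq> 1 + of_int r \<Longrightarrow> ((\<lambda>w. zeta (w - of_int r)) \<longlongrightarrow> zeta (p - of_int r)) (at p)"
  by (intro zeta_tendsto tendsto_intros) (auto simp: algebra_simps)

lemma zeta_scale_tendsto: "p \<noteq> 1 / of_nat k \<Longrightarrow> ((\<lambda>w. zeta (of_nat k * w)) \<longlongrightarrow> zeta (of_nat k * p)) (at p)"
  using k2 by (intro zeta_tendsto tendsto_intros) (auto simp: field_simps)

lemma zeta_shift_pole: "((\<lambda>w. zeta (w - of_int r) * (w - (1 + of_int r))) \<longlongrightarrow> 1) (at (1 + of_int r))"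
proof -
  have "((\<lambda>w. w - of_int r) \<longlongrightarrow> 1) (at (1 + of_int r :: complex))"
    by (auto intro!: tendsto_eq_intros)
  moreover have "eventually (\<lambda>w. w - of_int r \<noteq> (1 :: complex)) (at (1 + of_int r))"
    by (auto simp: eventually_at_filter algebra_simps)
  ultimately have "filterlim (\<lambda>w. w - of_int r) (at (1 :: complex)) (at (1 + of_int r))"
    by (simp add: filterlim_at)
  from filterlim_compose[OF zeta_pole this] show ?thesis by (simp add: algebra_simps)
qed

lemma zeta_scale_pole: "((\<lambda>w. zeta (of_nat k * w) * (w - 1 / of_nat k)) \<longlongrightarrow> 1 / of_nat k) (at (1 / of_nat k))"
proof -
  have k0: "(of_nat k :: complex) \<noteq> 0" using k2 by simp
  have "((\<lambda>w. of_nat k * w) \<longlongrightarrow> 1) (at (1 / of_nat k :: complex))"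
    using k0 by (auto intro!: tendsto_eq_intros)
  moreover have "eventually (\<lambda>w. of_nat k * w \<noteq> (1 :: complex)) (at (1 / of_nat k))"
    using k0 by (auto simp: eventually_at_filter field_simps)
  ultimately have "filterlim (\<lambda>w. of_nat k * w) (at (1 :: complex)) (at (1 / of_nat k))"
    by (simp add: filterlim_at)
  from tendsto_mult_left[OF filterlim_compose[OF zeta_pole this], of "1 / of_nat k"]
  show ?thesis using k0 by (simp add: algebra_simps)
qed

text \<open>Separates the pole of zeta(k s) at 1 / k from the integers, where Gamma and zeta(s - r)
  have their poles.\<close>

lemma integer_not_reciprocal: "of_int i \<noteq> (1 / of_nat k :: complex)"
proof
  assume "of_int i = (1 / of_nat k :: complex)"
  then have "of_int (i * int k) = (of_int 1 :: complex)" using k2 by (simp add: field_simps)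
  then have "i * int k = 1" unfolding of_int_eq_iff .
  then have "int k dvd 1" by (metis dvd_triv_right)
  then show False using k2 by simp
qed

lemma residue_at_0: "residue kernel 0 = - (1 / 2) * zeta (- of_int r)"
proof (rule kernel_residue)
  show "0 \<in> special_points" unfolding special_points_def by (intro insertI2 image_eqI[of _ _ 0]) auto
  have g: "((\<lambda>w. Gamma w * w) \<longlongrightarrow> 1) (at (0 :: complex))"
    using Gamma_residues[of 0, where 'a = complex] by simp
  \<comment> \<open>For r = -1 the poles of Gamma and of zeta(s - r) would coincide at 0 and form a
    double pole.\<close>
  have r: "(0 :: complex) \<noteq> 1 + of_int r"
    using r_ne by (metis add.commute add_eq_0_iff of_int_1 of_int_eq_iff of_int_minus)
  have "((\<lambda>w. (Gamma w * w) * zeta (of_nat k * w) * zeta (w - of_int r) * of_real x powr (- w)) \<longlongrightarrow>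
      1 * zeta (of_nat k * 0) * zeta (0 - of_int r) * of_real x powr (- 0)) (at 0)"
    by (intro tendsto_mult g x_powr_tendsto zeta_shift_tendsto zeta_scale_tendsto r) (use k2 in simp)
  then show "((\<lambda>w. kernel w * (w - 0)) \<longlongrightarrow> - (1 / 2) * zeta (- of_int r)) (at 0)"
    using x_pos by (simp add: kernel_def zeta_0 mult_ac)
qed

lemma residue_at_reciprocal:
  "residue kernel (1 / of_nat k) = 1 / of_nat k * Gamma (1 / of_nat k) * zeta (1 / of_nat k - of_int r) * of_real (x powr (- 1 / real k))"
proof (rule kernel_residue)
  show "1 / of_nat k \<in> special_points" by (simp add: special_points_def)
  have n: "(1 / of_nat k :: complex) \<notin> \<int>\<^sub>\<le>\<^sub>0"
    using k2 by (intro not_nonpos_Int_Re) (simp add: Re_divide_of_nat)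
  have "isCont Gamma (1 / of_nat k :: complex)" by (intro isCont_Gamma n continuous_ident)
  then have g: "(Gamma \<longlongrightarrow> Gamma (1 / of_nat k)) (at (1 / of_nat k :: complex))" by (simp add: isCont_def)
  have r: "1 / of_nat k \<noteq> (1 + of_int r :: complex)"
    using integer_not_reciprocal[of "1 + r"] by (metis of_int_1 of_int_add)
  have "((\<lambda>w. Gamma w * (zeta (of_nat k * w) * (w - 1 / of_nat k)) * zeta (w - of_int r) * of_real x powr (- w)) \<longlongrightarrow>
      Gamma (1 / of_nat k) * (1 / of_nat k) * zeta (1 / of_nat k - of_int r) * of_real x powr (- (1 / of_nat k))) (at (1 / of_nat k))"
    by (intro tendsto_mult g x_powr_tendsto zeta_shift_tendsto zeta_scale_pole r)
  moreover have "of_real x powr (- (1 / of_nat k)) = complex_of_real (x powr (- 1 / real k))"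
    using x_pos by (simp add: powr_of_real[symmetric])
  ultimately show "((\<lambda>w. kernel w * (w - 1 / of_nat k)) \<longlongrightarrow>
      1 / of_nat k * Gamma (1 / of_nat k) * zeta (1 / of_nat k - of_int r) * of_real (x powr (- 1 / real k))) (at (1 / of_nat k))"
    by (simp add: kernel_def mult_ac)
qed

lemma x_powr_of_int: "of_real x powr (of_int i) = complex_of_real (x powi i)"
  using x_pos by (subst complex_powr_of_int) auto

text \<open>Since k is even, -k m is a negative even integer, hence a trivial zero.\<close>

lemma k_times_neg_int:
  assumes "m \<ge> 1"
  shows "zeta (of_nat k * (- of_nat m)) = 0"
proof -
  obtain h where h: "k = 2 * h" using k_even by blast
  have "of_nat k * (- of_nat m) = (- of_nat (2 * (h * m)) :: complex)" by (simp add: h)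
  moreover have "h * m \<ge> 1" using assms k2 h by simp
  ultimately show ?thesis by (simp only: zeta_trivial_zero)
qed

lemma residue_at_shifted_pole: "residue kernel (1 + of_int r) = R_term k r x"
proof (rule kernel_residue)
  show "1 + of_int r \<in> special_points" by (simp add: special_points_def)
  define p where "p = (1 + of_int r :: complex)"
  have p_eq: "p = of_int (1 + r)" by (simp add: p_def)
  have kp: "of_nat k * p = of_int (int k * (1 + r))" by (simp add: p_def)
  have pk: "p \<noteq> 1 / of_nat k" unfolding p_eq by (rule integer_not_reciprocal)
  have xp: "of_real x powr (- p) = complex_of_real (x powi (- (1 + r)))"
    using x_powr_of_int[of "- (1 + r)"] by (simp add: p_def)
  have zp: "((\<lambda>w. zeta (w - of_int r) * (w - p)) \<longlongrightarrow> 1) (at p)"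
    unfolding p_def by (rule zeta_shift_pole)
  have "((\<lambda>w. kernel w * (w - p)) \<longlongrightarrow> R_term k r x) (at p)"
  proof (cases "r \<ge> 0")
    case True
    have "p \<notin> \<int>\<^sub>\<le>\<^sub>0" unfolding p_eq of_int_in_nonpos_Ints using True by simp
    then have "isCont Gamma p" by (intro isCont_Gamma continuous_ident)
    then have g: "(Gamma \<longlongrightarrow> Gamma p) (at p)" by (simp add: isCont_def)
    have Gp: "Gamma p = fact (nat r)"
      using Gamma_fact[of "nat r", where 'a = complex] True by (simp add: p_def)
    have "((\<lambda>w. Gamma w * zeta (of_nat k * w) * (zeta (w - of_int r) * (w - p)) * of_real x powr (- w)) \<longlongrightarrow>
       Gamma p * zeta (of_nat k * p) * 1 * of_real x powr (- p)) (at p)"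
      by (intro tendsto_mult g x_powr_tendsto zeta_scale_tendsto zp pk)
    then show ?thesis
      using True unfolding R_term_def xp kp Gp by (simp add: kernel_def mult_ac)
  next
    case False
    define m where "m = nat (- (1 + r))"
    have m: "m \<ge> 1" "1 + r = - int m" using False r_ne by (auto simp: m_def)
    have pm: "p = - of_nat m" unfolding p_eq m(2) by simp
    have g: "((\<lambda>w. Gamma w * (w - p)) \<longlongrightarrow> (-1) ^ m / fact m) (at p)"
      using Gamma_residues[of m, where 'a = complex] unfolding pm by simp
    define q where "q = of_nat k * p"
    have zq: "zeta q = 0" unfolding q_def pm by (rule k_times_neg_int[OF m(1)])
    have "q \<noteq> 1" using pk k2 by (auto simp: q_def field_simps)
    then have "(zeta has_field_derivative deriv zeta q) (at q)"
      by (intro holomorphic_derivI[OF holomorphic_zeta]) auto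
    then have "(zeta has_field_derivative deriv zeta q) (at (of_nat k * p))" by (simp add: q_def)
    moreover have "((\<lambda>w. of_nat k * w) has_field_derivative of_nat k) (at p)"
      by (auto intro!: derivative_eq_intros)
    ultimately have "((\<lambda>w. zeta (of_nat k * w)) has_field_derivative deriv zeta q * of_nat k) (at p)"
      by (rule DERIV_chain2)
    then have d: "((\<lambda>w. zeta (of_nat k * w) / (w - p)) \<longlongrightarrow> deriv zeta q * of_nat k) (at p)"
      using zq by (simp add: has_field_derivative_iff q_def)
    \<comment> \<open>For r < 0 a pole of Gamma, a zero of zeta(k s) and a pole of zeta(s - r) meet
      at p. The factor w - p is therefore distributed as a multiplication, a division and a
      multiplication by w - p; the chain rule puts the k in front of zeta'.\<close>
    have lim: "((\<lambda>w. (Gamma w * (w - p)) * (zeta (of_nat k * w) / (w - p)) * (zeta (w - of_int r) * (w - p)) * of_real x powr (- w)) \<longlongrightarrow>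
       (-1) ^ m / fact m * (deriv zeta q * of_nat k) * 1 * of_real x powr (- p)) (at p)"
      by (intro tendsto_mult g x_powr_tendsto d zp)
    have eq: "(-1) ^ m / fact m * (deriv zeta q * of_nat k) * 1 * of_real x powr (- p) = R_term k r x"
    proof -
      have "(-1) powi (1 + r) = ((-1) ^ m :: complex)"
        unfolding m(2) by (simp add: power_int_minus power_inverse[symmetric])
      then show ?thesis using False m unfolding R_term_def xp q_def kp m_def[symmetric] by simp
    qed
    have "eventually (\<lambda>w. (Gamma w * (w - p)) * (zeta (of_nat k * w) / (w - p)) * (zeta (w - of_int r) * (w - p)) * of_real x powr (- w)
        = kernel w * (w - p)) (at p)"
      by (auto simp: eventually_at_filter kernel_def)
    from Lim_transform_eventually[OF lim this] show ?thesis unfolding eq .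
  qed
  then show "((\<lambda>w. kernel w * (w - (1 + of_int r))) \<longlongrightarrow> R_term k r x) (at (1 + of_int r))"
    unfolding p_def .
qed

lemma residue_at_trivial:
  assumes m: "m \<ge> 1" "m \<le> nat \<bar>r\<bar> + 1" and ne: "- of_nat m \<noteq> (1 + of_int r :: complex)"
  shows "residue kernel (- of_nat m) = 0"
proof (rule kernel_residue)
  show "- of_nat m \<in> special_points" using m by (auto simp: special_points_def)
  have k: "- of_nat m \<noteq> (1 / of_nat k :: complex)"
    using integer_not_reciprocal[of "- int m"] by simp
  have g: "((\<lambda>w. Gamma w * (w - - of_nat m)) \<longlongrightarrow> (-1) ^ m / fact m) (at (- of_nat m :: complex))"
    using Gamma_residues[of m, where 'a = complex] by simp
  have "((\<lambda>w. (Gamma w * (w - - of_nat m)) * zeta (of_nat k * w) * zeta (w - of_int r) * of_real x powr (- w)) \<longlongrightarrow>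
      (-1) ^ m / fact m * zeta (of_nat k * (- of_nat m)) * zeta (- of_nat m - of_int r) * of_real x powr (- (- of_nat m))) (at (- of_nat m))"
    by (intro tendsto_mult g x_powr_tendsto zeta_shift_tendsto zeta_scale_tendsto k ne)
  then show "((\<lambda>w. kernel w * (w - - of_nat m)) \<longlongrightarrow> 0) (at (- of_nat m))"
    unfolding k_times_neg_int[OF m(1)] by (simp add: kernel_def mult_ac)
qed

lemma sum_residues:
  "(\<Sum>p\<in>special_points. residue kernel p) = - (1 / 2) * zeta (- of_int r)
     + 1 / of_nat k * Gamma (1 / of_nat k) * zeta (1 / of_nat k - of_int r) * of_real (x powr (- 1 / real k)) + R_term k r x"
proof -
  have "(\<Sum>p\<in>special_points. residue kernel p) = (\<Sum>p\<in>{0, 1 / of_nat k, 1 + of_int r}. residue kernel p)"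
  proof (rule sum.mono_neutral_right[OF finite_special_points])
    have "0 \<in> special_points" unfolding special_points_def by (intro insertI2 image_eqI[of _ _ 0]) auto
    moreover have "1 / of_nat k \<in> special_points" "1 + of_int r \<in> special_points"
      by (simp_all add: special_points_def)
    ultimately show "{0, 1 / of_nat k, 1 + of_int r} \<subseteq> special_points" by blast
    show "\<forall>p\<in>special_points - {0, 1 / of_nat k, 1 + of_int r}. residue kernel p = 0"
    proof
      fix p assume p: "p \<in> special_points - {0, 1 / of_nat k, 1 + of_int r}"
      then obtain m where m: "m \<le> nat \<bar>r\<bar> + 1" "p = - of_nat m" by (auto simp: special_points_def)
      moreover have "m \<ge> 1" using p m by (cases m) auto
      ultimately show "residue kernel p = 0" using p by (auto intro: residue_at_trivial)
    qed
  qed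
  moreover have "(0 :: complex) \<noteq> 1 / of_nat k" using k2 by simp
  moreover have "1 / of_nat k \<noteq> (1 + of_int r :: complex)"
    using integer_not_reciprocal[of "1 + r"] by (metis of_int_1 of_int_add)
  moreover have "(0 :: complex) \<noteq> 1 + of_int r"
    using r_ne by (metis add.commute add_eq_0_iff of_int_1 of_int_eq_iff of_int_minus)
  ultimately show ?thesis
    by (simp add: residue_at_0 residue_at_reciprocal residue_at_shifted_pole)
qed

text \<open>After the shift, the substitution t -> -t writes the points of the left line as 1 - u
  with u on the right line, the form that the reflection expects.\<close>

lemma kernel_shift:
  "integral\<^sup>L lborel (\<lambda>t. kernel (Complex line t)) = integral\<^sup>L lborel (\<lambda>t. kernel (1 - Complex line t))
     + 2 * of_real pi * (\<Sum>p\<in>special_points. residue kernel p)"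
proof -
  obtain C where C: "\<And>s. 1 - line \<le> Re s \<Longrightarrow> Re s \<le> line \<Longrightarrow> 1 \<le> \<bar>Im s\<bar> \<Longrightarrow> norm (kernel s) \<le> C / (1 + (Im s)\<^sup>2)"
    using kernel_bound by metis
  have V: "1 - line < line" "1 - line - 1 / 4 < 1 - line" "line < line + 1" by (auto simp: line_def)
  note shift = vertical_line_shift[OF V finite_special_points special_points_Re kernel_holomorphic C]
  have "integral\<^sup>L lborel (\<lambda>t. kernel (Complex (1 - line) t)) = integral\<^sup>L lborel (\<lambda>t. kernel (Complex (1 - line) (0 + (-1) * t)))"
    by (subst lborel_integral_real_affine[where c = "-1" and t = 0]) auto
  also have "\<dots> = integral\<^sup>L lborel (\<lambda>t. kernel (1 - Complex line t))"
    by (intro Bochner_Integration.integral_cong refl arg_cong[of _ _ kernel]) (simp add: complex_eq_iff)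
  finally show ?thesis using shift(3) by (simp add: algebra_simps)
qed

section \<open>Termwise integration on both sides\<close>

lemma lambert_series_sums:
  "(\<lambda>n. of_real (D_sum k r (Suc n) * exp (- real (Suc n) * x))) sums
     (integral\<^sup>L lborel (\<lambda>t. kernel (Complex line t)) / (2 * of_real pi))"
proof -
  define h where "h n t = Gamma (Complex line t) * of_real (real (Suc n) * x) powr (- Complex line t)" for n t
  have l0: "line > 0" by (simp add: line_def)
  have y: "real (Suc n) * x > 0" for n using x_pos by simp
  have h: "integrable lborel (h n)" "integral\<^sup>L lborel (h n) = 2 * of_real pi * of_real (exp (- real (Suc n) * x))" for n
    using Cahen_Mellin[OF y l0, of n] unfolding h_def by (simp_all only: mult_minus_left)
  have split: "of_real (real (Suc n) * x) powr (- z) = of_real x powr (- z) * of_nat (Suc n) powr (- z)" for n and z :: complex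
  proof -
    have "Ln (of_real (real (Suc n) * x)) = of_real (ln x) + of_real (ln (real (Suc n)))"
      using x_pos Ln_of_real[OF y[of n]] by (simp add: ln_mult del: of_nat_Suc)
    then show ?thesis using x_pos y[of n]
      by (simp add: powr_def Ln_of_real Ln_of_nat algebra_simps exp_add[symmetric] exp_diff exp_minus divide_inverse del: of_nat_Suc)
  qed
  have s1: "1 < Re (of_nat k * Complex line t - of_nat 0)" and s2: "1 < Re (Complex line t - of_int r)" for t
  proof -
    have "1 * 1 < real k * line" using k2 by (intro mult_strict_mono) (auto simp: line_def)
    then show "1 < Re (of_nat k * Complex line t - of_nat 0)" by simp
    show "1 < Re (Complex line t - of_int r)" by (simp add: line_def)
  qed
  have k0: "k > 0" using k2 by simp
  note Dir = power_divisor_Dirichlet_series[OF k0 s1 s2, folded D_sum_eq]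
  have "(\<lambda>n. integral\<^sup>L lborel (\<lambda>t. of_real (D_sum k r (Suc n)) * h n t)) sums integral\<^sup>L lborel (\<lambda>t. kernel (Complex line t))"
  proof (rule sums_integral_dominated(2))
    show "integrable lborel (\<lambda>t. of_real (D_sum k r (Suc n)) * h n t)" for n
      using h by (intro integrable_mult_right)
    show "integrable lborel (\<lambda>t. norm (h 0 t))" using h by (intro integrable_norm)
    show "summable (\<lambda>n. norm (of_real (D_sum k r (Suc n)) * of_nat (Suc n) powr (- Complex line 0)))"
      using Dir(2)[of 0] .
    show "(\<lambda>n. of_real (D_sum k r (Suc n)) * h n t) sums kernel (Complex line t)" for t
      using sums_mult[OF Dir(1)[of t], of "Gamma (Complex line t) * of_real x powr (- Complex line t)"]
      unfolding h_def split kernel_def by (simp add: mult_ac del: of_nat_Suc)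
    \<comment> \<open>The n-th term is bounded by the modulus of the Dirichlet term at t = 0, which
      is summable, times the integrable |h 0 t|, where \<open>h 0\<close> belongs to the summand n =
      1 of the theorem.\<close>
    show "norm (of_real (D_sum k r (Suc n)) * h n t) \<le> norm (of_real (D_sum k r (Suc n)) * of_nat (Suc n) powr (- Complex line 0)) * norm (h 0 t)" for n t
    proof -
      have "norm (of_nat (Suc n) powr (- Complex line t)) = norm (of_nat (Suc n) powr (- Complex line 0))"
        using norm_powr_real_powr[of "of_nat (Suc n)"] by (simp del: of_nat_Suc)
      then have "norm (h n t) = norm (of_nat (Suc n) powr (- Complex line 0)) * norm (h 0 t)"
        unfolding h_def split norm_mult by simp
      then show ?thesis by (simp add: norm_mult mult_ac del: of_nat_Suc)
    qed
  qed
  from sums_divide[OF this, of "2 * of_real pi"] show ?thesis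
    by (simp add: h field_simps del: of_nat_Suc)
qed

definition dual_integrand :: "int \<Rightarrow> real \<Rightarrow> complex" where
  "dual_integrand j t = meijer_integrand params (X_abs k x 1) (X_arg j) (Complex line t) * dual_zeta (Complex line t)"

definition dual_term :: "int \<Rightarrow> nat \<Rightarrow> complex" where
  "dual_term j n = of_real (S_sum k r (Suc n)) * meijer_G params (X_abs k x (Suc n)) (X_arg j)"

text \<open>The domination is the same as for the Lambert series. The line lies to the right of the
  poles of the Meijer integrand and in the half-plane where the Dirichlet series of
  \<open>S_sum\<close> converges absolutely.\<close>

lemma meijer_series:
  assumes j: "j \<in> odd_range k"
  shows "integrable lborel (dual_integrand j)"
    and "dual_term j sums
      (integral\<^sup>L lborel (dual_integrand j) / (2 * of_real pi))"
proof -
  define g where "g n t = meijer_integrand params (X_abs k x (Suc n)) (X_arg j) (Complex line t)" for n t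
  note M = meijer_G_line[OF params_real X_arg_bound[OF j] line_gt]
  have g: "integrable lborel (g n)" "integral\<^sup>L lborel (g n) = 2 * of_real pi * meijer_G params (X_abs k x (Suc n)) (X_arg j)" for n
    unfolding g_def by (rule M)+
  have u: "Re (Complex line t) > 1" "Re (Complex line t) > 1 - of_int r" for t by (simp_all add: line_def)
  have k0: "k > 0" using k2 by simp
  have "real k * (line - 1) > 0" using k2 by (simp add: line_def)
  then have s1: "1 < Re (of_nat k * Complex line t - of_nat (k - 1))" for t using k2 by (simp add: of_nat_diff algebra_simps)
  have s2: "1 < Re (Complex line t - of_int (- r))" for t by (simp add: line_def)
  define b where "b n = norm (of_real (S_sum k r (Suc n)) * of_nat (Suc n) powr (- Complex line 0) :: complex)" for n
  have b: "summable b"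
    unfolding b_def S_sum_eq by (rule power_divisor_Dirichlet_series(2)[OF k0 s1 s2])
  have le: "norm (of_real (S_sum k r (Suc n)) * g n t) \<le> b n * norm (g 0 t)" for n t
  proof -
    have "norm (of_nat (Suc n) powr (- Complex line t)) = norm (of_nat (Suc n) powr (- Complex line 0))"
      using norm_powr_real_powr[of "of_nat (Suc n)"] by (simp del: of_nat_Suc)
    moreover have "g n t = g 0 t * of_nat (Suc n) powr (- Complex line t)"
      unfolding g_def using meijer_integrand_X_abs[of "Suc n" "X_arg j"] by simp
    ultimately show ?thesis by (simp add: b_def norm_mult mult_ac del: of_nat_Suc)
  qed
  have F: "(\<lambda>n. of_real (S_sum k r (Suc n)) * g n t) sums (g 0 t * dual_zeta (Complex line t))" for t
    using meijer_series_sums[OF u, of "X_arg j"] unfolding g_def by simp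
  have g_dual: "(\<lambda>t. g 0 t * dual_zeta (Complex line t)) = dual_integrand j"
    by (simp add: fun_eq_iff g_def dual_integrand_def)
  have int: "integrable lborel (\<lambda>t. of_real (S_sum k r (Suc n)) * g n t)" for n
    using g by (intro integrable_mult_right)
  have G: "integrable lborel (\<lambda>t. norm (g 0 t))" using g by (intro integrable_norm)
  note dom = sums_integral_dominated[OF int G le b F, unfolded g_dual]
  show "integrable lborel (dual_integrand j)" by (rule dom(1))
  from sums_divide[OF dom(2), of "2 * of_real pi"]
  show "dual_term j sums (integral\<^sup>L lborel (dual_integrand j) / (2 * of_real pi))"
    by (simp add: g dual_term_def[abs_def])
qed

lemma kernel_dual_integral:
  "integral\<^sup>L lborel (\<lambda>t. kernel (1 - Complex line t)) / (2 * of_real pi) = dual_const * (\<Sum>j\<in>odd_range k. \<i> powi j *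
      suminf (dual_term j))"
proof -
  have m: "integrable lborel (dual_integrand j)" if "j \<in> odd_range k" for j
    by (rule meijer_series(1)[OF that])
  have refl: "kernel (1 - Complex line t) = dual_const * (\<Sum>j\<in>odd_range k. \<i> powi j * dual_integrand j t)" for t
    unfolding dual_integrand_def
  proof (rule kernel_reflection)
    \<comment> \<open>A zero of the sine would make the abscissa an integer, but 2 * line = 2 |r| +
      5 is odd.\<close>
    have "of_real pi * Complex line t \<noteq> of_int n * of_real pi" for n
    proof
      assume "of_real pi * Complex line t = of_int n * of_real pi"
      then have "Complex line t = of_int n" by simp
      then have "line = of_int n" by (simp add: complex_eq_iff)
      then have "2 * \<bar>r\<bar> + 5 = 2 * n" by (simp add: line_def)
      then show False by presburger
    qed
    then show "sin (of_real pi * Complex line t) \<noteq> 0" by (auto simp: sin_eq_0 mult.commute)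
  qed (auto simp: line_def)
  have "integral\<^sup>L lborel (\<lambda>t. kernel (1 - Complex line t)) = dual_const * (\<Sum>j\<in>odd_range k. \<i> powi j * integral\<^sup>L lborel (dual_integrand j))"
    unfolding refl using m by (simp add: Bochner_Integration.integral_sum)
  moreover have "integral\<^sup>L lborel (dual_integrand j) = 2 * of_real pi * suminf (dual_term j)"
    if "j \<in> odd_range k" for j
    using meijer_series(2)[OF that] by (simp add: sums_iff)
  ultimately have "integral\<^sup>L lborel (\<lambda>t. kernel (1 - Complex line t)) = 2 * of_real pi * (dual_const * (\<Sum>j\<in>odd_range k. \<i> powi j *
      suminf (dual_term j)))"
    by (simp add: sum_distrib_left mult_ac)
  then show ?thesis by simp
qed

definition main_terms :: complex where
  "main_terms = - (1 / 2) * zeta (- of_int r)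
     + 1 / of_nat k * Gamma (1 / of_nat k) * zeta (1 / of_nat k - of_int r) * of_real (x powr (- 1 / real k))
     + R_term k r x"

theorem lambert_series_transformation:
  "(\<forall>j\<in>odd_range k. summable (dual_term j)) \<and>
   (\<lambda>n. of_real (D_sum k r (Suc n) * exp (- real (Suc n) * x))) sums
     (main_terms + dual_const * (\<Sum>j\<in>odd_range k. \<i> powi j * suminf (dual_term j)))"
proof
  show "\<forall>j\<in>odd_range k. summable (dual_term j)"
    using meijer_series(2) sums_summable by blast
  have "integral\<^sup>L lborel (\<lambda>t. kernel (Complex line t)) / (2 * of_real pi)
     = main_terms + dual_const * (\<Sum>j\<in>odd_range k. \<i> powi j * suminf (dual_term j))"
    unfolding kernel_shift add_divide_distrib kernel_dual_integral sum_residues main_terms_def by simp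
  then show "(\<lambda>n. of_real (D_sum k r (Suc n) * exp (- real (Suc n) * x))) sums
     (main_terms + dual_const * (\<Sum>j\<in>odd_range k. \<i> powi j * suminf (dual_term j)))"
    using lambert_series_sums by simp
qed

end

text \<open>The convergence of every series of Meijer functions is asserted first, so that the
  infinite sums in the second part have their proper meaning. Indices are shifted by one, and the
  division by 2 in the exponent of -1 is exact because r is odd.\<close>

theorem theorem3p4:
  fixes k :: nat and r :: int and x :: real
  defines "J \<equiv> {j \<in> {- (int k - 1)..int k - 1}. [j = int k - 1] (mod 2)}"
    and "bs \<equiv> of_int r # map (\<lambda>l. - (of_nat l / of_nat k)) [1..<k]"
  assumes "k \<ge> 2" and "even k" and "odd r" and "r \<noteq> -1" and "x > 0"
  shows "(\<forall>j\<in>J. summable (\<lambda>n. of_real (S_sum k r (Suc n)) * meijer_G bs (X_abs k x (Suc n)) (X_arg j))) \<and>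
    (\<lambda>n. of_real (D_sum k r (Suc n) * exp (- real (Suc n) * x))) sums
      (- (1 / 2) * zeta (- of_int r)
       + 1 / of_nat k * Gamma (1 / of_nat k) * zeta (1 / of_nat k - of_int r) * of_real (x powr (- 1 / real k))
       + R_term k r x
       + (- 1) powi ((2 * int k + r - 1) div 2)
           * of_real ((2 * pi) powr ((real k + 1 - 2 * of_int r) / 2) / (x * real k powr ((2 * real k - 1) / 2)))
           * (\<Sum>j\<in>J. \<i> powi j *
               (\<Sum>n. of_real (S_sum k r (Suc n)) * meijer_G bs (X_abs k x (Suc n)) (X_arg j))))"
proof -
  interpret lambert_transform k r x
    using assms by unfold_locales auto
  show ?thesis
    using lambert_series_transformation unfolding J_def bs_def odd_range_def params_def dual_const_def
      main_terms_def dual_term_def[abs_def] .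
qed

end
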